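(* Let $0<\Lambda_1\le\Lambda_2<\infty$, let $n^\ast:=\frac{\Lambda_1}{\Lambda_2}(n-1)+1$ and let $p^\ast_+$, $p^\ast_-$ be the critical exponents described in the context. (i) If $n^\ast>2$ and $1<p<p^\ast_+$, then there exists no non-trivial nonnegative continuous viscosity solution $u$ of $$\mathcal M^+_{\Lambda_1,\Lambda_2}(D^2u)+u^p=0\quad\text{in }\mathbb R^n$$ satisfying $u(x)=o\big(|x|^{-\frac{2}{p-1}}\big)$ as $|x|\to\infty$. (ii) If $n^\ast>2$ and $1<p<p^\ast_-$, then there exists no non-trivial nonnegative continuous viscosity solution $u$ of $$\mathcal M^-_{\Lambda_1,\Lambda_2}(D^2u)+u^p=0\quad\text{in }\mathbb R^n$$ satisfying $u(x)=o\big(|x|^{-\frac{2}{p-1}}\big)$ as $|x|\to\infty$.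
   Context: For a real symmetric $n\times n$ matrix $M$ with eigenvalues $e_1,\dots,e_n$, the Pucci extremal operators are $$\mathcal M^+_{\Lambda_1,\Lambda_2}(M)=\Lambda_2\sum_{e_i>0}e_i+\Lambda_1\sum_{e_i<0}e_i,\qquad \mathcal M^-_{\Lambda_1,\Lambda_2}(M)=\Lambda_1\sum_{e_i>0}e_i+\Lambda_2\sum_{e_i<0}e_i.$$ A continuous $u:\mathbb R^n\to\mathbb R$ is a viscosity supersolution (resp. subsolution) of $G(D^2u)+u^p=0$ in $\mathbb R^n$ if, whenever $\phi\in C^2(\mathbb R^n)$ and $u-\phi$ has a local minimum (resp. maximum) at $x_0$, one has $G(D^2\phi(x_0))+u(x_0)^p\le0$ (resp. $\ge0$). A viscosity solution is both. The exponents $p^\ast_\pm$ (depending on $\Lambda_1,\Lambda_2,n$) are those given by the following known theorem of Felmer and Quaas, which is taken as part of the setting. Put also $n_\ast:=\frac{\Lambda_2}{\Lambda_1}(n-1)+1$. (i) For $\mathcal M^+_{\Lambda_1,\Lambda_2}(D^2u)+u^p=0$ in $\mathbb R^n$ there exists no non-trivial nonnegative radially symmetric solution if $1<p<p^\ast_+$ and $n^\ast>2$, where $\max\{\frac{n^\ast}{n^\ast-2},\frac{n+2}{n-2}\}<p^\ast_+<\frac{n^\ast+2}{n^\ast-2}$. (ii) For $\mathcal M^-_{\Lambda_1,\Lambda_2}(D^2u)+u^p=0$ in $\mathbb R^n$ there exists no non-trivial nonnegative radially symmetric solution if $1<p<p^\ast_-$, where $\frac{n_\ast+2}{n_\ast-2}<p^\ast_-<\frac{n+2}{n-2}$.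 *)

theory Defs
  imports
    "HOL-Analysis.Analysis"
    "HOL-Computational_Algebra.Polynomial"
    "HOL-Library.Landau_Symbols"
begin

definition charpoly :: "real ^ 'n ^ 'n \<Rightarrow> real poly" where
  "charpoly M = det (mat [:0, 1:] - (\<chi> i j. [:M $ i $ j:]))"

text \<open>For symmetric \<open>M\<close> all roots of the characteristic polynomial are real, so this is the full
  list \<open>e\<^sub>1, \<dots>, e\<^sub>n\<close>, with multiplicities. The Pucci operators below are meaningful for symmetric
  arguments only.\<close>

definition eigenvalues :: "real ^ 'n ^ 'n \<Rightarrow> real multiset" where
  "eigenvalues M = proots (charpoly M)"

definition pucci_plus :: "real \<Rightarrow> real \<Rightarrow> real ^ 'n ^ 'n \<Rightarrow> real" where
  "pucci_plus \<Lambda>\<^sub>1 \<Lambda>\<^sub>2 M =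
     \<Lambda>\<^sub>2 * (\<Sum>e\<in>#filter_mset (\<lambda>e. e > 0) (eigenvalues M). e) +
     \<Lambda>\<^sub>1 * (\<Sum>e\<in>#filter_mset (\<lambda>e. e < 0) (eigenvalues M). e)"

definition pucci_minus :: "real \<Rightarrow> real \<Rightarrow> real ^ 'n ^ 'n \<Rightarrow> real" where
  "pucci_minus \<Lambda>\<^sub>1 \<Lambda>\<^sub>2 M =
     \<Lambda>\<^sub>1 * (\<Sum>e\<in>#filter_mset (\<lambda>e. e > 0) (eigenvalues M). e) +
     \<Lambda>\<^sub>2 * (\<Sum>e\<in>#filter_mset (\<lambda>e. e < 0) (eigenvalues M). e)"

text \<open>\<open>\<phi>\<close> is twice continuously differentiable on the whole space, with Hessian matrix \<open>H x\<close> at \<open>x\<close>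
  (symmetric by Schwarz's theorem).\<close>

definition C2_with_hessian :: "(real ^ 'n \<Rightarrow> real) \<Rightarrow> (real ^ 'n \<Rightarrow> real ^ 'n ^ 'n) \<Rightarrow> bool" where
  "C2_with_hessian \<phi> H \<longleftrightarrow>
     (\<exists>g. (\<forall>x. (\<phi> has_derivative (\<lambda>h. g x \<bullet> h)) (at x)) \<and>
          (\<forall>x. (g has_derivative (\<lambda>h. H x *v h)) (at x)) \<and>
          continuous_on UNIV H)"

definition local_min_at :: "(real ^ 'n \<Rightarrow> real) \<Rightarrow> real ^ 'n \<Rightarrow> bool" where
  "local_min_at f x\<^sub>0 \<longleftrightarrow> (\<forall>\<^sub>F x in nhds x\<^sub>0. f x\<^sub>0 \<le> f x)"

definition local_max_at :: "(real ^ 'n \<Rightarrow> real) \<Rightarrow> real ^ 'n \<Rightarrow> bool" where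
  "local_max_at f x\<^sub>0 \<longleftrightarrow> (\<forall>\<^sub>F x in nhds x\<^sub>0. f x \<le> f x\<^sub>0)"

text \<open>Viscosity notions for \<open>G (D\<^sup>2 u) + u\<^sup>p = 0\<close> in the whole space. The power is \<open>powr\<close>, which is the
  usual power for nonnegative \<open>u\<close> and \<open>p > 0\<close> (with \<open>0 powr p = 0\<close>).\<close>

definition viscosity_supersolution ::
    "(real ^ 'n ^ 'n \<Rightarrow> real) \<Rightarrow> real \<Rightarrow> (real ^ 'n \<Rightarrow> real) \<Rightarrow> bool" where
  "viscosity_supersolution G p u \<longleftrightarrow> continuous_on UNIV u \<and>
     (\<forall>\<phi> H x\<^sub>0. C2_with_hessian \<phi> H \<and> local_min_at (\<lambda>x. u x - \<phi> x) x\<^sub>0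
        \<longrightarrow> G (H x\<^sub>0) + u x\<^sub>0 powr p \<le> 0)"

definition viscosity_subsolution ::
    "(real ^ 'n ^ 'n \<Rightarrow> real) \<Rightarrow> real \<Rightarrow> (real ^ 'n \<Rightarrow> real) \<Rightarrow> bool" where
  "viscosity_subsolution G p u \<longleftrightarrow> continuous_on UNIV u \<and>
     (\<forall>\<phi> H x\<^sub>0. C2_with_hessian \<phi> H \<and> local_max_at (\<lambda>x. u x - \<phi> x) x\<^sub>0
        \<longrightarrow> G (H x\<^sub>0) + u x\<^sub>0 powr p \<ge> 0)"

definition viscosity_solution ::
    "(real ^ 'n ^ 'n \<Rightarrow> real) \<Rightarrow> real \<Rightarrow> (real ^ 'n \<Rightarrow> real) \<Rightarrow> bool" where
  "viscosity_solution G p u \<longleftrightarrow> viscosity_supersolution G p u \<and> viscosity_subsolution G p u"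

definition radially_symmetric :: "(real ^ 'n \<Rightarrow> real) \<Rightarrow> bool" where
  "radially_symmetric u \<longleftrightarrow> (\<forall>x y. norm x = norm y \<longrightarrow> u x = u y)"

definition no_radial_solution :: "(real ^ 'n ^ 'n \<Rightarrow> real) \<Rightarrow> real \<Rightarrow> bool" where
  "no_radial_solution G p \<longleftrightarrow>
     (\<nexists>u. viscosity_solution G p u \<and> (\<forall>x. u x \<ge> 0) \<and> (\<exists>x. u x \<noteq> 0) \<and> radially_symmetric u)"

definition n_upper :: "real \<Rightarrow> real \<Rightarrow> real \<Rightarrow> real" where
  "n_upper \<Lambda>\<^sub>1 \<Lambda>\<^sub>2 n = \<Lambda>\<^sub>1 / \<Lambda>\<^sub>2 * (n - 1) + 1"

definition n_lower :: "real \<Rightarrow> real \<Rightarrow> real \<Rightarrow> real" where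
  "n_lower \<Lambda>\<^sub>1 \<Lambda>\<^sub>2 n = \<Lambda>\<^sub>2 / \<Lambda>\<^sub>1 * (n - 1) + 1"

text \<open>The properties that the theorem of Felmer and Quaas attributes to the critical exponents in
  dimension \<open>CARD('n)\<close>. Their bounds are strict when \<open>\<Lambda>\<^sub>1 < \<Lambda>\<^sub>2\<close>. For \<open>\<Lambda>\<^sub>1 = \<Lambda>\<^sub>2\<close> the lower and upper bounds
  coincide (all are \<open>(n + 2) / (n - 2)\<close>), so strict inequalities would be contradictory there;
  the non-strict ones cover both cases.\<close>

definition felmer_quaas_plus :: "'n::finite itself \<Rightarrow> real \<Rightarrow> real \<Rightarrow> real \<Rightarrow> bool" where
  "felmer_quaas_plus _ \<Lambda>\<^sub>1 \<Lambda>\<^sub>2 q \<longleftrightarrow>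
     (let n = real CARD('n); n' = n_upper \<Lambda>\<^sub>1 \<Lambda>\<^sub>2 n in
       (\<forall>p. 1 < p \<and> p < q \<longrightarrow> no_radial_solution (pucci_plus \<Lambda>\<^sub>1 \<Lambda>\<^sub>2 :: real ^ 'n ^ 'n \<Rightarrow> real) p) \<and>
       max (n' / (n' - 2)) ((n + 2) / (n - 2)) \<le> q \<and> q \<le> (n' + 2) / (n' - 2))"

definition felmer_quaas_minus :: "'n::finite itself \<Rightarrow> real \<Rightarrow> real \<Rightarrow> real \<Rightarrow> bool" where
  "felmer_quaas_minus _ \<Lambda>\<^sub>1 \<Lambda>\<^sub>2 q \<longleftrightarrow>
     (let n = real CARD('n); n' = n_lower \<Lambda>\<^sub>1 \<Lambda>\<^sub>2 n in
       (\<forall>p. 1 < p \<and> p < q \<longrightarrow> no_radial_solution (pucci_minus \<Lambda>\<^sub>1 \<Lambda>\<^sub>2 :: real ^ 'n ^ 'n \<Rightarrow> real) p) \<and>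
       (n' + 2) / (n' - 2) \<le> q \<and> q \<le> (n + 2) / (n - 2))"

end

theory Submission
  imports Defs "HOL-Probability.Distributions"
begin

text \<open>Suppose a nontrivial decaying solution \<open>u\<close> exists. The method of moving planes shows that \<open>u\<close> is
radially symmetric about some point; a translate of \<open>u\<close> is then a radial solution, which the
theorem of Felmer and Quaas excludes.

\<^bold>\<open>The difference of two solutions.\<close> Moving planes compares \<open>u\<close> with its reflection
\<open>u \<circ> \<sigma>\<close>, so it needs an inequality for \<open>u \<circ> \<sigma> - u\<close>, where both functions solve the equation only
in the viscosity sense. Usually this comes from the theorem on sums and hence from Alexandrov's
theorem. Here the structure of the operators allows something more elementary. The operator
\<open>\<M>\<^sup>+\<close> is the maximum of the linear operators \<open>X \<mapsto> A \<bullet> X\<close> over the elliptic matrices \<open>A\<close>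
(\<open>elliptic_le_pucci_plus\<close>, \<open>pucci_plus_attained\<close>), so a supersolution for \<open>\<M>\<^sup>+\<close> is a supersolution
for each of them, and constant coefficient linear inequalities survive mollification. Hence a
supersolution is a uniform limit of \<^emph>\<open>smooth\<close> approximate supersolutions
(\<open>smooth_supersolution_approximation\<close>). These are legitimate test functions for a subsolution, and
sublinearity of \<open>\<M>\<^sup>+\<close> gives the inequality for the difference
(\<open>difference_is_supersolution\<close>). The operator \<open>\<M>\<^sup>-\<close> is treated by changing signs.

\<^bold>\<open>Mollification in the viscosity sense.\<close> That a viscosity supersolution \<open>a\<close> of
\<open>A \<bullet> D\<^sup>2 a + f \<le> 0\<close> mollifies is proved with the heat semigroup \<open>P\<^sub>t\<close> of \<open>A\<close>, given by an
explicit Gaussian kernel. The smooth function \<open>P\<^sub>t a + t P\<^sub>t f - t \<epsilon>\<close> is, for small times, a strict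
subsolution of the parabolic equation that starts at \<open>a\<close>, so it stays below \<open>a\<close>
(\<open>supersolution_dominates_heat_flow\<close>): at a first violation it would touch \<open>a\<close> from below. Convolving
this integral inequality with a fixed smooth kernel and letting \<open>t \<rightarrow> 0\<close> gives the
differential inequality for the mollified function (\<open>mollified_linear_supersolution\<close>).

\<^bold>\<open>Moving planes.\<close> Write \<open>w\<close> for the difference of the reflected function and \<open>u\<close> in the half space
beyond the reflecting plane. Where \<open>w\<close> is negative it satisfies a linear inequality with potential at
most \<open>p u\<^sup>p\<^sup>-\<^sup>1\<close>, and the decay hypothesis says exactly that this is \<open>o(|x|\<^sup>-\<^sup>2)\<close>. One explicit
barrier, \<open>(1 + |x|\<^sup>2)\<^sup>-\<^sup>s\<^sup>/\<^sup>2 (2 - e\<^sup>-\<^sup>B\<^sup>\<tau>)\<close> with \<open>\<tau>\<close> the distance to the plane, is a strict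
supersolution both far out and in a thin strip along the plane; the first uses \<open>n\<^sup>* > 2\<close>, which
leaves room for an exponent \<open>0 < s < n\<^sup>* - 2\<close>. Therefore negativity of \<open>w\<close> can only originate in a
bounded region away from the plane (\<open>nonneg_difference_localised\<close>). The planes can thus be started
at infinity and moved on, by the strong maximum principle, until \<open>w\<close> vanishes identically
(\<open>symmetric_hyperplane\<close>). Symmetry in the coordinate directions produces a centre, and decay forces
all other symmetry planes through it (\<open>radial_about_a_point\<close>).\<close>

section \<open>Symmetric matrices and the Pucci operators\<close>

definition diag_mat :: "('n \<Rightarrow> 'a::zero) \<Rightarrow> 'a ^ 'n ^ 'n" where
  "diag_mat d = (\<chi> i j. if i = j then d i else 0)"

definition outer :: "real ^ 'n \<Rightarrow> real ^ 'n \<Rightarrow> real ^ 'n ^ 'n" where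
  "outer a b = (\<chi> i j. a $ i * b $ j)"

lemma dot_lmul_symmetric:
  fixes M :: "real ^ 'n ^ 'n"
  assumes "transpose M = M"
  shows "x \<bullet> (M *v y) = (M *v x) \<bullet> y"
proof -
  have "x v* M = M *v x" using vector_transpose_matrix[of x M] assms by simp
  then show ?thesis using dot_lmul_matrix[of x M y] by simp
qed

lemma linear_term_vanishes:
  fixes a b :: real
  assumes "\<And>t. t * a + t\<^sup>2 * b \<le> 0"
  shows "a = 0"
proof (rule ccontr)
  assume "a \<noteq> 0"
  define t where "t = a / (\<bar>b\<bar> + 1)"
  have "a / D * a + (a / D)\<^sup>2 * b = a\<^sup>2 / D * (1 + b / D)" if "D > 0" for D
    using that by (simp add: field_simps power2_eq_square)
  from this[of "\<bar>b\<bar> + 1"] have "t * a + t\<^sup>2 * b = a\<^sup>2 / (\<bar>b\<bar> + 1) * (1 + b / (\<bar>b\<bar> + 1))"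
    by (simp add: t_def)
  moreover have "a\<^sup>2 / (\<bar>b\<bar> + 1) > 0" using \<open>a \<noteq> 0\<close> by (simp add: add_nonneg_pos)
  moreover have "1 + b / (\<bar>b\<bar> + 1) > 0" by (simp add: field_simps add_nonneg_pos)
  ultimately have "t * a + t\<^sup>2 * b > 0" by (metis mult_pos_pos)
  with assms[of t] show False by simp
qed

text \<open>A maximiser of the Rayleigh quotient on the unit sphere of \<open>S\<close> is an eigenvector: the first
variation vanishes in all directions of \<open>S\<close>, and \<open>M v - c v\<close> is itself such a direction.\<close>
lemma eigenvector_in_invariant_subspace:
  fixes M :: "real ^ 'n ^ 'n"
  assumes sym: "transpose M = M" and S: "subspace S"
    and inv: "\<And>x. x \<in> S \<Longrightarrow> M *v x \<in> S" and ne: "\<exists>x\<in>S. x \<noteq> 0"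
  obtains v c where "v \<in> S" "norm v = 1" "M *v v = c *\<^sub>R v"
proof -
  let ?K = "S \<inter> sphere 0 1"
  have "compact ?K" using S by (intro closed_Int_compact closed_subspace) auto
  moreover have "?K \<noteq> {}"
  proof -
    obtain x where "x \<in> S" "x \<noteq> 0" using ne by blast
    then have "x /\<^sub>R norm x \<in> ?K" using S by (auto simp: subspace_scale)
    then show ?thesis by blast
  qed
  moreover have "continuous_on ?K (\<lambda>x. x \<bullet> (M *v x))"
    by (intro continuous_intros linear_continuous_on_compose[OF continuous_on_id] matrix_vector_mul_linear)
  ultimately obtain v where v: "v \<in> ?K" and vmax: "\<And>y. y \<in> ?K \<Longrightarrow> y \<bullet> (M *v y) \<le> v \<bullet> (M *v v)"
    using continuous_attains_sup[of ?K "\<lambda>x. x \<bullet> (M *v x)"] by blast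
  define c where "c = v \<bullet> (M *v v)"
  have v1: "v \<in> S" "norm v = 1" "v \<bullet> v = 1" using v by (auto simp: norm_eq_1)
  have quad: "x \<bullet> (M *v x) \<le> c * (x \<bullet> x)" if "x \<in> S" for x
  proof (cases "x = 0")
    case False
    define y where "y = x /\<^sub>R norm x"
    have "y \<in> ?K" using False that S by (auto simp: y_def subspace_scale)
    then have "y \<bullet> (M *v y) \<le> c" unfolding c_def by (rule vmax)
    moreover have "x \<bullet> (M *v x) = (norm x)\<^sup>2 * (y \<bullet> (M *v y))"
      using False by (simp add: y_def matrix_vector_mult_scaleR power2_eq_square field_simps)
    ultimately show ?thesis by (simp add: power2_norm_eq_inner mult.commute[of c] mult_left_mono)
  qed simp
  have orth: "h \<bullet> (M *v v - c *\<^sub>R v) = 0" if h: "h \<in> S" for h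
  proof -
    \<comment> \<open>first variation of the Rayleigh quotient in the direction \<open>h\<close>\<close>
    have "t * (2 * (h \<bullet> (M *v v - c *\<^sub>R v))) + t\<^sup>2 * (h \<bullet> (M *v h) - c * (h \<bullet> h)) \<le> 0" for t
    proof -
      have "v + t *\<^sub>R h \<in> S" using v1 h S by (simp add: subspace_add subspace_scale)
      from quad[OF this] have "(v + t *\<^sub>R h) \<bullet> (M *v (v + t *\<^sub>R h)) \<le> c * ((v + t *\<^sub>R h) \<bullet> (v + t *\<^sub>R h))" .
      moreover have "v \<bullet> (M *v h) = h \<bullet> (M *v v)" using dot_lmul_symmetric[OF sym] by (metis inner_commute)
      ultimately show ?thesis using c_def v1(3)
        by (simp add: matrix_vector_right_distrib matrix_vector_mult_scaleR inner_simps inner_commute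
            algebra_simps power2_eq_square)
    qed
    then have "2 * (h \<bullet> (M *v v - c *\<^sub>R v)) = 0" by (rule linear_term_vanishes)
    then show ?thesis by simp
  qed
  have "M *v v - c *\<^sub>R v \<in> S" using v1 inv S by (simp add: subspace_diff subspace_scale)
  from orth[OF this] have "M *v v = c *\<^sub>R v" by simp
  with v1 that show ?thesis by blast
qed

text \<open>An orthonormal system of eigenvectors of maximal size spans the space: its orthogonal complement is
invariant under \<open>M\<close> and would otherwise contain one more eigenvector.\<close>
theorem spectral_theorem_symmetric:
  fixes M :: "real ^ 'n ^ 'n"
  assumes sym: "transpose M = M"
  obtains P d where "orthogonal_matrix P" "M = P ** diag_mat d ** transpose P"
proof -
  define good where "good B \<longleftrightarrow> finite B \<and> pairwise orthogonal B \<and> (\<forall>v\<in>B. norm v = 1 \<and> (\<exists>c. M *v v = c *\<^sub>R v))"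
    for B :: "(real ^ 'n) set"
  have indep: "independent B" if "good B" for B
    using that by (intro pairwise_orthogonal_independent) (auto simp: good_def)
  have bound: "card B \<le> CARD('n)" if "good B" for B
    using independent_bound[OF indep[OF that]] by simp
  have "good {}" by (simp add: good_def)
  then obtain B where B: "good B" and Bmax: "\<And>B'. good B' \<Longrightarrow> card B' \<le> card B"
    using ex_has_greatest_nat[of good "{}" card "Suc CARD('n)"] bound by (auto simp: less_Suc_eq_le)
  have spanB: "span B = UNIV"
  proof (rule ccontr)
    assume "span B \<noteq> UNIV"
    define S where "S = {x. \<forall>b\<in>B. x \<bullet> b = 0}"
    have "subspace S" by (auto simp: S_def subspace_def inner_simps)
    moreover have "M *v x \<in> S" if x: "x \<in> S" for x
    proof -
      { fix b assume b: "b \<in> B"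
        then obtain c where "M *v b = c *\<^sub>R b" using B good_def by blast
        then have "(M *v x) \<bullet> b = c * (x \<bullet> b)" using dot_lmul_symmetric[OF sym, of x b] by simp
        then have "(M *v x) \<bullet> b = 0" using x b by (simp add: S_def) }
      then show ?thesis by (simp add: S_def)
    qed
    moreover have "\<exists>x\<in>S. x \<noteq> 0"
    proof -
      have "dim B < DIM(real ^ 'n)" using \<open>span B \<noteq> UNIV\<close>
        by (metis dim_eq_full dim_subset_UNIV le_neq_implies_less)
      then obtain x where "x \<noteq> 0" "\<And>y. y \<in> span B \<Longrightarrow> orthogonal x y"
        using orthogonal_to_subspace_exists by metis
      then show ?thesis unfolding S_def orthogonal_def by (blast intro: span_base)
    qed
    ultimately obtain v c where v: "v \<in> S" "norm v = 1" "M *v v = c *\<^sub>R v"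
      by (meson eigenvector_in_invariant_subspace[OF sym])
    have "v \<notin> B" using v by (auto simp: S_def norm_eq_1)
    moreover have "good (insert v B)"
      using B v by (auto simp: good_def S_def pairwise_insert orthogonal_def inner_commute)
    ultimately show False using Bmax[of "insert v B"] B by (simp add: good_def)
  qed
  have "card B = CARD('n)"
    using dim_span_eq_card_independent[OF indep[OF B]] spanB by simp
  then obtain f where f: "bij_betw f (UNIV :: 'n set) B"
    using B finite_same_card_bij[of "UNIV :: 'n set" B] by (auto simp: good_def)
  then have fB: "f i \<in> B" for i by (auto simp: bij_betw_def)
  define P :: "real ^ 'n ^ 'n" where "P = (\<chi> i j. f j $ i)"
  have col: "column j P = f j" for j by (simp add: column_def P_def vec_eq_iff)
  have orthP: "orthogonal_matrix P"
    unfolding orthogonal_matrix_orthonormal_columns col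
  proof (intro conjI allI impI)
    fix i j :: 'n
    show "norm (f i) = 1" using fB B good_def by blast
    assume "i \<noteq> j"
    then have "f i \<noteq> f j" using f by (auto simp: bij_betw_def inj_on_def)
    then show "orthogonal (f i) (f j)" using B fB unfolding good_def pairwise_def by blast
  qed
  have "\<forall>i. \<exists>c. M *v f i = c *\<^sub>R f i" using fB B good_def by blast
  then obtain d where d: "\<And>i. M *v f i = d i *\<^sub>R f i" by metis
  have MP: "M ** P = P ** diag_mat d"
  proof -
    have "(M ** P) $ i $ j = (P ** diag_mat d) $ i $ j" for i j
    proof -
      have "(M ** P) $ i $ j = (M *v f j) $ i"
        by (simp add: matrix_matrix_mult_def matrix_vector_mult_def P_def)
      also have "\<dots> = d j * f j $ i" by (simp add: d)
      also have "\<dots> = (P ** diag_mat d) $ i $ j"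
        by (simp add: matrix_matrix_mult_def diag_mat_def P_def if_distrib[of "\<lambda>x. _ * x"] sum.delta' cong: if_cong)
      finally show ?thesis .
    qed
    then show ?thesis by (simp add: vec_eq_iff)
  qed
  have "P ** transpose P = mat 1" using orthP by (simp add: orthogonal_matrix_def)
  then have "M = P ** diag_mat d ** transpose P"
    by (metis MP matrix_mul_assoc matrix_mul_rid)
  with orthP that show ?thesis by blast
qed

text \<open>The characteristic polynomial is a determinant over the polynomial ring, so conjugation of real
matrices has to be carried out there.\<close>
definition const_mat :: "real ^ 'n ^ 'n \<Rightarrow> real poly ^ 'n ^ 'n" where
  "const_mat A = (\<chi> i j. [:A $ i $ j:])"

lemma sum_const_poly: "(\<Sum>k\<in>S. [:f k:]) = [:\<Sum>k\<in>S. f k :: real:]"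
  by (induction S rule: infinite_finite_induct) auto

lemma const_mat_mult: "const_mat (A ** B) = const_mat A ** const_mat B"
  by (simp add: const_mat_def matrix_matrix_mult_def vec_eq_iff sum_const_poly mult.commute)

lemma const_mat_1: "const_mat (mat 1) = mat 1"
  by (auto simp: const_mat_def mat_def vec_eq_iff)

lemma mat_scalar_commute:
  fixes A :: "'a::comm_semiring_1 ^ 'n ^ 'n"
  shows "mat x ** A = A ** mat x"
proof -
  have "(mat x ** A) $ i $ j = x * A $ i $ j" for i j
    by (simp add: matrix_matrix_mult_def mat_def if_distrib[of "\<lambda>y. y * _"] cong: if_cong)
  moreover have "(A ** mat x) $ i $ j = A $ i $ j * x" for i j
    by (simp add: matrix_matrix_mult_def mat_def if_distrib[of "\<lambda>y. _ * y"] cong: if_cong)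
  ultimately show ?thesis by (simp add: vec_eq_iff mult.commute)
qed

lemma matrix_diff_ldistrib: "A ** (B - C) = A ** B - A ** (C :: 'a::comm_ring_1 ^ 'n ^ 'm)"
  by (simp add: vec_eq_iff matrix_matrix_mult_def right_diff_distrib sum_subtractf)

lemma matrix_diff_rdistrib: "(A - B) ** C = A ** C - B ** (C :: 'a::comm_ring_1 ^ 'n ^ 'm)"
  by (simp add: vec_eq_iff matrix_matrix_mult_def left_diff_distrib sum_subtractf)

lemma charpoly_similar:
  fixes X P Q :: "real ^ 'n ^ 'n"
  assumes "P ** Q = mat 1"
  shows "charpoly (P ** X ** Q) = charpoly X"
proof -
  let ?x = "mat [:0, 1:] :: real poly ^ 'n ^ 'n"
  have PQ: "const_mat P ** const_mat Q = mat 1"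
    using assms by (metis const_mat_1 const_mat_mult)
  have "const_mat P ** ?x ** const_mat Q = ?x"
    by (metis PQ mat_scalar_commute matrix_mul_assoc matrix_mul_rid)
  then have "?x - const_mat (P ** X ** Q) = const_mat P ** (?x - const_mat X) ** const_mat Q"
    by (simp add: const_mat_mult matrix_diff_ldistrib matrix_diff_rdistrib)
  then have "det (?x - const_mat (P ** X ** Q)) = det (const_mat P ** const_mat Q) * det (?x - const_mat X)"
    by (simp add: det_mul mult_ac)
  then show ?thesis by (simp add: charpoly_def PQ flip: const_mat_def)
qed

lemma eigenvalues_diagonalised:
  fixes P :: "real ^ 'n ^ 'n"
  assumes "orthogonal_matrix P"
  shows "eigenvalues (P ** diag_mat d ** transpose P) = image_mset d (mset_set UNIV)"
proof -
  have "charpoly (P ** diag_mat d ** transpose P) = charpoly (diag_mat d)"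
    using assms by (intro charpoly_similar) (simp add: orthogonal_matrix_def)
  also have "\<dots> = (\<Prod>i\<in>UNIV. [:- d i, 1:])"
    unfolding charpoly_def by (subst det_diagonal) (auto simp: diag_mat_def mat_def)
  finally show ?thesis
    by (simp add: eigenvalues_def proots_prod sum_unfold_sum_mset)
qed

text \<open>Symmetric matrices with spectrum in \<open>[l, L]\<close>, stated through the quadratic form. Since the inner product
\<open>A \<bullet> X\<close> of matrices is the trace of \<open>A X\<close> when \<open>A\<close> is symmetric, these are the coefficients of the
linear operators whose maximum is the Pucci operator.\<close>
definition elliptic :: "real \<Rightarrow> real \<Rightarrow> real ^ 'n ^ 'n \<Rightarrow> bool" where
  "elliptic l L A \<longleftrightarrow> transpose A = A \<and> (\<forall>x. l * (x \<bullet> x) \<le> x \<bullet> (A *v x) \<and> x \<bullet> (A *v x) \<le> L * (x \<bullet> x))"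

lemma inner_outer: "A \<bullet> outer a b = a \<bullet> (A *v b)"
  by (simp add: inner_vec_def outer_def matrix_vector_mult_def sum_distrib_left mult_ac)

lemma inner_mat_1: "A \<bullet> mat 1 = trace (A :: real ^ 'n ^ 'n)"
  by (simp add: inner_vec_def mat_def trace_def if_distrib[of "\<lambda>y. _ * y"] sum.delta sum.delta' cong: if_cong)

lemma diagonalised_as_sum:
  "P ** diag_mat d ** transpose P = (\<Sum>i\<in>UNIV. d i *\<^sub>R outer (column i P) (column i P))"
  by (simp add: vec_eq_iff matrix_matrix_mult_def diag_mat_def transpose_def outer_def column_def
      if_distrib[of "\<lambda>y. _ * y"] if_distrib[of "\<lambda>y. y * _"] sum.delta sum.delta' mult_ac cong: if_cong)

lemma inner_diagonalised:
  "A \<bullet> (P ** diag_mat d ** transpose P) = (\<Sum>i\<in>UNIV. d i * (column i P \<bullet> (A *v column i P)))"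
  by (simp add: diagonalised_as_sum inner_sum_right inner_outer)

lemma transpose_diagonalised:
  fixes P :: "real ^ 'n ^ 'n"
  shows "transpose (P ** diag_mat d ** transpose P) = P ** diag_mat d ** transpose P"
proof -
  have "transpose (diag_mat d) = diag_mat d" by (auto simp: diag_mat_def transpose_def vec_eq_iff)
  then show ?thesis by (simp add: matrix_transpose_mul transpose_transpose matrix_mul_assoc)
qed

lemma diagonalised_quadratic:
  fixes P :: "real ^ 'n ^ 'n"
  shows "x \<bullet> ((P ** diag_mat d ** transpose P) *v x) = (\<Sum>i\<in>UNIV. d i * (column i P \<bullet> x)\<^sup>2)"
proof -
  have "x \<bullet> ((P ** diag_mat d ** transpose P) *v x) = outer x x \<bullet> (P ** diag_mat d ** transpose P)"
    by (simp add: inner_outer inner_commute[of "outer x x"])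
  also have "\<dots> = (\<Sum>i\<in>UNIV. d i * (column i P \<bullet> (outer x x *v column i P)))" by (rule inner_diagonalised)
  also have "\<dots> = (\<Sum>i\<in>UNIV. d i * (column i P \<bullet> x)\<^sup>2)"
  proof (intro sum.cong refl arg_cong2[where f="(*)"])
    fix i
    have "outer x x *v column i P = (x \<bullet> column i P) *\<^sub>R x"
      by (simp add: outer_def matrix_vector_mult_def inner_vec_def vec_eq_iff sum_distrib_left sum_distrib_right mult_ac)
    then show "column i P \<bullet> (outer x x *v column i P) = (column i P \<bullet> x)\<^sup>2"
      by (simp add: power2_eq_square inner_commute)
  qed
  finally show ?thesis .
qed

lemma orthogonal_columns_parseval:
  fixes P :: "real ^ 'n ^ 'n"
  assumes "orthogonal_matrix P"
  shows "(\<Sum>i\<in>UNIV. (column i P \<bullet> x)\<^sup>2) = x \<bullet> x"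
proof -
  have "diag_mat (\<lambda>_. 1::real) = (mat 1 :: real ^ 'n ^ 'n)" by (simp add: diag_mat_def mat_def)
  then show ?thesis using diagonalised_quadratic[of x P "\<lambda>_. 1"] assms by (simp add: orthogonal_matrix_def)
qed

lemma column_orthogonal_unit:
  fixes P :: "real ^ 'n ^ 'n"
  assumes "orthogonal_matrix P"
  shows "column i P \<bullet> column i P = 1"
  using assms unfolding orthogonal_matrix_orthonormal_columns by (simp add: norm_eq_1)

lemma inner_columns_orthogonal:
  fixes P :: "real ^ 'n ^ 'n"
  assumes "orthogonal_matrix P"
  shows "column j P \<bullet> column i P = (if j = i then 1 else 0)"
  using assms column_orthogonal_unit[OF assms] unfolding orthogonal_matrix_orthonormal_columns orthogonal_def by auto

lemma diagonalised_quadratic_column: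
  fixes P :: "real ^ 'n ^ 'n"
  assumes "orthogonal_matrix P"
  shows "column i P \<bullet> ((P ** diag_mat d ** transpose P) *v column i P) = d i"
  unfolding diagonalised_quadratic inner_columns_orthogonal[OF assms]
  by (simp add: if_distrib[of "\<lambda>y. y\<^sup>2"] if_distrib[of "\<lambda>y. _ * y"] sum.delta cong: if_cong)

lemma elliptic_diagonalised:
  fixes P :: "real ^ 'n ^ 'n"
  assumes P: "orthogonal_matrix P" and d: "\<And>i. l \<le> d i \<and> d i \<le> L"
  shows "elliptic l L (P ** diag_mat d ** transpose P)"
  unfolding elliptic_def transpose_diagonalised diagonalised_quadratic orthogonal_columns_parseval[OF P, symmetric]
    sum_distrib_left
  using d by (auto intro!: sum_mono mult_right_mono)

lemma filter_sum_mset_image: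
  "(\<Sum>e\<in>#filter_mset Q (image_mset d (mset_set (UNIV :: 'n::finite set))). e) = (\<Sum>i\<in>UNIV. if Q (d i) then d i else (0::real))"
proof -
  have "(\<Sum>e\<in>#filter_mset Q (image_mset d (mset_set S)). e) = (\<Sum>i\<in>S. if Q (d i) then d i else (0::real))"
    if "finite S" for S :: "'n set"
    using that by (induction rule: finite_induct) auto
  then show ?thesis by simp
qed

lemma pucci_plus_diagonalised:
  fixes P :: "real ^ 'n ^ 'n"
  assumes "orthogonal_matrix P"
  shows "pucci_plus l L (P ** diag_mat d ** transpose P) = (\<Sum>i\<in>UNIV. (if d i > 0 then L else l) * d i)"
proof -
  have "pucci_plus l L (P ** diag_mat d ** transpose P)
      = (\<Sum>i\<in>UNIV. L * (if d i > 0 then d i else 0) + l * (if d i < 0 then d i else 0))"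
    unfolding pucci_plus_def eigenvalues_diagonalised[OF assms] filter_sum_mset_image
    by (simp add: sum_distrib_left sum.distrib)
  also have "\<dots> = (\<Sum>i\<in>UNIV. (if d i > 0 then L else l) * d i)"
    by (intro sum.cong) auto
  finally show ?thesis .
qed

lemma pucci_minus_diagonalised:
  fixes P :: "real ^ 'n ^ 'n"
  assumes "orthogonal_matrix P"
  shows "pucci_minus l L (P ** diag_mat d ** transpose P) = (\<Sum>i\<in>UNIV. (if d i > 0 then l else L) * d i)"
proof -
  have "pucci_minus l L (P ** diag_mat d ** transpose P)
      = (\<Sum>i\<in>UNIV. l * (if d i > 0 then d i else 0) + L * (if d i < 0 then d i else 0))"
    unfolding pucci_minus_def eigenvalues_diagonalised[OF assms] filter_sum_mset_image
    by (simp add: sum_distrib_left sum.distrib)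
  also have "\<dots> = (\<Sum>i\<in>UNIV. (if d i > 0 then l else L) * d i)"
    by (intro sum.cong) auto
  finally show ?thesis .
qed

text \<open>Changing the sign of \<open>X\<close> exchanges positive and negative eigenvalues. This reduces all statements about
\<open>\<M>\<^sup>-\<close> to \<open>\<M>\<^sup>+\<close>.\<close>
lemma pucci_minus_eq:
  fixes X :: "real ^ 'n ^ 'n"
  assumes "transpose X = X"
  shows "pucci_minus l L X = - pucci_plus l L (- X)"
proof -
  obtain P d where P: "orthogonal_matrix P" and X: "X = P ** diag_mat d ** transpose P"
    using spectral_theorem_symmetric[OF assms] .
  have "- X = P ** diag_mat (\<lambda>i. - d i) ** transpose P"
    by (simp add: X diagonalised_as_sum sum_negf)
  then have "pucci_plus l L (- X) = (\<Sum>i\<in>UNIV. (if - d i > 0 then L else l) * (- d i))"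
    using pucci_plus_diagonalised[OF P] by metis
  also have "\<dots> = - (\<Sum>i\<in>UNIV. (if d i > 0 then l else L) * d i)"
    unfolding sum_negf[symmetric] by (intro sum.cong) auto
  finally show ?thesis by (simp add: X pucci_minus_diagonalised[OF P])
qed

text \<open>In an eigenbasis of \<open>X\<close> the product \<open>A \<bullet> X\<close> is a sum of eigenvalues of \<open>X\<close> weighted by diagonal
entries of \<open>A\<close>, which lie in \<open>[l, L]\<close>.\<close>
lemma elliptic_le_pucci_plus:
  fixes X :: "real ^ 'n ^ 'n"
  assumes A: "elliptic l L A" and X: "transpose X = X"
  shows "A \<bullet> X \<le> pucci_plus l L X"
proof -
  obtain P d where P: "orthogonal_matrix P" and X: "X = P ** diag_mat d ** transpose P"
    using spectral_theorem_symmetric[OF X] .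
  have "l \<le> column i P \<bullet> (A *v column i P)" "column i P \<bullet> (A *v column i P) \<le> L" for i
    using A column_orthogonal_unit[OF P, of i] unfolding elliptic_def by (metis mult.right_neutral)+
  then show ?thesis
    unfolding X inner_diagonalised pucci_plus_diagonalised[OF P]
    by (intro sum_mono) (auto simp: mult.commute[of L] mult.commute[of l] mult_left_mono mult_left_mono_neg)
qed

text \<open>The maximising \<open>A\<close> is diagonal in the eigenbasis of \<open>X\<close>, with \<open>L\<close> on the positive and \<open>l\<close> on the
remaining eigendirections.\<close>
lemma pucci_plus_attained:
  fixes X :: "real ^ 'n ^ 'n"
  assumes X: "transpose X = X" and "l \<le> L"
  obtains A where "elliptic l L A" "A \<bullet> X = pucci_plus l L X"
proof -
  obtain P d where P: "orthogonal_matrix P" and X: "X = P ** diag_mat d ** transpose P"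
    using spectral_theorem_symmetric[OF X] .
  define a where "a i = (if d i > 0 then L else l)" for i
  define A where "A = P ** diag_mat a ** transpose P"
  have "elliptic l L A" unfolding A_def using \<open>l \<le> L\<close> by (intro elliptic_diagonalised[OF P]) (auto simp: a_def)
  moreover have "column i P \<bullet> (A *v column i P) = a i" for i
    unfolding A_def by (rule diagonalised_quadratic_column[OF P])
  ultimately show ?thesis
    using that[of A] by (simp add: X inner_diagonalised pucci_plus_diagonalised[OF P] a_def mult.commute)
qed

lemma pucci_plus_leI:
  fixes X :: "real ^ 'n ^ 'n"
  assumes "transpose X = X" "l \<le> L" "\<And>A. elliptic l L A \<Longrightarrow> A \<bullet> X \<le> c"
  shows "pucci_plus l L X \<le> c"
  using pucci_plus_attained[OF assms(1,2)] assms(3) by metis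

lemma transpose_add: "transpose (X + Y) = transpose X + transpose (Y :: real ^ 'n ^ 'm)"
  by (simp add: transpose_def vec_eq_iff)

lemma transpose_minus: "transpose (- X) = - transpose (X :: real ^ 'n ^ 'm)"
  by (simp add: transpose_def vec_eq_iff)

lemma transpose_scaleR: "transpose (c *\<^sub>R X) = c *\<^sub>R transpose (X :: real ^ 'n ^ 'm)"
  by (simp add: transpose_def vec_eq_iff)

lemma transpose_outer: "transpose (outer a b) = outer b a"
  by (simp add: transpose_def vec_eq_iff outer_def)

lemma pucci_plus_subadditive:
  fixes X :: "real ^ 'n ^ 'n"
  assumes "transpose X = X" "transpose Y = Y" "l \<le> L"
  shows "pucci_plus l L (X + Y) \<le> pucci_plus l L X + pucci_plus l L Y"
proof (rule pucci_plus_leI)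
  show "A \<bullet> (X + Y) \<le> pucci_plus l L X + pucci_plus l L Y" if "elliptic l L A" for A
    using elliptic_le_pucci_plus[OF that assms(1)] elliptic_le_pucci_plus[OF that assms(2)]
    by (simp add: inner_add_right)
qed (use assms in \<open>auto simp: transpose_add\<close>)

lemma elliptic_bilinear_bound:
  fixes A :: "real ^ 'n ^ 'n"
  assumes A: "elliptic l L A" and "0 \<le> l"
  shows "\<bar>x \<bullet> (A *v y)\<bar> \<le> L * (norm x * norm y)"
proof -
  have sym: "transpose A = A" using A by (simp add: elliptic_def)
  have lo: "0 \<le> z \<bullet> (A *v z)" for z
    using A \<open>0 \<le> l\<close> unfolding elliptic_def by (meson inner_ge_zero mult_nonneg_nonneg order_trans)
  have unit: "x \<bullet> (A *v y) \<le> L" if "norm x = 1" "norm y = 1" for x y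
  proof -
    have "4 * (x \<bullet> (A *v y)) = (x + y) \<bullet> (A *v (x + y)) - (x - y) \<bullet> (A *v (x - y))"
      using dot_lmul_symmetric[OF sym, of y x]
      by (simp add: matrix_vector_right_distrib matrix_vector_mult_diff_distrib inner_simps inner_commute)
    also have "\<dots> \<le> L * ((x + y) \<bullet> (x + y)) + L * ((x - y) \<bullet> (x - y))"
      using A lo[of "x - y"] lo[of "x + y"] unfolding elliptic_def
      by (smt (verit, ccfv_threshold))
    also have "\<dots> = 4 * L" using that by (simp add: norm_eq_1 inner_simps inner_commute algebra_simps)
    finally show ?thesis by simp
  qed
  have "x \<bullet> (A *v y) \<le> L * (norm x * norm y)" for x y
  proof (cases "x = 0 \<or> y = 0")
    case False
    define x' where "x' = x /\<^sub>R norm x" define y' where "y' = y /\<^sub>R norm y"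
    have "x \<bullet> (A *v y) = (norm x * norm y) * (x' \<bullet> (A *v y'))"
      using False by (simp add: x'_def y'_def matrix_vector_mult_scaleR field_simps)
    moreover have "x' \<bullet> (A *v y') \<le> L" using False by (intro unit) (auto simp: x'_def y'_def)
    ultimately show ?thesis by (metis mult.commute mult_left_mono mult_nonneg_nonneg norm_ge_zero)
  qed auto
  from this[of x y] this[of "- x" y] show ?thesis by (simp add: abs_le_iff)
qed

lemma elliptic_norm_bound:
  fixes A :: "real ^ 'n ^ 'n"
  assumes A: "elliptic l L A" and "0 \<le> l"
  shows "norm A \<le> (real CARD('n))\<^sup>2 * L"
proof -
  have "\<bar>A $ i $ j\<bar> \<le> L" for i j
  proof -
    have "A $ i $ j = axis i 1 \<bullet> (A *v axis j 1)"
      by (simp add: matrix_vector_mul_component inner_axis' inner_axis)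
    then show ?thesis using elliptic_bilinear_bound[OF assms, of "axis i 1" "axis j 1"] by simp
  qed
  then have "(\<Sum>i\<in>UNIV. \<Sum>j\<in>UNIV. \<bar>A $ i $ j\<bar>) \<le> (\<Sum>i\<in>(UNIV::'n set). \<Sum>j\<in>(UNIV::'n set). L)"
    by (intro sum_mono)
  moreover have "norm A \<le> (\<Sum>i\<in>UNIV. norm (A $ i))" unfolding norm_vec_def by (rule L2_set_le_sum) simp
  moreover have "(\<Sum>i\<in>UNIV. norm (A $ i)) \<le> (\<Sum>i\<in>UNIV. \<Sum>j\<in>UNIV. \<bar>A $ i $ j\<bar>)"
    by (intro sum_mono norm_le_l1_cart)
  ultimately show ?thesis by (simp add: power2_eq_square mult.assoc)
qed

lemma pucci_plus_le_norm:
  fixes X :: "real ^ 'n ^ 'n"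
  assumes "transpose X = X" "0 \<le> l" "l \<le> L"
  shows "pucci_plus l L X \<le> (real CARD('n))\<^sup>2 * L * norm X"
proof (rule pucci_plus_leI)
  show "A \<bullet> X \<le> (real CARD('n))\<^sup>2 * L * norm X" if "elliptic l L A" for A
    using Cauchy_Schwarz_ineq2[of A X] elliptic_norm_bound[OF that assms(2)]
    by (smt (verit) mult_right_mono norm_ge_zero)
qed (use assms in auto)

text \<open>One direction contributes its own quadratic form, each of the \<open>n - 1\<close> others at least \<open>l\<close>. The slack in
this bound is what makes \<open>|x|\<^sup>-\<^sup>s\<close> a supersolution for \<open>s < n\<^sup>* - 2\<close>.\<close>
lemma elliptic_trace_lower_bound:
  fixes A :: "real ^ 'n ^ 'n"
  assumes A: "elliptic l L A" and x: "norm x = 1"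
  shows "x \<bullet> (A *v x) + (real CARD('n) - 1) * l \<le> trace A"
proof -
  define B where "B = A - l *\<^sub>R mat 1"
  have Bq: "y \<bullet> (B *v y) = y \<bullet> (A *v y) - l * (y \<bullet> y)" for y
    by (simp add: B_def matrix_vector_mult_diff_rdistrib inner_diff_right scaleR_matrix_vector_assoc[symmetric])
  have "transpose B = B" using A
    by (auto simp: B_def elliptic_def transpose_def vec_eq_iff mat_def)
  then obtain P d where P: "orthogonal_matrix P" and B: "B = P ** diag_mat d ** transpose P"
    using spectral_theorem_symmetric[of B] by blast
  have d0: "0 \<le> d i" for i
  proof -
    have "column i P \<bullet> (B *v column i P) = d i" unfolding B by (rule diagonalised_quadratic_column[OF P])
    moreover have "0 \<le> column i P \<bullet> (B *v column i P)" unfolding Bq using A by (simp add: elliptic_def)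
    ultimately show ?thesis by simp
  qed
  have tr: "trace B = (\<Sum>i\<in>UNIV. d i)"
  proof -
    have "trace B = mat 1 \<bullet> B" by (simp add: inner_mat_1[symmetric] inner_commute)
    also have "\<dots> = (\<Sum>i\<in>UNIV. d i)" unfolding B inner_diagonalised
      by (simp add: column_orthogonal_unit[OF P])
    finally show ?thesis .
  qed
  have "x \<bullet> (B *v x) \<le> (\<Sum>i\<in>UNIV. d i)" unfolding B diagonalised_quadratic
  proof (intro sum_mono)
    fix i
    have "\<bar>column i P \<bullet> x\<bar> \<le> 1"
      using Cauchy_Schwarz_ineq2[of "column i P" x] x column_orthogonal_unit[OF P, of i] by (simp add: norm_eq_sqrt_inner)
    then have "(column i P \<bullet> x)\<^sup>2 \<le> 1" by (simp add: abs_square_le_1)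
    then show "d i * (column i P \<bullet> x)\<^sup>2 \<le> d i" using d0[of i] by (simp add: mult_left_le)
  qed
  moreover have "trace B = trace A - l * real CARD('n)"
    by (simp add: B_def trace_def mat_def sum_subtractf sum_distrib_left)
  moreover have "x \<bullet> x = 1" using x by (simp add: norm_eq_1)
  ultimately show ?thesis using tr by (simp add: Bq algebra_simps)
qed

section \<open>Calculus of twice differentiable functions\<close>

text \<open>\<open>C2_with_hessian\<close> with the gradient made explicit, so that derivatives of composite functions can be
computed.\<close>
definition C2_jet :: "(real ^ 'n \<Rightarrow> real) \<Rightarrow> (real ^ 'n \<Rightarrow> real ^ 'n) \<Rightarrow> (real ^ 'n \<Rightarrow> real ^ 'n ^ 'n) \<Rightarrow> bool" where
  "C2_jet \<phi> g H \<longleftrightarrow>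
     (\<forall>x. (\<phi> has_derivative (\<lambda>h. g x \<bullet> h)) (at x)) \<and>
     (\<forall>x. (g has_derivative (\<lambda>h. H x *v h)) (at x)) \<and>
     continuous_on UNIV H"

lemma C2_jet_hessian: "C2_jet \<phi> g H \<Longrightarrow> C2_with_hessian \<phi> H"
  by (auto simp: C2_jet_def C2_with_hessian_def)

lemma C2_with_hessianE:
  assumes "C2_with_hessian \<phi> H"
  obtains g where "C2_jet \<phi> g H"
  using assms by (auto simp: C2_jet_def C2_with_hessian_def)

lemma C2_jetD:
  assumes "C2_jet \<phi> g H"
  shows "(\<phi> has_derivative (\<lambda>h. g x \<bullet> h)) (at x)" "(g has_derivative (\<lambda>h. H x *v h)) (at x)"
    "continuous_on UNIV H" "continuous_on UNIV \<phi>" "continuous_on UNIV g"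
proof -
  show 1: "(\<phi> has_derivative (\<lambda>h. g x \<bullet> h)) (at x)" "(g has_derivative (\<lambda>h. H x *v h)) (at x)" for x
    using assms by (auto simp: C2_jet_def)
  show "continuous_on UNIV H" using assms by (simp add: C2_jet_def)
  show "continuous_on UNIV \<phi>" "continuous_on UNIV g"
    using 1[THEN has_derivative_continuous] by (simp_all add: continuous_on_eq_continuous_within)
qed

lemma outer_mult: "outer a b *v h = (b \<bullet> h) *\<^sub>R a"
  by (simp add: outer_def matrix_vector_mult_def inner_vec_def vec_eq_iff sum_distrib_left sum_distrib_right mult_ac)

lemma continuous_on_outer:
  assumes "continuous_on S f" "continuous_on S g"
  shows "continuous_on S (\<lambda>x. outer (f x) (g x))"
  unfolding outer_def by (intro continuous_on_vec_lambda continuous_on_mult continuous_on_component assms)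

lemma C2_jet_const: "C2_jet (\<lambda>x. c) (\<lambda>x. 0) (\<lambda>x. 0)"
  by (auto simp: C2_jet_def intro!: derivative_eq_intros)

lemma C2_jet_linear: "C2_jet (\<lambda>x. e \<bullet> x) (\<lambda>x. e) (\<lambda>x. 0)"
  by (auto simp: C2_jet_def intro!: derivative_eq_intros)

lemma C2_jet_quadratic:
  assumes "transpose C = C"
  shows "C2_jet (\<lambda>x. x \<bullet> (C *v x)) (\<lambda>x. 2 *\<^sub>R (C *v x)) (\<lambda>x. 2 *\<^sub>R C)"
proof -
  have lin: "((*v) C has_derivative (*v) C) (at x)" for x
    by (rule bounded_linear_imp_has_derivative) (simp add: matrix_vector_mul_bounded_linear)
  have "((\<lambda>x. x \<bullet> (C *v x)) has_derivative (\<lambda>h. (2 *\<^sub>R (C *v x)) \<bullet> h)) (at x)" for x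
    by (rule has_derivative_eq_rhs[OF has_derivative_inner[OF has_derivative_ident lin]])
       (simp add: fun_eq_iff dot_lmul_symmetric[OF assms, of x] inner_commute[of _ "C *v x"])
  moreover have "((\<lambda>x. 2 *\<^sub>R (C *v x)) has_derivative (\<lambda>h. (2 *\<^sub>R C) *v h)) (at x)" for x
    by (rule has_derivative_eq_rhs[OF has_derivative_scaleR_right[OF lin]])
       (simp add: fun_eq_iff scaleR_matrix_vector_assoc)
  ultimately show ?thesis by (simp add: C2_jet_def)
qed

lemma C2_jet_scale:
  assumes "C2_jet f g H"
  shows "C2_jet (\<lambda>x. c * f x) (\<lambda>x. c *\<^sub>R g x) (\<lambda>x. c *\<^sub>R H x)"
  using assms unfolding C2_jet_def
  by (auto intro!: derivative_eq_intros continuous_intros simp: scaleR_matrix_vector_assoc)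

lemma C2_jet_add:
  assumes "C2_jet f g H" "C2_jet f' g' H'"
  shows "C2_jet (\<lambda>x. f x + f' x) (\<lambda>x. g x + g' x) (\<lambda>x. H x + H' x)"
  using assms unfolding C2_jet_def
  by (auto intro!: derivative_eq_intros continuous_intros simp: matrix_vector_mult_add_rdistrib inner_add_left)

lemma C2_jet_minus:
  assumes "C2_jet f g H"
  shows "C2_jet (\<lambda>x. - f x) (\<lambda>x. - g x) (\<lambda>x. - H x)"
  using C2_jet_scale[OF assms, of "-1"] by simp

lemma C2_jet_diff:
  assumes "C2_jet f g H" "C2_jet f' g' H'"
  shows "C2_jet (\<lambda>x. f x - f' x) (\<lambda>x. g x - g' x) (\<lambda>x. H x - H' x)"
  using C2_jet_add[OF assms(1) C2_jet_minus[OF assms(2)]] by simp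

lemma C2_jet_mult:
  assumes 1: "C2_jet f g H" and 2: "C2_jet f' g' H'"
  shows "C2_jet (\<lambda>x. f x * f' x) (\<lambda>x. f x *\<^sub>R g' x + f' x *\<^sub>R g x)
    (\<lambda>x. f x *\<^sub>R H' x + f' x *\<^sub>R H x + outer (g' x) (g x) + outer (g x) (g' x))"
  unfolding C2_jet_def
proof (intro conjI allI)
  note D = C2_jetD[OF 1] C2_jetD[OF 2]
  show "((\<lambda>x. f x * f' x) has_derivative (\<lambda>h. (f x *\<^sub>R g' x + f' x *\<^sub>R g x) \<bullet> h)) (at x)" for x
    by (rule has_derivative_eq_rhs[OF has_derivative_mult[OF D(1) D(6)]])
       (simp add: fun_eq_iff inner_add_left)
  show "((\<lambda>x. f x *\<^sub>R g' x + f' x *\<^sub>R g x) has_derivative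
      (\<lambda>h. (f x *\<^sub>R H' x + f' x *\<^sub>R H x + outer (g' x) (g x) + outer (g x) (g' x)) *v h)) (at x)" for x
    by (rule has_derivative_eq_rhs[OF has_derivative_add[OF
          has_derivative_scaleR[OF D(1) D(7)] has_derivative_scaleR[OF D(6) D(2)]]])
       (simp add: fun_eq_iff matrix_vector_mult_add_rdistrib outer_mult scaleR_matrix_vector_assoc)
  show "continuous_on UNIV (\<lambda>x. f x *\<^sub>R H' x + f' x *\<^sub>R H x + outer (g' x) (g x) + outer (g x) (g' x))"
    by (intro continuous_intros continuous_on_outer D)
qed

lemma C2_jet_compose:
  assumes 1: "C2_jet f g H"
    and d1: "\<And>x. (\<psi> has_real_derivative \<psi>' (f x)) (at (f x))"
    and d2: "\<And>x. (\<psi>' has_real_derivative \<psi>'' (f x)) (at (f x))"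
    and c: "continuous_on UNIV (\<lambda>x. \<psi>'' (f x))"
  shows "C2_jet (\<lambda>x. \<psi> (f x)) (\<lambda>x. \<psi>' (f x) *\<^sub>R g x) (\<lambda>x. \<psi>' (f x) *\<^sub>R H x + \<psi>'' (f x) *\<^sub>R outer (g x) (g x))"
  unfolding C2_jet_def
proof (intro conjI allI)
  note D = C2_jetD[OF 1]
  have d1': "((\<lambda>x. \<psi> (f x)) has_derivative (\<lambda>h. \<psi>' (f x) * (g x \<bullet> h))) (at x)" for x
    using has_derivative_compose[OF D(1) d1[unfolded has_field_derivative_def]] by simp
  have d2': "((\<lambda>x. \<psi>' (f x)) has_derivative (\<lambda>h. \<psi>'' (f x) * (g x \<bullet> h))) (at x)" for x
    using has_derivative_compose[OF D(1) d2[unfolded has_field_derivative_def]] by simp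
  show "((\<lambda>x. \<psi> (f x)) has_derivative (\<lambda>h. (\<psi>' (f x) *\<^sub>R g x) \<bullet> h)) (at x)" for x
    using d1'[of x] by simp
  show "((\<lambda>x. \<psi>' (f x) *\<^sub>R g x) has_derivative
       (\<lambda>h. (\<psi>' (f x) *\<^sub>R H x + \<psi>'' (f x) *\<^sub>R outer (g x) (g x)) *v h)) (at x)" for x
    by (rule has_derivative_eq_rhs[OF has_derivative_scaleR[OF d2' D(2)]])
      (simp add: fun_eq_iff matrix_vector_mult_add_rdistrib outer_mult scaleR_matrix_vector_assoc[symmetric])
  have "continuous_on UNIV (\<lambda>x. \<psi>' (f x))"
    using d2'[THEN has_derivative_continuous] by (simp add: continuous_on_eq_continuous_within)
  then show "continuous_on UNIV (\<lambda>x. \<psi>' (f x) *\<^sub>R H x + \<psi>'' (f x) *\<^sub>R outer (g x) (g x))"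
    by (intro continuous_intros continuous_on_outer D c)
qed

lemma C2_jet_affine:
  fixes R :: "real ^ 'n ^ 'n"
  assumes "C2_jet f g H"
  shows "C2_jet (\<lambda>x. f (R *v x + b)) (\<lambda>x. transpose R *v g (R *v x + b))
    (\<lambda>x. transpose R ** H (R *v x + b) ** R)"
  unfolding C2_jet_def
proof (intro conjI allI)
  note D = C2_jetD[OF assms]
  have lin: "((*v) C has_derivative (*v) C) (at x)" for x and C :: "real ^ 'n ^ 'n"
    by (rule bounded_linear_imp_has_derivative) (simp add: matrix_vector_mul_bounded_linear)
  have aff: "((\<lambda>x. R *v x + b) has_derivative (*v) R) (at x)" for x
    by (rule has_derivative_eq_rhs[OF has_derivative_add[OF lin has_derivative_const]]) simp
  have "(transpose R *v w) \<bullet> h = w \<bullet> (R *v h)" for w h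
    by (metis dot_lmul_matrix transpose_matrix_vector)
  then show "((\<lambda>x. f (R *v x + b)) has_derivative (\<lambda>h. (transpose R *v g (R *v x + b)) \<bullet> h)) (at x)" for x
    using has_derivative_compose[OF aff D(1)] by simp
  show "((\<lambda>x. transpose R *v g (R *v x + b)) has_derivative (\<lambda>h. (transpose R ** H (R *v x + b) ** R) *v h)) (at x)" for x
    using has_derivative_compose[OF has_derivative_compose[OF aff D(2)] lin]
    by (simp add: matrix_vector_mul_assoc matrix_mul_assoc del: transpose_matrix_vector)
  have "continuous_on UNIV (\<lambda>x. R *v x + b)"
    using aff[THEN has_derivative_continuous] by (simp add: continuous_on_eq_continuous_within)
  then have "continuous_on UNIV (\<lambda>x. H (R *v x + b))"
    by (rule continuous_on_compose2[OF D(3)]) auto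
  then show "continuous_on UNIV (\<lambda>x. transpose R ** H (R *v x + b) ** R)"
    unfolding matrix_matrix_mult_def by (intro continuous_intros)
qed

lemma C2_jet_shift:
  assumes "C2_jet f g H"
  shows "C2_jet (\<lambda>x. f (x + b)) (\<lambda>x. g (x + b)) (\<lambda>x. H (x + b))"
  using C2_jet_affine[OF assms, of "mat 1" b] by (simp add: transpose_mat)

lemma C2_jet_norm_square: "C2_jet (\<lambda>x::real^'n. (norm (x - a))\<^sup>2) (\<lambda>x. 2 *\<^sub>R (x - a)) (\<lambda>x. 2 *\<^sub>R mat 1)"
  using C2_jet_shift[OF C2_jet_quadratic[of "mat 1"], of "- a"] by (simp add: transpose_mat power2_norm_eq_inner)

section \<open>Convolution with dominated kernels\<close>

lemma lborel_integral_affine: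
  fixes f :: "'a::euclidean_space \<Rightarrow> 'b::{banach, second_countable_topology}"
  assumes [measurable]: "f \<in> borel_measurable borel" and c: "c \<noteq> 0"
  shows "(\<integral>z. f z \<partial>lborel) = \<bar>c\<bar> ^ DIM('a) *\<^sub>R (\<integral>y. f (t + c *\<^sub>R y) \<partial>lborel)"
proof -
  have [measurable]: "(\<lambda>x. t + c *\<^sub>R x) \<in> borel_measurable lborel" by simp
  have "(\<integral>z. f z \<partial>lborel) = integral\<^sup>L (density (distr lborel borel (\<lambda>x. t + c *\<^sub>R x)) (\<lambda>_. ennreal (\<bar>c\<bar> ^ DIM('a)))) f"
    by (subst lborel_affine[OF c, of t]) (simp add: ennreal_power)
  also have "\<dots> = \<bar>c\<bar> ^ DIM('a) *\<^sub>R (\<integral>y. f (t + c *\<^sub>R y) \<partial>lborel)"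
    by (subst integral_density) (simp_all add: integral_distr)
  finally show ?thesis .
qed

lemma lborel_integrable_affine:
  fixes f :: "'a::euclidean_space \<Rightarrow> 'b::{banach, second_countable_topology}"
  assumes f: "integrable lborel f" and c: "c \<noteq> 0"
  shows "integrable lborel (\<lambda>y. f (t + c *\<^sub>R y))"
proof -
  have [measurable]: "f \<in> borel_measurable borel" using f by (simp add: borel_measurable_integrable)
  have "integrable (density (distr lborel borel (\<lambda>x. t + c *\<^sub>R x)) (\<lambda>_. ennreal (\<bar>c\<bar> ^ DIM('a)))) f"
    using f by (subst (asm) lborel_affine[OF c, of t]) (simp add: ennreal_power)
  then have "integrable lborel (\<lambda>y. \<bar>c\<bar> ^ DIM('a) *\<^sub>R f (t + c *\<^sub>R y))"
    by (subst (asm) integrable_density) (simp_all add: integrable_distr_eq)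
  from integrable_scaleR_right[OF this, of "inverse (\<bar>c\<bar> ^ DIM('a))"] show ?thesis using c by simp
qed

lemma lborel_integrable_reflect:
  fixes f :: "'a::euclidean_space \<Rightarrow> 'b::{banach, second_countable_topology}"
  assumes "integrable lborel f"
  shows "integrable lborel (\<lambda>z. f (x - z))"
  using lborel_integrable_affine[OF assms, of "-1" x] by simp

lemma lborel_integral_reflect:
  fixes f :: "'a::euclidean_space \<Rightarrow> 'b::{banach, second_countable_topology}"
  assumes "f \<in> borel_measurable borel"
  shows "(\<integral>z. f (x - z) \<partial>lborel) = (\<integral>z. f z \<partial>lborel)"
  using lborel_integral_affine[OF assms, of "-1" x] by simp

lemma integrable_exp_neg_norm_square:
  assumes "b > 0"
  shows "integrable lborel (\<lambda>y::'a::euclidean_space. exp (- b * (norm y)\<^sup>2))"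
proof -
  interpret product_sigma_finite "\<lambda>_::'a. lborel :: real measure" ..
  have 1: "integrable lborel (\<lambda>x::real. exp (- b * x\<^sup>2))"
  proof -
    define s where "s = 1 / sqrt (2 * b)"
    have s: "s > 0" "2 * s\<^sup>2 = 1 / b" using assms by (auto simp: s_def power_divide)
    have "integrable lborel (\<lambda>x. sqrt (2 * pi * s\<^sup>2) * normal_density 0 s x)"
      using s by simp
    moreover have "sqrt (2 * pi * s\<^sup>2) * normal_density 0 s x = exp (- b * x\<^sup>2)" for x
      using s by (simp add: normal_density_def)
    ultimately show ?thesis by simp
  qed
  have "integrable (\<Pi>\<^sub>M b\<in>(Basis::'a set). lborel) (\<lambda>f. \<Prod>i\<in>Basis. exp (- b * (f i)\<^sup>2))"
    using 1 by (intro product_integrable_prod) auto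
  moreover have "(\<Prod>i\<in>Basis. exp (- b * (f i)\<^sup>2)) = exp (- b * (norm (\<Sum>i\<in>Basis. f i *\<^sub>R (i::'a)))\<^sup>2)" for f
  proof -
    have "(norm (\<Sum>i\<in>Basis. f i *\<^sub>R (i::'a)))\<^sup>2 = (\<Sum>i\<in>(Basis::'a set). (f i)\<^sup>2)"
      unfolding power2_norm_eq_inner by (subst euclidean_inner) (simp add: power2_eq_square)
    then show ?thesis by (simp add: exp_sum[symmetric] sum_distrib_left sum_negf)
  qed
  ultimately show ?thesis
    by (subst lborel_eq) (simp add: integrable_distr_eq)
qed

text \<open>Differentiation under the integral sign. It is used for a vector parameter (the point of evaluation) and
for a real one (time).\<close>
lemma has_derivative_integral:
  fixes F :: "'x::real_normed_vector \<Rightarrow> 'z \<Rightarrow> 'b::{banach, second_countable_topology}"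
  assumes r: "r > 0"
    and int: "\<And>x. x \<in> ball x0 r \<Longrightarrow> integrable M (F x)"
    and der: "\<And>z. ((\<lambda>x. F x z) has_derivative F' z) (at x0)"
    and lip: "\<And>x z. x \<in> ball x0 r \<Longrightarrow> norm (F x z - F x0 z) \<le> m z * norm (x - x0)"
    and bnd: "\<And>z h. norm (F' z h) \<le> m z * norm h"
    and m: "integrable M m"
    and meas: "\<And>h. (\<lambda>z. F' z h) \<in> borel_measurable M"
  shows "((\<lambda>x. \<integral>z. F x z \<partial>M) has_derivative (\<lambda>h. \<integral>z. F' z h \<partial>M)) (at x0)"
proof -
  have intF': "integrable M (\<lambda>z. F' z h)" for h
    by (rule Bochner_Integration.integrable_bound[of _ "\<lambda>z. m z * norm h"])
       (use m meas bnd in \<open>auto intro!: AE_I2 intro: order_trans[OF bnd]\<close>)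
  have bl: "bounded_linear (F' z)" for z using der by (rule has_derivative_bounded_linear)
  have lin: "bounded_linear (\<lambda>h. \<integral>z. F' z h \<partial>M)"
  proof (rule bounded_linear_intro[where K = "\<integral>z. m z \<partial>M"])
    show "(\<integral>z. F' z (x + y) \<partial>M) = (\<integral>z. F' z x \<partial>M) + (\<integral>z. F' z y \<partial>M)" for x y
      by (simp add: linear_simps[OF bl] Bochner_Integration.integral_add[OF intF' intF'])
    show "(\<integral>z. F' z (c *\<^sub>R x) \<partial>M) = c *\<^sub>R (\<integral>z. F' z x \<partial>M)" for c x
      by (simp add: linear_simps[OF bl])
    show "norm (\<integral>z. F' z x \<partial>M) \<le> norm x * (\<integral>z. m z \<partial>M)" for x
    proof -
      have "norm (\<integral>z. F' z x \<partial>M) \<le> (\<integral>z. m z * norm x \<partial>M)"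
        by (rule order_trans[OF integral_norm_bound integral_mono]) (use intF' m bnd in auto)
      then show ?thesis by (simp add: mult.commute)
    qed
  qed
  show ?thesis unfolding has_derivative_at
  proof (intro conjI lin, unfold tendsto_at_iff_sequentially, intro allI impI)
    fix X :: "nat \<Rightarrow> 'x" assume X: "\<forall>i. X i \<in> UNIV - {0}" and X0: "X \<longlonglongrightarrow> 0"
    define R where "R i z = (F (x0 + X i) z - F x0 z - F' z (X i)) /\<^sub>R norm (X i)" for i z
    have "eventually (\<lambda>i. norm (X i) < r) sequentially"
      using X0 r by (simp add: tendsto_iff dist_norm)
    then obtain N where N: "\<And>i. i \<ge> N \<Longrightarrow> norm (X i) < r" by (auto simp: eventually_sequentially)
    have inball: "x0 + X (i + N) \<in> ball x0 r" for i using N[of "i + N"] by (simp add: dist_norm)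
    have x0b: "x0 \<in> ball x0 r" using r by simp
    have intR: "integrable M (R (i + N))" for i
      unfolding R_def using int[OF inball] int[OF x0b] intF' by auto
    have "(\<lambda>i. \<integral>z. R (i + N) z \<partial>M) \<longlonglongrightarrow> (\<integral>z. 0 \<partial>M)"
    proof (rule integral_dominated_convergence[where w = "\<lambda>z. 2 * m z"])
      show "AE z in M. (\<lambda>i. R (i + N) z) \<longlonglongrightarrow> 0"
      proof (rule AE_I2)
        fix z
        have "(\<lambda>h. norm (F (x0 + h) z - F x0 z - F' z h) / norm h) \<midarrow>0\<rightarrow> 0"
          using der[of z] by (simp add: has_derivative_at)
        then have "((\<lambda>h. norm (F (x0 + h) z - F x0 z - F' z h) / norm h) \<circ> X) \<longlonglongrightarrow> 0"
          using X X0 unfolding tendsto_at_iff_sequentially by blast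
        then have "(\<lambda>i. norm (R i z)) \<longlonglongrightarrow> 0"
          by (simp add: R_def o_def divide_inverse mult.commute)
        then show "(\<lambda>i. R (i + N) z) \<longlonglongrightarrow> 0"
          by (intro LIMSEQ_ignore_initial_segment) (rule tendsto_norm_zero_cancel)
      qed
      show "AE z in M. norm (R (i + N) z) \<le> 2 * m z" for i
      proof (rule AE_I2)
        fix z
        have "norm (F (x0 + X (i + N)) z - F x0 z - F' z (X (i + N))) \<le> 2 * m z * norm (X (i + N))"
          using lip[OF inball[of i], of z] bnd[of z "X (i + N)"]
            norm_triangle_ineq4[of "F (x0 + X (i + N)) z - F x0 z" "F' z (X (i + N))"] by simp
        moreover have "norm (X (i + N)) > 0" using X by simp
        ultimately have "norm (F (x0 + X (i + N)) z - F x0 z - F' z (X (i + N))) / norm (X (i + N)) \<le> 2 * m z"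
          by (simp only: pos_divide_le_eq)
        then show "norm (R (i + N) z) \<le> 2 * m z"
          by (simp add: R_def divide_inverse mult.commute)
      qed
      show "R (i + N) \<in> borel_measurable M" for i using intR by auto
    qed (use m in auto)
    then have "(\<lambda>i. norm (\<integral>z. R (i + N) z \<partial>M)) \<longlonglongrightarrow> 0" by (simp add: tendsto_norm_zero)
    moreover have "norm (\<integral>z. R (i + N) z \<partial>M)
       = norm ((\<integral>z. F (x0 + X (i + N)) z \<partial>M) - (\<integral>z. F x0 z \<partial>M) - (\<integral>z. F' z (X (i + N)) \<partial>M)) / norm (X (i + N))" for i
      unfolding R_def using int[OF inball[of i]] int[OF x0b] intF'
      by (simp add: divide_inverse mult.commute)
    ultimately show "((\<lambda>h. norm ((\<integral>z. F (x0 + h) z \<partial>M) - (\<integral>z. F x0 z \<partial>M) - (\<integral>z. F' z h \<partial>M)) / norm h) \<circ> X) \<longlonglongrightarrow> 0"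
      by - (rule LIMSEQ_offset[where k = N], simp add: o_def)
  qed
qed

lemma integrable_bounded_times_kernel:
  fixes k :: "'a::euclidean_space \<Rightarrow> 'b::{banach, second_countable_topology}" and h :: "'a \<Rightarrow> real"
  assumes [measurable]: "h \<in> borel_measurable borel" "k \<in> borel_measurable borel"
    and B: "\<And>z. \<bar>h z\<bar> \<le> B" and M: "integrable lborel M" "\<And>y. norm (k y) \<le> M y"
  shows "integrable lborel (\<lambda>z. h z *\<^sub>R k (x - z))"
proof (rule Bochner_Integration.integrable_bound)
  show "integrable lborel (\<lambda>z. B * M (x - z))" using lborel_integrable_reflect[OF M(1)] by simp
  have "0 \<le> B" using B[of 0] by linarith
  show "AE z in lborel. norm (h z *\<^sub>R k (x - z)) \<le> norm (B * M (x - z))"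
  proof (rule AE_I2)
    fix z
    have "\<bar>h z\<bar> * norm (k (x - z)) \<le> B * M (x - z)" using B M(2) \<open>0 \<le> B\<close> by (intro mult_mono) auto
    then show "norm (h z *\<^sub>R k (x - z)) \<le> norm (B * M (x - z))" by simp
  qed
qed simp

lemma has_derivative_convolution:
  fixes k :: "'a::euclidean_space \<Rightarrow> 'b::{banach, second_countable_topology}" and h :: "'a \<Rightarrow> real"
  assumes h[measurable]: "h \<in> borel_measurable borel" and B: "\<And>z. \<bar>h z\<bar> \<le> B"
    and der: "\<And>y. (k has_derivative k' y) (at y)"
    and M: "integrable lborel M" "\<And>y. norm (k y) \<le> M y"
    and k'M: "\<And>y w v. norm w \<le> 1 \<Longrightarrow> norm (k' (y + w) v) \<le> M y * norm v"
    and [measurable]: "\<And>v. (\<lambda>y. k' y v) \<in> borel_measurable borel"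
  shows "((\<lambda>x. \<integral>z. h z *\<^sub>R k (x - z) \<partial>lborel) has_derivative (\<lambda>v. \<integral>z. h z *\<^sub>R k' (x - z) v \<partial>lborel)) (at x)"
proof (rule has_derivative_integral[where r = 1 and m = "\<lambda>z. B * M (x - z)"])
  have "continuous_on UNIV k"
    using der[THEN has_derivative_continuous] by (simp add: continuous_on_eq_continuous_within)
  then have [measurable]: "k \<in> borel_measurable borel" by (rule borel_measurable_continuous_onI)
  have "0 \<le> B" using B[of 0] by linarith
  show "integrable lborel (\<lambda>z. h z *\<^sub>R k (y - z))" for y
    by (rule integrable_bounded_times_kernel) (use B M in auto)
  have shift: "((\<lambda>x. k (x - z)) has_derivative k' (y - z)) (at y)" for y z
    using has_derivative_compose[OF has_derivative_diff[OF has_derivative_ident has_derivative_const] der] by simp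
  show "((\<lambda>x. h z *\<^sub>R k (x - z)) has_derivative (\<lambda>v. h z *\<^sub>R k' (x - z) v)) (at x)" for z
    by (rule has_derivative_scaleR_right[OF shift])
  show "norm (h z *\<^sub>R k' (x - z) v) \<le> B * M (x - z) * norm v" for z v
    using mult_mono[OF B[of z] k'M[of 0 "x - z" v] \<open>0 \<le> B\<close>] by (simp add: mult.assoc)
  show "norm (h z *\<^sub>R k (y - z) - h z *\<^sub>R k (x - z)) \<le> B * M (x - z) * norm (y - x)" if y: "y \<in> ball x 1" for y z
  proof -
    have "norm (k (y - z) - k (x - z)) \<le> M (x - z) * norm (y - x)"
    proof (rule differentiable_bound[where S = "ball x 1" and f = "\<lambda>x. k (x - z)" and f' = "\<lambda>x. k' (x - z)"])
      show "((\<lambda>x. k (x - z)) has_derivative k' (w - z)) (at w within ball x 1)" for w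
        by (rule has_derivative_at_withinI[OF shift])
      show "onorm (k' (w - z)) \<le> M (x - z)" if "w \<in> ball x 1" for w
      proof (rule onorm_le)
        show "norm (k' (w - z) v) \<le> M (x - z) * norm v" for v
          using k'M[of "w - x" "x - z" v] that by (simp add: dist_norm norm_minus_commute)
      qed
    qed (use y in auto)
    then have "\<bar>h z\<bar> * norm (k (y - z) - k (x - z)) \<le> B * (M (x - z) * norm (y - x))"
      using B \<open>0 \<le> B\<close> by (intro mult_mono) auto
    then show ?thesis by (simp add: scaleR_diff_right[symmetric] mult.assoc)
  qed
  show "integrable lborel (\<lambda>z. B * M (x - z))" using lborel_integrable_reflect[OF M(1)] by simp
qed simp_all

lemma continuous_convolution:
  fixes k :: "'a::euclidean_space \<Rightarrow> 'b::{banach, second_countable_topology}" and h :: "'a \<Rightarrow> real"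
  assumes h[measurable]: "h \<in> borel_measurable borel" and B: "\<And>z. \<bar>h z\<bar> \<le> B"
    and k: "continuous_on UNIV k"
    and M: "integrable lborel M" "\<And>y w. norm w \<le> 1 \<Longrightarrow> norm (k (y + w)) \<le> M y"
  shows "continuous_on UNIV (\<lambda>x. \<integral>z. h z *\<^sub>R k (x - z) \<partial>lborel)"
proof -
  have [measurable]: "k \<in> borel_measurable borel" using k by (rule borel_measurable_continuous_onI)
  have "0 \<le> B" using B[of 0] by linarith
  show ?thesis unfolding continuous_on_sequentially
  proof (intro allI ballI impI, elim conjE)
    fix X :: "nat \<Rightarrow> 'a" and a assume "X \<longlonglongrightarrow> a"
    then have "eventually (\<lambda>i. dist (X i) a < 1) sequentially" by (simp add: tendsto_iff)
    then obtain N where N: "\<And>i. i \<ge> N \<Longrightarrow> dist (X i) a < 1" by (auto simp: eventually_sequentially)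
    have "(\<lambda>i. \<integral>z. h z *\<^sub>R k (X (i + N) - z) \<partial>lborel) \<longlonglongrightarrow> (\<integral>z. h z *\<^sub>R k (a - z) \<partial>lborel)"
    proof (rule integral_dominated_convergence[where w = "\<lambda>z. B * M (a - z)"])
      show "integrable lborel (\<lambda>z. B * M (a - z))" using lborel_integrable_reflect[OF M(1)] by simp
      show "AE z in lborel. (\<lambda>i. h z *\<^sub>R k (X (i + N) - z)) \<longlonglongrightarrow> h z *\<^sub>R k (a - z)"
      proof (rule AE_I2)
        fix z
        have "(\<lambda>i. X (i + N) - z) \<longlonglongrightarrow> a - z"
          by (rule tendsto_diff[OF LIMSEQ_ignore_initial_segment[OF \<open>X \<longlonglongrightarrow> a\<close>] tendsto_const])
        then have "(\<lambda>i. k (X (i + N) - z)) \<longlonglongrightarrow> k (a - z)"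
          by (rule continuous_on_tendsto_compose[OF k]) auto
        then show "(\<lambda>i. h z *\<^sub>R k (X (i + N) - z)) \<longlonglongrightarrow> h z *\<^sub>R k (a - z)" by (intro tendsto_intros)
      qed
      show "AE z in lborel. norm (h z *\<^sub>R k (X (i + N) - z)) \<le> B * M (a - z)" for i
      proof (rule AE_I2)
        fix z
        have "norm (k (X (i + N) - z)) \<le> M (a - z)"
          using M(2)[of "X (i + N) - a" "a - z"] N[of "i + N"] by (simp add: dist_norm)
        then show "norm (h z *\<^sub>R k (X (i + N) - z)) \<le> B * M (a - z)"
          using B[of z] \<open>0 \<le> B\<close> by (simp add: mult_mono)
      qed
    qed simp_all
    then show "((\<lambda>x. \<integral>z. h z *\<^sub>R k (x - z) \<partial>lborel) \<circ> X) \<longlonglongrightarrow> (\<integral>z. h z *\<^sub>R k (a - z) \<partial>lborel)"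
      by - (rule LIMSEQ_offset[where k = N], simp add: o_def)
  qed
qed

lemma norm_matrix_vector_le:
  fixes M :: "real ^ 'n ^ 'm"
  shows "norm (M *v v) \<le> norm M * norm v"
proof -
  have "norm (M *v v) = L2_set (\<lambda>i. \<bar>M $ i \<bullet> v\<bar>) UNIV"
    by (simp add: norm_vec_def matrix_vector_mul_component)
  also have "\<dots> \<le> L2_set (\<lambda>i. norm (M $ i) * norm v) UNIV"
    by (intro L2_set_mono Cauchy_Schwarz_ineq2) auto
  also have "\<dots> = norm M * norm v"
    by (simp add: norm_vec_def[of M] L2_set_left_distrib)
  finally show ?thesis .
qed

lemma norm_outer: "norm (outer a b) = norm a * norm b"
proof -
  have "outer a b $ i = a $ i *\<^sub>R b" for i by (simp add: outer_def vec_eq_iff)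
  then have "norm (outer a b) = L2_set (\<lambda>i. \<bar>a $ i\<bar> * norm b) UNIV" by (simp add: norm_vec_def[of "outer a b"])
  then show ?thesis by (simp add: norm_vec_def[of a] L2_set_left_distrib)
qed

text \<open>All derivatives fall on the kernel, so \<open>h\<close> need only be bounded and measurable. The majorant must work
uniformly for unit shifts of the argument.\<close>
lemma C2_jet_convolution:
  fixes K :: "real ^ 'n \<Rightarrow> real"
  assumes jet: "C2_jet K K1 K2" and M: "integrable lborel M"
    and dom: "\<And>y w. norm w \<le> 1 \<Longrightarrow> \<bar>K (y + w)\<bar> \<le> M y"
      "\<And>y w. norm w \<le> 1 \<Longrightarrow> norm (K1 (y + w)) \<le> M y"
      "\<And>y w. norm w \<le> 1 \<Longrightarrow> norm (K2 (y + w)) \<le> M y"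
    and h[measurable]: "h \<in> borel_measurable borel" and B: "\<And>z. \<bar>h z\<bar> \<le> B"
  shows "C2_jet (\<lambda>x. \<integral>z. h z * K (x - z) \<partial>lborel) (\<lambda>x. \<integral>z. h z *\<^sub>R K1 (x - z) \<partial>lborel)
    (\<lambda>x. \<integral>z. h z *\<^sub>R K2 (x - z) \<partial>lborel)"
  unfolding C2_jet_def
proof (intro conjI allI)
  note D = C2_jetD[OF jet]
  have dom4: "norm (K2 (y + w) *v v) \<le> M y * norm v" if "norm w \<le> 1" for y w v
    using norm_matrix_vector_le[of "K2 (y + w)" v] mult_right_mono[OF dom(3)[OF that, of y] norm_ge_zero[of v]]
    by linarith
  have [measurable]: "K \<in> borel_measurable borel" "K1 \<in> borel_measurable borel" "K2 \<in> borel_measurable borel"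
    using D by (auto intro: borel_measurable_continuous_onI)
  have i1: "integrable lborel (\<lambda>z. h z *\<^sub>R K1 (x - z))" for x
    by (rule integrable_bounded_times_kernel) (use B M dom(2)[of 0] in auto)
  have i2: "integrable lborel (\<lambda>z. h z *\<^sub>R K2 (x - z))" for x
    by (rule integrable_bounded_times_kernel) (use B M dom(3)[of 0] in auto)
  have "((\<lambda>x. \<integral>z. h z *\<^sub>R K (x - z) \<partial>lborel) has_derivative (\<lambda>v. \<integral>z. h z *\<^sub>R (K1 (x - z) \<bullet> v) \<partial>lborel)) (at x)" for x
  proof (rule has_derivative_convolution[where M = M])
    show "norm (K1 (y + w) \<bullet> v) \<le> M y * norm v" if "norm w \<le> 1" for y w v
      using Cauchy_Schwarz_ineq2[of "K1 (y + w)" v] mult_right_mono[OF dom(2)[OF that, of y] norm_ge_zero[of v]] by simp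
  qed (use B M dom(1)[of 0] D in auto)
  moreover have "(\<integral>z. h z *\<^sub>R (K1 (x - z) \<bullet> v) \<partial>lborel) = (\<integral>z. h z *\<^sub>R K1 (x - z) \<partial>lborel) \<bullet> v" for x v
    using integral_bounded_linear[OF bounded_linear_inner_left i1, of x v] by simp
  ultimately show "((\<lambda>x. \<integral>z. h z * K (x - z) \<partial>lborel) has_derivative (\<lambda>v. (\<integral>z. h z *\<^sub>R K1 (x - z) \<partial>lborel) \<bullet> v)) (at x)" for x
    by simp
  have bl: "bounded_linear (\<lambda>A :: real ^ 'n ^ 'n. A *v v)" for v
    unfolding matrix_vector_mult_def linear_conv_bounded_linear[symmetric]
    by (intro linearI) (simp_all add: vec_eq_iff algebra_simps sum.distrib sum_distrib_left)
  have [measurable]: "(\<lambda>y. K2 y *v v) \<in> borel_measurable borel" for v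
    using bounded_linear.continuous_on[OF bl D(3)] by (rule borel_measurable_continuous_onI)
  have "((\<lambda>x. \<integral>z. h z *\<^sub>R K1 (x - z) \<partial>lborel) has_derivative (\<lambda>v. \<integral>z. h z *\<^sub>R (K2 (x - z) *v v) \<partial>lborel)) (at x)" for x
    by (rule has_derivative_convolution[where M = M and k = K1]) (use B M dom(2)[of 0] dom4 D in auto)
  moreover have "(\<integral>z. h z *\<^sub>R (K2 (x - z) *v v) \<partial>lborel) = (\<integral>z. h z *\<^sub>R K2 (x - z) \<partial>lborel) *v v" for x v
    using integral_bounded_linear[OF bl i2, of x v] by (simp add: scaleR_matrix_vector_assoc[symmetric])
  ultimately show "((\<lambda>x. \<integral>z. h z *\<^sub>R K1 (x - z) \<partial>lborel) has_derivative (\<lambda>v. (\<integral>z. h z *\<^sub>R K2 (x - z) \<partial>lborel) *v v)) (at x)" for x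
    by simp
  show "continuous_on UNIV (\<lambda>x. \<integral>z. h z *\<^sub>R K2 (x - z) \<partial>lborel)"
    by (rule continuous_convolution[where M = M]) (use B M dom(3) D in auto)
qed

section \<open>Gaussian kernels of constant coefficient operators\<close>

text \<open>A polynomial factor costs half of the exponential decay.\<close>
lemma one_plus_times_exp_le:
  fixes a s :: real
  assumes "a > 0" "s \<ge> 0"
  shows "(1 + s) * exp (- a * s) \<le> (1 + 2 / a) * exp (- (a / 2) * s)"
proof -
  have "1 + s \<le> (1 + 2 / a) * (1 + a / 2 * s)" using assms by (simp add: field_simps)
  also have "\<dots> \<le> (1 + 2 / a) * exp (a / 2 * s)" using assms by (intro mult_left_mono exp_ge_add_one_self) simp
  finally have "(1 + s) * exp (- a * s) \<le> (1 + 2 / a) * exp (a / 2 * s) * exp (- a * s)" by (rule mult_right_mono) simp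
  also have "\<dots> = (1 + 2 / a) * exp (- (a / 2) * s)" by (simp add: mult.assoc exp_add[symmetric])
  finally show ?thesis .
qed

lemma norm_add_square_lower:
  fixes y w :: "'a::real_inner"
  assumes "norm w \<le> 1"
  shows "(norm y)\<^sup>2 / 2 - 1 \<le> (norm (y + w))\<^sup>2"
proof -
  have "norm y \<le> norm (y + w) + 1" using norm_triangle_ineq4[of "y + w" w] assms by simp
  then have "(norm y)\<^sup>2 \<le> (norm (y + w) + 1)\<^sup>2" by (intro power_mono) auto
  moreover have "(norm (y + w) + 1)\<^sup>2 + (norm (y + w) - 1)\<^sup>2 = 2 * (norm (y + w))\<^sup>2 + 2"
    by (simp add: power2_eq_square algebra_simps)
  ultimately show ?thesis using zero_le_power2[of "norm (y + w) - 1"] by linarith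
qed

text \<open>\<open>C\<close> is the inverse of the coefficient matrix \<open>A\<close>. The Gaussian \<open>exp (- (y \<bullet> C y) / (4 t))\<close>, multiplied
by \<open>t\<^sup>-\<^sup>n\<^sup>/\<^sup>2\<close> and normalised, is the heat kernel of the operator \<open>A \<bullet> D\<^sup>2\<close>; \<open>K1\<close> and \<open>K2\<close> are
its gradient and Hessian in space.\<close>
locale heat_kernel =
  fixes A C :: "real ^ 'n ^ 'n" and q :: real
  assumes symA: "transpose A = A" and symC: "transpose C = C" and AC: "A ** C = mat 1"
    and q_pos: "0 < q" and coercive: "\<And>y. q * (y \<bullet> y) \<le> y \<bullet> (C *v y)"
begin

definition Z :: real where "Z = (\<integral>y. exp (- (y \<bullet> (C *v y)) / 4) \<partial>lborel)"

definition K :: "real \<Rightarrow> real ^ 'n \<Rightarrow> real" where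
  "K t y = t powr (- (real CARD('n) / 2)) / Z * exp (- (y \<bullet> (C *v y)) / (4 * t))"

definition K1 :: "real \<Rightarrow> real ^ 'n \<Rightarrow> real ^ 'n" where
  "K1 t y = - (K t y / (2 * t)) *\<^sub>R (C *v y)"

definition K2 :: "real \<Rightarrow> real ^ 'n \<Rightarrow> real ^ 'n ^ 'n" where
  "K2 t y = K t y *\<^sub>R ((1 / (4 * t\<^sup>2)) *\<^sub>R outer (C *v y) (C *v y) - (1 / (2 * t)) *\<^sub>R C)"

lemma quadratic_continuous: "continuous_on UNIV (\<lambda>y. y \<bullet> (C *v y))"
  using C2_jetD(4)[OF C2_jet_quadratic[OF symC]] .

lemma quadratic_measurable [measurable]: "(\<lambda>y. y \<bullet> (C *v y)) \<in> borel_measurable borel"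
  by (rule borel_measurable_continuous_onI[OF quadratic_continuous])

lemma gaussian_le: "t > 0 \<Longrightarrow> exp (- (y \<bullet> (C *v y)) / (4 * t)) \<le> exp (- (q / (4 * t)) * (norm y)\<^sup>2)"
  using coercive[of y] by (simp add: power2_norm_eq_inner divide_right_mono)

lemma gaussian_integrable: "integrable lborel (\<lambda>y. exp (- (y \<bullet> (C *v y)) / 4))"
proof (rule Bochner_Integration.integrable_bound)
  show "integrable lborel (\<lambda>y::real^'n. exp (- (q / 4) * (norm y)\<^sup>2))"
    by (rule integrable_exp_neg_norm_square) (use q_pos in simp)
  show "AE y in lborel. norm (exp (- (y \<bullet> (C *v y)) / 4)) \<le> norm (exp (- (q / 4) * (norm y)\<^sup>2))"
    using gaussian_le[of 1] by (intro AE_I2) simp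
qed simp

lemma Z_pos: "Z > 0"
proof -
  have "Z \<noteq> 0"
  proof
    assume "Z = 0"
    then have "AE y in lborel. exp (- (y \<bullet> (C *v y)) / 4) = 0"
      unfolding Z_def by (subst (asm) integral_nonneg_eq_0_iff_AE[OF gaussian_integrable]) auto
    then have "AE y in (lborel :: (real ^ 'n) measure). False" by simp
    then have "emeasure lborel (space (lborel :: (real ^ 'n) measure)) = 0"
      by (subst (asm) AE_iff_measurable[of "space lborel"]) auto
    then show False by simp
  qed
  moreover have "Z \<ge> 0" unfolding Z_def by simp
  ultimately show ?thesis by simp
qed

lemma K_pos: "t > 0 \<Longrightarrow> K t y > 0"
  using Z_pos by (simp add: K_def)

lemma K_continuous: "continuous_on UNIV (K t)"
  unfolding K_def divide_inverse by (intro continuous_intros quadratic_continuous)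

lemma K_measurable [measurable]: "K t \<in> borel_measurable borel"
  by (rule borel_measurable_continuous_onI[OF K_continuous])

lemma K_jet:
  assumes "t > 0"
  shows "C2_jet (K t) (K1 t) (K2 t)"
proof -
  define b where "b = t powr (- (real CARD('n) / 2)) / Z"
  define \<psi> where "\<psi> r = b * exp (- r / (4 * t))" for r :: real
  have d: "(\<psi> has_real_derivative - (1 / (4 * t)) * \<psi> r) (at r)" for r
    unfolding \<psi>_def using assms by (auto intro!: derivative_eq_intros)
  have "C2_jet (\<lambda>x. \<psi> (x \<bullet> (C *v x))) (\<lambda>x. (- (1 / (4 * t)) * \<psi> (x \<bullet> (C *v x))) *\<^sub>R (2 *\<^sub>R (C *v x)))
    (\<lambda>x. (- (1 / (4 * t)) * \<psi> (x \<bullet> (C *v x))) *\<^sub>R (2 *\<^sub>R C)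
      + (- (1 / (4 * t)) * (- (1 / (4 * t)) * \<psi> (x \<bullet> (C *v x)))) *\<^sub>R outer (2 *\<^sub>R (C *v x)) (2 *\<^sub>R (C *v x)))"
  proof (rule C2_jet_compose[OF C2_jet_quadratic[OF symC]])
    show "((\<lambda>r. - (1 / (4 * t)) * \<psi> r) has_real_derivative - (1 / (4 * t)) * (- (1 / (4 * t)) * \<psi> r)) (at r)" for r
      by (rule DERIV_cmult[OF d])
    show "continuous_on UNIV (\<lambda>x. - (1 / (4 * t)) * (- (1 / (4 * t)) * \<psi> (x \<bullet> (C *v x))))"
      unfolding \<psi>_def using assms by (intro continuous_intros quadratic_continuous) auto
  qed (rule d)
  moreover have "(\<lambda>x. \<psi> (x \<bullet> (C *v x))) = K t" by (simp add: \<psi>_def b_def K_def fun_eq_iff)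
  moreover have "(- (1 / (4 * t)) * \<psi> (x \<bullet> (C *v x))) *\<^sub>R (2 *\<^sub>R (C *v x)) = K1 t x" for x
    by (simp add: \<psi>_def b_def K1_def K_def)
  moreover have "outer (2 *\<^sub>R a) (2 *\<^sub>R a) = 4 *\<^sub>R outer a a" for a :: "real ^ 'n"
    by (simp add: outer_def vec_eq_iff)
  then have "(- (1 / (4 * t)) * \<psi> (x \<bullet> (C *v x))) *\<^sub>R (2 *\<^sub>R C)
      + (- (1 / (4 * t)) * (- (1 / (4 * t)) * \<psi> (x \<bullet> (C *v x)))) *\<^sub>R outer (2 *\<^sub>R (C *v x)) (2 *\<^sub>R (C *v x)) = K2 t x" for x
    by (simp add: \<psi>_def b_def K2_def K_def scaleR_diff_right power2_eq_square mult_ac)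
  ultimately show ?thesis by simp
qed

text \<open>This is the right hand side of the heat equation for \<open>K\<close>; comparison with the time derivative shows that
\<open>K\<close> solves it.\<close>
lemma A_K2: "t > 0 \<Longrightarrow> A \<bullet> K2 t y = ((y \<bullet> (C *v y)) / (4 * t\<^sup>2) - real CARD('n) / (2 * t)) * K t y"
proof -
  have "A \<bullet> C = trace (A ** C)"
  proof -
    have "C $ i $ j = C $ j $ i" for i j using symC by (metis transpose_def vec_lambda_beta)
    then show ?thesis by (simp add: inner_vec_def trace_def matrix_matrix_mult_def)
  qed
  then have "A \<bullet> C = real CARD('n)" by (simp add: AC trace_I)
  moreover have "A *v (C *v y) = y" by (simp add: matrix_vector_mul_assoc AC)
  ultimately show ?thesis
    by (simp add: K2_def inner_diff_right inner_outer inner_commute algebra_simps)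
qed

lemma K_time_derivative:
  assumes "t > 0"
  shows "((\<lambda>t. K t y) has_real_derivative A \<bullet> K2 t y) (at t)"
proof -
  have "((\<lambda>t. K t y) has_real_derivative
     (- (real CARD('n) / 2) * t powr (- (real CARD('n) / 2) - 1)) / Z * exp (- (y \<bullet> (C *v y)) / (4 * t)) +
     t powr (- (real CARD('n) / 2)) / Z * (exp (- (y \<bullet> (C *v y)) / (4 * t)) * ((y \<bullet> (C *v y)) / (4 * t\<^sup>2)))) (at t)"
    unfolding K_def using assms Z_pos
    by (auto intro!: derivative_eq_intros simp: power2_eq_square field_simps)
  moreover have "t powr (- (real CARD('n) / 2) - 1) = t powr (- (real CARD('n) / 2)) / t"
    using assms by (simp add: powr_diff)
  ultimately show ?thesis
    unfolding A_K2[OF assms] K_def by (simp add: algebra_simps diff_divide_distrib)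
qed

text \<open>One integrable function dominates the kernel and its spatial derivatives up to second order, uniformly for
times in a compact interval and for unit shifts of the argument.\<close>
lemma K_majorant:
  assumes t1: "0 < t1" "t1 \<le> t2"
  obtains M where "integrable lborel M"
    "\<And>t y w. t1 \<le> t \<Longrightarrow> t \<le> t2 \<Longrightarrow> norm w \<le> 1 \<Longrightarrow> \<bar>K t (y + w)\<bar> \<le> M y"
    "\<And>t y w. t1 \<le> t \<Longrightarrow> t \<le> t2 \<Longrightarrow> norm w \<le> 1 \<Longrightarrow> norm (K1 t (y + w)) \<le> M y"
    "\<And>t y w. t1 \<le> t \<Longrightarrow> t \<le> t2 \<Longrightarrow> norm w \<le> 1 \<Longrightarrow> norm (K2 t (y + w)) \<le> M y"
proof -
  define a where "a = q / (4 * t2)"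
  define D where "D = t1 powr (- (real CARD('n) / 2)) / Z"
  define N where "N = norm C"
  define E where "E = 1 + N / (2 * t1) + N\<^sup>2 / (4 * t1\<^sup>2)"
  have a: "a > 0" using q_pos t1 by (simp add: a_def)
  have D: "D \<ge> 0" using Z_pos by (simp add: D_def)
  have N: "N \<ge> 0" by (simp add: N_def)
  have E: "E \<ge> 1" "N / (2 * t1) \<le> E" "N / (2 * t1) + N\<^sup>2 / (4 * t1\<^sup>2) \<le> E" using N t1 by (simp_all add: E_def)
  define b where "b y = D * (E * ((1 + (norm y)\<^sup>2) * exp (- a * (norm y)\<^sup>2)))" for y :: "real ^ 'n"
  have Kb: "K t y \<le> D * exp (- a * (norm y)\<^sup>2)" if t: "t1 \<le> t" "t \<le> t2" for t y
  proof -
    have "t powr (- (real CARD('n) / 2)) \<le> t1 powr (- (real CARD('n) / 2))"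
      using t t1 by (intro powr_mono2') auto
    then have 1: "t powr (- (real CARD('n) / 2)) / Z \<le> D" using Z_pos by (simp add: D_def divide_right_mono)
    have "q / (4 * t) \<ge> a" unfolding a_def using t t1 q_pos by (intro divide_left_mono) auto
    then have "- (q / (4 * t)) * (norm y)\<^sup>2 \<le> - a * (norm y)\<^sup>2" by (intro mult_right_mono) auto
    then have 2: "exp (- (y \<bullet> (C *v y)) / (4 * t)) \<le> exp (- a * (norm y)\<^sup>2)"
      using gaussian_le[of t y] t t1 by (smt (verit) exp_le_cancel_iff)
    show ?thesis unfolding K_def using 1 2 D by (intro mult_mono) auto
  qed
  have main: "K t y * r \<le> b y" if t: "t1 \<le> t" "t \<le> t2" and r: "r \<le> E * (1 + (norm y)\<^sup>2)" for t y r
  proof -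
    have K0: "K t y > 0" using K_pos t t1 by simp
    have "K t y * r \<le> K t y * (E * (1 + (norm y)\<^sup>2))" using K0 r by (intro mult_left_mono) auto
    also have "\<dots> \<le> (D * exp (- a * (norm y)\<^sup>2)) * (E * (1 + (norm y)\<^sup>2))"
      using Kb[OF t] E by (intro mult_right_mono) auto
    finally show ?thesis by (simp add: b_def mult_ac)
  qed
  have y1: "norm y \<le> 1 + (norm y)\<^sup>2" for y :: "real ^ 'n"
  proof -
    have "2 * norm y \<le> 1 + (norm y)\<^sup>2"
      using zero_le_power2[of "norm y - 1"] by (simp add: power2_eq_square algebra_simps)
    then show ?thesis using norm_ge_zero[of y] by linarith
  qed
  have b0: "\<bar>K t y\<bar> \<le> b y" if t: "t1 \<le> t" "t \<le> t2" for t y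
  proof -
    have "K t y * 1 \<le> b y"
      by (rule main[OF t]) (use E mult_mono[of 1 E 1 "1 + (norm y)\<^sup>2"] in auto)
    then show ?thesis using K_pos[of t y] t t1 by simp
  qed
  have Cy: "norm (C *v y) \<le> N * norm y" for y unfolding N_def by (rule norm_matrix_vector_le)
  have b1: "norm (K1 t y) \<le> b y" if t: "t1 \<le> t" "t \<le> t2" for t y
  proof -
    have "norm (C *v y) / (2 * t) \<le> N * norm y / (2 * t1)" using Cy[of y] t t1 N by (intro frac_le) auto
    also have "\<dots> = N / (2 * t1) * norm y" by simp
    also have "\<dots> \<le> E * (1 + (norm y)\<^sup>2)" using E N t1 y1[of y] by (intro mult_mono) auto
    finally have "K t y * (norm (C *v y) / (2 * t)) \<le> b y" by (rule main[OF t])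
    then show ?thesis using K_pos[of t y] t t1 by (simp add: K1_def)
  qed
  have b2: "norm (K2 t y) \<le> b y" if t: "t1 \<le> t" "t \<le> t2" for t y
  proof -
    have t0: "t > 0" using t t1 by simp
    define W where "W = (1 / (4 * t\<^sup>2)) *\<^sub>R outer (C *v y) (C *v y) - (1 / (2 * t)) *\<^sub>R C"
    have "norm W \<le> norm ((1 / (4 * t\<^sup>2)) *\<^sub>R outer (C *v y) (C *v y)) + norm ((1 / (2 * t)) *\<^sub>R C)"
      unfolding W_def by (rule norm_triangle_ineq4)
    also have "\<dots> = (norm (C *v y))\<^sup>2 / (4 * t\<^sup>2) + N / (2 * t)"
      using t0 by (simp add: norm_outer N_def power2_eq_square)
    also have "\<dots> \<le> (N * norm y)\<^sup>2 / (4 * t1\<^sup>2) + N / (2 * t1)"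
      using t t1 N Cy[of y] by (intro add_mono frac_le power_mono mult_left_mono) (auto simp: power_mono)
    also have "\<dots> \<le> (N / (2 * t1) + N\<^sup>2 / (4 * t1\<^sup>2)) * (1 + (norm y)\<^sup>2)"
    proof -
      define P S where "P = N / (2 * t1)" and "S = N\<^sup>2 / (4 * t1\<^sup>2)"
      have "P \<ge> 0" "S \<ge> 0" using N t1 by (simp_all add: P_def S_def)
      then have "S * (norm y)\<^sup>2 + P \<le> (P + S) * (1 + (norm y)\<^sup>2)" by (simp add: algebra_simps)
      then show ?thesis by (simp add: P_def S_def power_mult_distrib)
    qed
    also have "\<dots> \<le> E * (1 + (norm y)\<^sup>2)" using E by (intro mult_right_mono) auto
    finally have "K t y * norm W \<le> b y" by (rule main[OF t])
    then show ?thesis using K_pos[OF t0, of y] by (simp add: K2_def W_def)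
  qed
  define M where "M y = D * (E * ((1 + 2 / a) * (exp (a / 2) * exp (- (a / 4) * (norm y)\<^sup>2))))" for y :: "real ^ 'n"
  have bM: "b (y + w) \<le> M y" if "norm w \<le> 1" for y w
  proof -
    have "(1 + (norm (y + w))\<^sup>2) * exp (- a * (norm (y + w))\<^sup>2) \<le> (1 + 2 / a) * exp (- (a / 2) * (norm (y + w))\<^sup>2)"
      using a by (intro one_plus_times_exp_le) auto
    also have "exp (- (a / 2) * (norm (y + w))\<^sup>2) \<le> exp (- (a / 2) * ((norm y)\<^sup>2 / 2 - 1))"
      using norm_add_square_lower[OF that, of y] a by (simp add: mult_left_mono)
    also have "- (a / 2) * ((norm y)\<^sup>2 / 2 - 1) = a / 2 + - (a / 4) * (norm y)\<^sup>2" by (simp add: field_simps)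
    finally show ?thesis using a D E unfolding b_def M_def exp_add by (intro mult_left_mono) (auto simp: mult_left_mono)
  qed
  have "integrable lborel (\<lambda>y::real^'n. exp (- (a / 4) * (norm y)\<^sup>2))"
    by (rule integrable_exp_neg_norm_square) (use a in simp)
  then have "integrable lborel M" unfolding M_def by simp
  then show ?thesis
  proof (rule that)
    show "\<bar>K t (y + w)\<bar> \<le> M y" "norm (K1 t (y + w)) \<le> M y" "norm (K2 t (y + w)) \<le> M y"
      if "t1 \<le> t" "t \<le> t2" "norm w \<le> 1" for t y w
      using b0[OF that(1,2)] b1[OF that(1,2)] b2[OF that(1,2)] bM[OF that(3)] by (blast intro: order_trans)+
  qed
qed

lemma K_1_integrable: "integrable lborel (K 1)"
  unfolding K_def using gaussian_integrable by simp

lemma K_1_integral: "(\<integral>y. K 1 y \<partial>lborel) = 1"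
  unfolding K_def using Z_pos by (simp add: Z_def)

text \<open>The heat semigroup. In this form, with the time in the argument of \<open>h\<close> rather than in the kernel, it makes
sense at \<open>t = 0\<close> and is continuous there; \<open>avg_convolution\<close> gives the form with the kernel \<open>K t\<close>, which is
the one to differentiate.\<close>
definition avg :: "real \<Rightarrow> (real ^ 'n \<Rightarrow> real) \<Rightarrow> real ^ 'n \<Rightarrow> real" where
  "avg t h x = (\<integral>y. h (x - sqrt t *\<^sub>R y) * K 1 y \<partial>lborel)"

lemma avg_convolution:
  assumes [measurable]: "h \<in> borel_measurable borel" and t: "t > 0"
  shows "avg t h x = (\<integral>z. h z * K t (x - z) \<partial>lborel)"
proof -
  have 1: "K t (sqrt t *\<^sub>R y) = t powr (- (real CARD('n) / 2)) * K 1 y" for y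
  proof -
    have "(sqrt t *\<^sub>R y) \<bullet> (C *v (sqrt t *\<^sub>R y)) = t * (y \<bullet> (C *v y))"
      using t by (simp add: matrix_vector_mult_scaleR mult.assoc[symmetric])
    then show ?thesis using t by (simp add: K_def)
  qed
  have 2: "sqrt t ^ CARD('n) * t powr (- (real CARD('n) / 2)) = 1"
    using t by (simp add: powr_half_sqrt[symmetric] powr_realpow[symmetric] powr_powr powr_add[symmetric])
  have "(\<integral>z. h z * K t (x - z) \<partial>lborel)
      = \<bar>- sqrt t\<bar> ^ DIM(real ^ 'n) *\<^sub>R (\<integral>y. h (x + (- sqrt t) *\<^sub>R y) * K t (x - (x + (- sqrt t) *\<^sub>R y)) \<partial>lborel)"
    by (rule lborel_integral_affine) (use t in simp_all)
  also have "\<dots> = sqrt t ^ CARD('n) * (\<integral>y. t powr (- (real CARD('n) / 2)) * (h (x - sqrt t *\<^sub>R y) * K 1 y) \<partial>lborel)"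
    using t by (simp add: 1 mult_ac)
  also have "\<dots> = (sqrt t ^ CARD('n) * t powr (- (real CARD('n) / 2))) * avg t h x"
    by (simp add: avg_def)
  finally show ?thesis using 2 by simp
qed

lemma avg_integrable:
  assumes [measurable]: "h \<in> borel_measurable borel" and B: "\<And>z. \<bar>h z\<bar> \<le> B"
  shows "integrable lborel (\<lambda>y. h (x - sqrt t *\<^sub>R y) * K 1 y)"
proof (rule Bochner_Integration.integrable_bound)
  show "integrable lborel (\<lambda>y. B * K 1 y)" using K_1_integrable by simp
  show "AE y in lborel. norm (h (x - sqrt t *\<^sub>R y) * K 1 y) \<le> norm (B * K 1 y)"
    using B K_pos[of 1] by (intro AE_I2) (auto simp: abs_mult intro!: mult_right_mono order_trans[OF B abs_ge_self])
qed simp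

lemma avg_0: "avg 0 h x = h x"
  by (simp add: avg_def K_1_integral)

lemma avg_add:
  assumes "f \<in> borel_measurable borel" "\<And>z. \<bar>f z\<bar> \<le> B" "g \<in> borel_measurable borel" "\<And>z. \<bar>g z\<bar> \<le> B'"
  shows "avg t (\<lambda>x. f x + c * g x) x = avg t f x + c * avg t g x"
  unfolding avg_def
  using avg_integrable[OF assms(1,2), of x t] avg_integrable[OF assms(3,4), of x t]
  by (simp add: distrib_right mult.assoc)

lemma avg_mono:
  assumes "f \<in> borel_measurable borel" "\<And>z. \<bar>f z\<bar> \<le> B" "g \<in> borel_measurable borel" "\<And>z. \<bar>g z\<bar> \<le> B'"
    and "\<And>z. f z \<le> g z"
  shows "avg t f x \<le> avg t g x"
  unfolding avg_def
  by (rule integral_mono) (use avg_integrable assms K_pos[of 1] in \<open>auto intro!: mult_right_mono simp: less_imp_le\<close>)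

lemma avg_const: "avg t (\<lambda>_. c) x = c"
  by (simp add: avg_def K_1_integral)

lemma avg_bounded:
  assumes "h \<in> borel_measurable borel" "\<And>z. \<bar>h z\<bar> \<le> B"
  shows "\<bar>avg t h x\<bar> \<le> B"
proof -
  have "- B \<le> h z" "h z \<le> B" for z using assms(2)[of z] by (auto simp: abs_le_iff)
  then have "avg t h x \<le> avg t (\<lambda>_. B) x" "avg t (\<lambda>_. - B) x \<le> avg t h x"
    using avg_mono[OF assms, of "\<lambda>_. B" "\<bar>B\<bar>"] avg_mono[OF _ _ assms, of "\<lambda>_. - B" "\<bar>B\<bar>"] by auto
  then show ?thesis by (simp add: avg_const abs_le_iff)
qed

lemma avg_continuous:
  assumes h: "continuous_on UNIV h" and B: "\<And>z. \<bar>h z\<bar> \<le> B"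
  shows "continuous_on ({0..} \<times> UNIV) (\<lambda>(t, x). avg t h x)"
  unfolding continuous_on_sequentially
proof (intro allI ballI impI, elim conjE)
  fix X :: "nat \<Rightarrow> real \<times> (real ^ 'n)" and a assume X: "X \<longlonglongrightarrow> a"
  have [measurable]: "h \<in> borel_measurable borel" using h by (rule borel_measurable_continuous_onI)
  obtain t x where a: "a = (t, x)" by (cases a)
  have "(\<lambda>i. \<integral>y. h (snd (X i) - sqrt (fst (X i)) *\<^sub>R y) * K 1 y \<partial>lborel) \<longlonglongrightarrow> (\<integral>y. h (x - sqrt t *\<^sub>R y) * K 1 y \<partial>lborel)"
  proof (rule integral_dominated_convergence[where w = "\<lambda>y. B * K 1 y"])
    show "AE y in lborel. (\<lambda>i. h (snd (X i) - sqrt (fst (X i)) *\<^sub>R y) * K 1 y) \<longlonglongrightarrow> h (x - sqrt t *\<^sub>R y) * K 1 y"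
    proof (rule AE_I2)
      fix y
      have "(\<lambda>i. snd (X i) - sqrt (fst (X i)) *\<^sub>R y) \<longlonglongrightarrow> x - sqrt t *\<^sub>R y"
        using tendsto_snd[OF X] tendsto_fst[OF X] by (auto intro!: tendsto_intros simp: a)
      then have "(\<lambda>i. h (snd (X i) - sqrt (fst (X i)) *\<^sub>R y)) \<longlonglongrightarrow> h (x - sqrt t *\<^sub>R y)"
        by (rule continuous_on_tendsto_compose[OF h]) auto
      then show "(\<lambda>i. h (snd (X i) - sqrt (fst (X i)) *\<^sub>R y) * K 1 y) \<longlonglongrightarrow> h (x - sqrt t *\<^sub>R y) * K 1 y"
        by (intro tendsto_intros)
    qed
    show "AE y in lborel. norm (h (snd (X i) - sqrt (fst (X i)) *\<^sub>R y) * K 1 y) \<le> B * K 1 y" for i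
      using B K_pos[of 1] by (intro AE_I2) (simp add: abs_mult mult_right_mono abs_of_pos less_imp_le)
    show "integrable lborel (\<lambda>y. B * K 1 y)" using K_1_integrable by simp
  qed simp_all
  then show "((\<lambda>(t, x). avg t h x) \<circ> X) \<longlonglongrightarrow> (\<lambda>(t, x). avg t h x) a"
    by (simp add: avg_def o_def case_prod_beta a)
qed

lemma avg_continuous_fixed_time:
  assumes h: "continuous_on UNIV h" and B: "\<And>z. \<bar>h z\<bar> \<le> B" and "0 \<le> t"
  shows "continuous_on UNIV (avg t h)"
proof -
  have "continuous_on UNIV (\<lambda>x::real^'n. (t, x))" by (intro continuous_intros)
  from continuous_on_compose2[OF avg_continuous[OF h B] this] \<open>0 \<le> t\<close> show ?thesis by auto
qed

lemma avg_jet: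
  assumes h: "h \<in> borel_measurable borel" and B: "\<And>z. \<bar>h z\<bar> \<le> B" and t: "t > 0"
  shows "C2_jet (avg t h) (\<lambda>x. \<integral>z. h z *\<^sub>R K1 t (x - z) \<partial>lborel) (\<lambda>x. \<integral>z. h z *\<^sub>R K2 t (x - z) \<partial>lborel)"
proof -
  obtain M where M: "integrable lborel M"
    "\<And>t' y w. t \<le> t' \<Longrightarrow> t' \<le> t \<Longrightarrow> norm w \<le> 1 \<Longrightarrow> \<bar>K t' (y + w)\<bar> \<le> M y"
    "\<And>t' y w. t \<le> t' \<Longrightarrow> t' \<le> t \<Longrightarrow> norm w \<le> 1 \<Longrightarrow> norm (K1 t' (y + w)) \<le> M y"
    "\<And>t' y w. t \<le> t' \<Longrightarrow> t' \<le> t \<Longrightarrow> norm w \<le> 1 \<Longrightarrow> norm (K2 t' (y + w)) \<le> M y"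
    using K_majorant[OF t order_refl] by blast
  have "avg t h = (\<lambda>x. \<integral>z. h z * K t (x - z) \<partial>lborel)" using avg_convolution[OF h t] by auto
  then show ?thesis using C2_jet_convolution[OF K_jet[OF t] M(1) _ _ _ h B] M(2-4) by auto
qed

lemma K2_integrable:
  assumes t: "t > 0"
  shows "integrable lborel (K2 t)"
proof -
  obtain M where M: "integrable lborel M"
    "\<And>t' y w. t \<le> t' \<Longrightarrow> t' \<le> t \<Longrightarrow> norm w \<le> 1 \<Longrightarrow> norm (K2 t' (y + w)) \<le> M y"
    using K_majorant[OF t order_refl] by metis
  have [measurable]: "K2 t \<in> borel_measurable borel"
    using C2_jetD(3)[OF K_jet[OF t]] by (rule borel_measurable_continuous_onI)
  show ?thesis by (rule Bochner_Integration.integrable_bound[OF M(1)])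
      (use M(2)[of t 0] in \<open>auto intro!: AE_I2 intro: order_trans[OF _ abs_ge_self]\<close>)
qed

lemma avg_time_derivative:
  assumes h[measurable]: "h \<in> borel_measurable borel" and B: "\<And>z. \<bar>h z\<bar> \<le> B" and t: "t > 0"
  shows "((\<lambda>t. avg t h x) has_real_derivative A \<bullet> (\<integral>z. h z *\<^sub>R K2 t (x - z) \<partial>lborel)) (at t)"
proof -
  have "0 \<le> B" using B[of 0] by linarith
  have t2: "0 < t / 2" "t / 2 \<le> 2 * t" using t by simp_all
  obtain M where M: "integrable lborel M"
    "\<And>t' y w. t / 2 \<le> t' \<Longrightarrow> t' \<le> 2 * t \<Longrightarrow> norm w \<le> 1 \<Longrightarrow> \<bar>K t' (y + w)\<bar> \<le> M y"
    "\<And>t' y w. t / 2 \<le> t' \<Longrightarrow> t' \<le> 2 * t \<Longrightarrow> norm w \<le> 1 \<Longrightarrow> norm (K1 t' (y + w)) \<le> M y"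
    "\<And>t' y w. t / 2 \<le> t' \<Longrightarrow> t' \<le> 2 * t \<Longrightarrow> norm w \<le> 1 \<Longrightarrow> norm (K2 t' (y + w)) \<le> M y"
    by (rule K_majorant[OF t2]) blast
  have [measurable]: "K2 t \<in> borel_measurable borel"
    using C2_jetD(3)[OF K_jet[OF t]] by (rule borel_measurable_continuous_onI)
  have AK2: "\<bar>A \<bullet> K2 s y\<bar> \<le> norm A * M y" if "s \<in> ball t (t / 2)" for s y
  proof -
    have "norm (K2 s y) \<le> M y" using M(4)[of s 0 y] that by (simp add: dist_real_def abs_if split: if_splits)
    then show ?thesis using Cauchy_Schwarz_ineq2[of A "K2 s y"] by (meson mult_left_mono norm_ge_zero order_trans)
  qed
  have "((\<lambda>s. \<integral>z. h z * K s (x - z) \<partial>lborel) has_derivative (\<lambda>d. \<integral>z. h z * (A \<bullet> K2 t (x - z)) * d \<partial>lborel)) (at t)"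
  proof (rule has_derivative_integral[where r = "t / 2" and m = "\<lambda>z. B * (norm A * M (x - z))"])
    show "0 < t / 2" using t by simp
    show "integrable lborel (\<lambda>z. B * (norm A * M (x - z)))" using lborel_integrable_reflect[OF M(1)] by simp
    show "integrable lborel (\<lambda>z. h z * K s (x - z))" if "s \<in> ball t (t / 2)" for s
    proof -
      have s: "t / 2 \<le> s" "s \<le> 2 * t" using that t by (auto simp: dist_real_def abs_if split: if_splits)
      have "integrable lborel (\<lambda>z. h z *\<^sub>R K s (x - z))"
        by (rule integrable_bounded_times_kernel[where M = M]) (use B M(1) M(2)[OF s, of 0] in auto)
      then show ?thesis by simp
    qed
    show "((\<lambda>s. h z * K s (x - z)) has_derivative (\<lambda>d. h z * (A \<bullet> K2 t (x - z)) * d)) (at t)" for z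
      using DERIV_cmult[OF K_time_derivative[OF t], of "h z" "x - z"] by (simp add: has_field_derivative_def)
    show "norm (h z * (A \<bullet> K2 t (x - z)) * d) \<le> B * (norm A * M (x - z)) * norm d" for z d
      using mult_mono[OF B[of z] AK2[of t "x - z"] \<open>0 \<le> B\<close>] t by (simp add: abs_mult mult_right_mono)
    show "norm (h z * K s (x - z) - h z * K t (x - z)) \<le> B * (norm A * M (x - z)) * norm (s - t)" if s: "s \<in> ball t (t / 2)" for s z
    proof -
      have "norm (K s (x - z) - K t (x - z)) \<le> norm A * M (x - z) * norm (s - t)"
      proof (rule field_differentiable_bound[of "ball t (t / 2)" "\<lambda>s. K s (x - z)" "\<lambda>s. A \<bullet> K2 s (x - z)"])
        show "((\<lambda>s. K s (x - z)) has_field_derivative A \<bullet> K2 r (x - z)) (at r within ball t (t / 2))" if "r \<in> ball t (t / 2)" for r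
          by (rule has_field_derivative_at_within[OF K_time_derivative]) (use that t in \<open>auto simp: dist_real_def abs_if split: if_splits\<close>)
      qed (use s t AK2 in auto)
      then have "\<bar>h z\<bar> * norm (K s (x - z) - K t (x - z)) \<le> B * (norm A * M (x - z) * norm (s - t))"
        using B \<open>0 \<le> B\<close> by (intro mult_mono) auto
      then show ?thesis by (simp add: right_diff_distrib[symmetric] abs_mult mult.assoc)
    qed
  qed measurable
  moreover have "integrable lborel (\<lambda>z. h z *\<^sub>R K2 t (x - z))"
    by (rule integrable_bounded_times_kernel[where M = "\<lambda>y. norm (K2 t y)"]) (use B K2_integrable[OF t] in auto)
  then have "(\<integral>z. h z * (A \<bullet> K2 t (x - z)) \<partial>lborel) = A \<bullet> (\<integral>z. h z *\<^sub>R K2 t (x - z) \<partial>lborel)"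
    using integral_bounded_linear[OF bounded_linear_inner_right, of lborel "\<lambda>z. h z *\<^sub>R K2 t (x - z)" A] by simp
  ultimately have "((\<lambda>s. \<integral>z. h z * K s (x - z) \<partial>lborel) has_real_derivative A \<bullet> (\<integral>z. h z *\<^sub>R K2 t (x - z) \<partial>lborel)) (at t)"
    by (simp add: has_field_derivative_def)
  then show ?thesis
    by (rule has_field_derivative_transform_within_open[where S = "{0<..}"]) (use t avg_convolution[OF h] in auto)
qed

text \<open>Most of the mass of the kernel lies in a large ball, where \<open>sqrt t *\<^sub>R y\<close> is small and uniform
continuity applies; the tail is estimated by the bound on \<open>h\<close>.\<close>
lemma avg_uniformly_close:
  assumes h: "uniformly_continuous_on UNIV h" and B: "\<And>z. \<bar>h z\<bar> \<le> B" and e: "e > 0"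
  obtains T where "T > 0" "\<And>t x. 0 \<le> t \<Longrightarrow> t \<le> T \<Longrightarrow> \<bar>avg t h x - h x\<bar> \<le> e"
proof -
  have hc: "continuous_on UNIV h" using h by (rule uniformly_continuous_imp_continuous)
  have hm[measurable]: "h \<in> borel_measurable borel" using hc by (rule borel_measurable_continuous_onI)
  have "0 \<le> B" using B[of 0] by linarith
  have "((\<lambda>N. \<integral>y. K 1 y * indicator {y. norm y > real N} y \<partial>lborel) \<longlongrightarrow> (LINT y|(lborel :: (real^'n) measure). 0)) sequentially"
  proof (rule integral_dominated_convergence[where w = "K 1"])
    show "AE y in lborel. (\<lambda>N. K 1 y * indicator {y. norm y > real N} y) \<longlonglongrightarrow> 0"
    proof (rule AE_I2)
      fix y :: "real ^ 'n"
      obtain n where "norm y < real n" using reals_Archimedean2 by blast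
      then have "eventually (\<lambda>N. K 1 y * indicator {y. norm y > real N} y = 0) sequentially"
        by (intro eventually_sequentiallyI[of n]) (auto simp: indicator_def)
      then show "(\<lambda>N. K 1 y * indicator {y. norm y > real N} y) \<longlonglongrightarrow> 0" by (rule tendsto_eventually)
    qed
    show "AE y in lborel. norm (K 1 y * indicator {y. norm y > real N} y) \<le> K 1 y" for N
      using K_pos[of 1] by (intro AE_I2) (auto simp: indicator_def less_imp_le)
  qed (use K_1_integrable in auto)
  then have "eventually (\<lambda>N. (\<integral>y. K 1 y * indicator {y. norm y > real N} y \<partial>lborel) < e / (4 * (B + 1))) sequentially"
    using e \<open>0 \<le> B\<close> by (intro order_tendstoD) auto
  then obtain N :: nat where N: "(\<integral>y. K 1 y * indicator {y. norm y > real N} y \<partial>lborel) < e / (4 * (B + 1))"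
    by (auto simp: eventually_sequentially)
  obtain d where d: "d > 0" "\<And>x x'. dist x' x < d \<Longrightarrow> dist (h x') (h x) < e / 2"
    using h e unfolding uniformly_continuous_on_def by (metis UNIV_I half_gt_zero)
  define T where "T = (d / (real N + 1))\<^sup>2"
  have T: "T > 0" using d by (simp add: T_def)
  have "\<bar>avg t h x - h x\<bar> \<le> e" if t: "0 \<le> t" "t \<le> T" for t x
  proof -
    have ih: "integrable lborel (\<lambda>y. h (x - sqrt t *\<^sub>R y) * K 1 y)" by (rule avg_integrable[OF hm B])
    have "avg t h x - h x = (\<integral>y. h (x - sqrt t *\<^sub>R y) * K 1 y - h x * K 1 y \<partial>lborel)"
      using ih K_1_integrable by (simp add: avg_def K_1_integral)
    moreover have "\<bar>\<dots>\<bar> \<le> (\<integral>y. e / 2 * K 1 y + 2 * B * (K 1 y * indicator {y. norm y > real N} y) \<partial>lborel)"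
    proof (rule integral_abs_bound_integral)
      show "integrable lborel (\<lambda>y. h (x - sqrt t *\<^sub>R y) * K 1 y - h x * K 1 y)" using ih K_1_integrable by simp
      show "integrable lborel (\<lambda>y. e / 2 * K 1 y + 2 * B * (K 1 y * indicator {y. norm y > real N} y))"
        using K_1_integrable by (intro Bochner_Integration.integrable_add integrable_mult_right integrable_real_mult_indicator) auto
      fix y
      have K0: "K 1 y > 0" using K_pos by simp
      have "\<bar>h (x - sqrt t *\<^sub>R y) - h x\<bar> \<le> e / 2 + 2 * B * indicator {y. norm y > real N} y"
      proof (cases "norm y > real N")
        case True
        then show ?thesis using B[of "x - sqrt t *\<^sub>R y"] B[of x] e by (auto simp: indicator_def)
      next
        case False
        have "sqrt t \<le> d / (real N + 1)" using t d by (auto simp: T_def intro!: real_le_lsqrt)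
        then have "sqrt t * norm y \<le> d / (real N + 1) * real N" using False t d by (intro mult_mono) auto
        also have "\<dots> < d" using d by (simp add: field_simps)
        finally have "dist (x - sqrt t *\<^sub>R y) x < d" using t by (simp add: dist_norm)
        from d(2)[OF this] show ?thesis using False by (simp add: dist_real_def indicator_def)
      qed
      then have le: "\<bar>h (x - sqrt t *\<^sub>R y) - h x\<bar> * K 1 y \<le> (e / 2 + 2 * B * indicator {y. norm y > real N} y) * K 1 y"
        using K0 by (intro mult_right_mono) auto
      then show "\<bar>h (x - sqrt t *\<^sub>R y) * K 1 y - h x * K 1 y\<bar> \<le> e / 2 * K 1 y + 2 * B * (K 1 y * indicator {y. norm y > real N} y)"
      proof -
        have "\<bar>h (x - sqrt t *\<^sub>R y) * K 1 y - h x * K 1 y\<bar> = \<bar>h (x - sqrt t *\<^sub>R y) - h x\<bar> * K 1 y"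
          using K0 by (simp add: left_diff_distrib[symmetric] abs_mult)
        then show ?thesis using le by (simp add: algebra_simps)
      qed
    qed
    moreover have "(\<integral>y. e / 2 * K 1 y + 2 * B * (K 1 y * indicator {y. norm y > real N} y) \<partial>lborel)
       = e / 2 + 2 * B * (\<integral>y. K 1 y * indicator {y. norm y > real N} y \<partial>lborel)"
      using K_1_integrable by (subst Bochner_Integration.integral_add)
        (auto intro!: integrable_mult_right integrable_real_mult_indicator simp: K_1_integral)
    moreover have "2 * B * (\<integral>y. K 1 y * indicator {y. norm y > real N} y \<partial>lborel) \<le> 2 * B * (e / (4 * (B + 1)))"
      using N \<open>0 \<le> B\<close> by (intro mult_left_mono) auto
    moreover have "2 * B * (e / (4 * (B + 1))) \<le> e / 2" using \<open>0 \<le> B\<close> e by (simp add: field_simps)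
    ultimately show ?thesis by linarith
  qed
  with T that show ?thesis by blast
qed

end

text \<open>Both sides are the same double integral, by Fubini.\<close>
lemma avg_commute:
  assumes 1: "heat_kernel A C q" and 2: "heat_kernel A' C' q'"
    and h[measurable]: "h \<in> borel_measurable borel" and B: "\<And>z. \<bar>h z\<bar> \<le> B"
  shows "heat_kernel.avg C s (heat_kernel.avg C' t h) x = heat_kernel.avg C' t (heat_kernel.avg C s h) x"
proof -
  interpret k1: heat_kernel A C q by fact
  interpret k2: heat_kernel A' C' q' by fact
  have "0 \<le> B" using B[of 0] by linarith
  define F where "F y z = h (x - sqrt s *\<^sub>R y - sqrt t *\<^sub>R z) * k2.K 1 z * k1.K 1 y" for y z
  have [measurable]: "case_prod F \<in> borel_measurable (lborel \<Otimes>\<^sub>M lborel)" unfolding F_def by measurable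
  have inner: "integrable lborel (\<lambda>z. F y z)" for y
    unfolding F_def using k2.avg_integrable[OF h B, of "x - sqrt s *\<^sub>R y" t] by simp
  have "integrable (lborel \<Otimes>\<^sub>M lborel) (case_prod F)"
  proof (rule lborel_pair.Fubini_integrable)
    have "integrable lborel (\<lambda>y. B * k1.K 1 y)" using k1.K_1_integrable by simp
    then show "integrable lborel (\<lambda>y. \<integral>z. norm (case_prod F (y, z)) \<partial>lborel)"
    proof (rule Bochner_Integration.integrable_bound)
      show "AE y in lborel. norm (\<integral>z. norm (case_prod F (y, z)) \<partial>lborel) \<le> norm (B * k1.K 1 y)"
      proof (rule AE_I2)
        fix y
        have K1: "k1.K 1 y > 0" using k1.K_pos by simp
        have "(\<integral>z. norm (F y z) \<partial>lborel) \<le> (\<integral>z. B * k1.K 1 y * k2.K 1 z \<partial>lborel)"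
        proof (rule integral_mono)
          show "norm (F y z) \<le> B * k1.K 1 y * k2.K 1 z" for z
            using B[of "x - sqrt s *\<^sub>R y - sqrt t *\<^sub>R z"] K1 k2.K_pos[of 1 z]
            by (simp add: F_def abs_mult mult_ac mult_left_mono)
        qed (use inner k2.K_1_integrable in auto)
        also have "\<dots> = B * k1.K 1 y" by (simp add: k2.K_1_integral)
        finally show "norm (\<integral>z. norm (case_prod F (y, z)) \<partial>lborel) \<le> norm (B * k1.K 1 y)" by simp
      qed
    qed measurable
  qed (use inner in auto)
  then have "(\<integral>y. \<integral>z. F y z \<partial>lborel \<partial>lborel) = (\<integral>z. \<integral>y. F y z \<partial>lborel \<partial>lborel)"
    by (rule lborel_pair.Fubini_integral[symmetric])
  moreover have "(\<integral>y. \<integral>z. F y z \<partial>lborel \<partial>lborel) = k1.avg s (k2.avg t h) x"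
    by (simp add: k1.avg_def k2.avg_def F_def)
  moreover have "(\<integral>z. \<integral>y. F y z \<partial>lborel \<partial>lborel) = k2.avg t (k1.avg s h) x"
  proof -
    have "F y z = h (x - sqrt t *\<^sub>R z - sqrt s *\<^sub>R y) * k1.K 1 y * k2.K 1 z" for y z
    proof -
      have "x - sqrt s *\<^sub>R y - sqrt t *\<^sub>R z = x - sqrt t *\<^sub>R z - sqrt s *\<^sub>R y" by (simp add: algebra_simps)
      then show ?thesis unfolding F_def by (simp only: mult_ac)
    qed
    then show ?thesis by (simp add: k1.avg_def k2.avg_def)
  qed
  ultimately show ?thesis by simp
qed

section \<open>Mollification of supersolutions and the equation of a difference\<close>

lemma C2_jet_unique:
  assumes "C2_jet \<phi> g H" "C2_jet \<phi> g' H'"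
  shows "g = g'" "H = H'"
proof -
  have "g x = g' x" for x
  proof -
    have "(\<lambda>h. g x \<bullet> h) = (\<lambda>h. g' x \<bullet> h)"
      using has_derivative_unique[OF C2_jetD(1)[OF assms(1)] C2_jetD(1)[OF assms(2)]] .
    then show ?thesis by (simp add: fun_eq_iff vector_eq_rdot)
  qed
  then show "g = g'" by blast
  have "H x = H' x" for x
  proof -
    have "(\<lambda>h. H x *v h) = (\<lambda>h. H' x *v h)"
      using has_derivative_unique[OF C2_jetD(2)[OF assms(1)]] C2_jetD(2)[OF assms(2)] \<open>g = g'\<close> by metis
    then show ?thesis by (simp add: matrix_eq fun_eq_iff)
  qed
  then show "H = H'" by blast
qed

lemma bounded_linear_transpose: "bounded_linear (transpose :: real ^ 'n ^ 'n \<Rightarrow> real ^ 'n ^ 'n)"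
  unfolding linear_conv_bounded_linear[symmetric]
  by (intro linearI) (simp_all add: transpose_add transpose_scaleR)

lemma transpose_diff: "transpose (X - Y) = transpose X - transpose (Y :: real ^ 'n ^ 'n)"
  by (simp add: transpose_def vec_eq_iff)

text \<open>Viscosity supersolutions of \<open>A \<bullet> D\<^sup>2 a + f \<le> 0\<close>, tested only by functions that touch from below globally and
have symmetric Hessians, which suffices for comparison with the heat flow.\<close>
definition linear_supersolution :: "real ^ 'n ^ 'n \<Rightarrow> (real ^ 'n \<Rightarrow> real) \<Rightarrow> (real ^ 'n \<Rightarrow> real) \<Rightarrow> bool" where
  "linear_supersolution A f a \<longleftrightarrow> (\<forall>\<phi> g H x\<^sub>0. C2_jet \<phi> g H \<and> (\<forall>x. transpose (H x) = H x) \<and>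
     (\<forall>x. a x\<^sub>0 - \<phi> x\<^sub>0 \<le> a x - \<phi> x) \<longrightarrow> A \<bullet> H x\<^sub>0 + f x\<^sub>0 \<le> 0)"

lemma linear_supersolutionD:
  assumes "linear_supersolution A f a" "C2_jet \<phi> g H" "\<And>x. transpose (H x) = H x" "\<And>x. a x\<^sub>0 - \<phi> x\<^sub>0 \<le> a x - \<phi> x"
  shows "A \<bullet> H x\<^sub>0 + f x\<^sub>0 \<le> 0"
  using assms unfolding linear_supersolution_def by blast

context heat_kernel
begin

lemma K2_symmetric: "transpose (K2 t y) = K2 t y"
  by (simp add: K2_def transpose_scaleR transpose_diff transpose_outer symC)

lemma avg_hessian_symmetric:
  assumes "h \<in> borel_measurable borel" "\<And>z. \<bar>h z\<bar> \<le> B" "t > 0"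
  shows "transpose (\<integral>z. h z *\<^sub>R K2 t (x - z) \<partial>lborel) = (\<integral>z. h z *\<^sub>R K2 t (x - z) \<partial>lborel)"
proof -
  have [measurable]: "K2 t \<in> borel_measurable borel"
    using C2_jetD(3)[OF K_jet[OF assms(3)]] by (rule borel_measurable_continuous_onI)
  have "integrable lborel (\<lambda>z. h z *\<^sub>R K2 t (x - z))"
    by (rule integrable_bounded_times_kernel[where M = "\<lambda>y. norm (K2 t y)"])
       (use assms K2_integrable[OF assms(3)] in auto)
  from integral_bounded_linear[OF bounded_linear_transpose this] show ?thesis
    by (simp add: transpose_scaleR K2_symmetric)
qed

text \<open>The function \<open>V = P\<^sub>t a + t P\<^sub>t f - t e\<close> satisfies \<open>\<partial>\<^sub>t V = A \<bullet> D\<^sup>2 V + P\<^sub>t f - e\<close>, and \<open>P\<^sub>t f - e\<close> is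
at most \<open>f - e / 2\<close> for short times. If \<open>V\<close> exceeded \<open>a\<close> somewhere, then at
a maximum of the (penalised) difference it would be nondecreasing in time and touch \<open>a\<close> from below in space,
and the supersolution property would contradict the equation for \<open>V\<close>.\<close>
lemma supersolution_dominates_heat_flow:
  assumes a: "uniformly_continuous_on UNIV a" "\<And>z. \<bar>a z\<bar> \<le> Ba"
    and f: "uniformly_continuous_on UNIV f" "\<And>z. \<bar>f z\<bar> \<le> Bf"
    and super: "linear_supersolution A f a"
    and e: "e > 0"
  obtains T where "T > 0" "\<And>t x. 0 \<le> t \<Longrightarrow> t \<le> T \<Longrightarrow> avg t a x + t * avg t f x - t * e \<le> a x"
proof -
  have ac: "continuous_on UNIV a" and fc: "continuous_on UNIV f"
    using a f by (auto intro: uniformly_continuous_imp_continuous)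
  have am: "a \<in> borel_measurable borel" and fm: "f \<in> borel_measurable borel"
    using ac fc by (auto intro: borel_measurable_continuous_onI)
  have B0: "0 \<le> Ba" "0 \<le> Bf" using a(2)[of 0] f(2)[of 0] by linarith+
  obtain T where T: "T > 0" and close: "\<And>t x. 0 \<le> t \<Longrightarrow> t \<le> T \<Longrightarrow> \<bar>avg t f x - f x\<bar> \<le> e / 2"
    using avg_uniformly_close[OF f, of "e / 2"] e by auto
  define V where "V t x = avg t a x + t * avg t f x - t * e" for t x
  \<comment> \<open>The penalisation \<open>\<theta> |x|\<^sup>2\<close> makes the maximum attained; for \<open>\<theta> \<le> \<theta>0\<close> it perturbs the equation by at most \<open>e / 4\<close>.\<close>
  define \<theta>0 where "\<theta>0 = e / (8 * (\<bar>trace A\<bar> + 1))"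
  have th0: "\<theta>0 > 0" unfolding \<theta>0_def using e by (intro divide_pos_pos) auto
  have penal: "V t1 x1 \<le> a x1 + \<theta> * (norm x1)\<^sup>2" if \<theta>: "0 < \<theta>" "\<theta> \<le> \<theta>0" and t1: "0 \<le> t1" "t1 \<le> T" for \<theta> t1 x1
  proof (rule ccontr)
    assume neg: "\<not> ?thesis"
    define W where "W p = V (fst p) (snd p) - a (snd p) - \<theta> * (norm (snd p))\<^sup>2" for p :: "real \<times> (real ^ 'n)"
    \<comment> \<open>a bound for \<open>V - a\<close>, so that the penalised difference is nonpositive outside the ball of radius \<open>R\<close>\<close>
    define M where "M = 2 * Ba + T * Bf"
    define R where "R = sqrt (M / \<theta>) + norm x1"
    have M0: "M \<ge> 0" using B0 T by (simp add: M_def)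
    have far: "W (t, x) \<le> 0" if "0 \<le> t" "t \<le> T" "norm x > R" for t x
    proof -
      have "t * avg t f x \<le> T * Bf"
      proof -
        have "t * avg t f x \<le> t * Bf"
          using avg_bounded[OF fm f(2), of t x] that(1) by (intro mult_left_mono) (auto simp: abs_le_iff)
        also have "\<dots> \<le> T * Bf" using that(2) B0 by (intro mult_right_mono) auto
        finally show ?thesis .
      qed
      moreover have "avg t a x \<le> Ba" "- a x \<le> Ba" "0 \<le> t * e"
        using avg_bounded[OF am a(2), of t x] a(2)[of x] that e by (auto simp: abs_le_iff)
      moreover have "M \<le> \<theta> * (norm x)\<^sup>2"
      proof -
        have "sqrt (M / \<theta>) \<le> norm x" using that(3) unfolding R_def by (smt (verit) norm_ge_zero)
        then have "(sqrt (M / \<theta>))\<^sup>2 \<le> (norm x)\<^sup>2" using M0 \<theta> by (intro power_mono) auto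
        then show ?thesis using M0 \<theta> by (simp add: field_simps)
      qed
      ultimately show ?thesis by (simp add: W_def V_def M_def)
    qed
    let ?D = "{0..T} \<times> cball (0 :: real ^ 'n) R"
    have p1: "(t1, x1) \<in> ?D" using t1 M0 \<theta> by (simp add: R_def)
    have "continuous_on ?D W"
    proof -
      have sub: "?D \<subseteq> {0..} \<times> UNIV" by auto
      have "continuous_on ?D (\<lambda>p. avg (fst p) a (snd p))" "continuous_on ?D (\<lambda>p. avg (fst p) f (snd p))"
        using continuous_on_subset[OF avg_continuous[OF ac a(2)] sub] continuous_on_subset[OF avg_continuous[OF fc f(2)] sub]
        by (simp_all add: case_prod_beta')
      moreover have "continuous_on ?D (\<lambda>p. a (snd p))"
        by (rule continuous_on_compose2[OF ac]) (auto intro: continuous_intros)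
      ultimately show ?thesis unfolding W_def V_def by (intro continuous_intros)
    qed
    moreover have "compact ?D" by (intro compact_Times compact_Icc compact_cball)
    ultimately obtain p0 where p0: "p0 \<in> ?D" and pmax: "\<And>p. p \<in> ?D \<Longrightarrow> W p \<le> W p0"
      using continuous_attains_sup[of ?D W] p1 by blast
    obtain t0 x0 where p0eq: "p0 = (t0, x0)" by (cases p0)
    have Wpos: "W (t0, x0) > 0"
      using pmax[OF p1] neg by (simp add: p0eq W_def)
    have t0: "0 \<le> t0" "t0 \<le> T" using p0 by (auto simp: p0eq)
    have gmax: "W (t, x) \<le> W (t0, x0)" if "0 \<le> t" "t \<le> T" for t x
      using pmax[of "(t, x)"] far[OF that, of x] that Wpos by (cases "norm x > R") (auto simp: p0eq)
    have t0pos: "t0 > 0"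
    proof (rule ccontr)
      assume "\<not> t0 > 0"
      then have "t0 = 0" using t0 by simp
      then have "W (t0, x0) \<le> 0" using \<theta> by (simp add: W_def V_def avg_0)
      with Wpos show False by simp
    qed
    define Ha where "Ha x = (\<integral>z. a z *\<^sub>R K2 t0 (x - z) \<partial>lborel)" for x
    define Hf where "Hf x = (\<integral>z. f z *\<^sub>R K2 t0 (x - z) \<partial>lborel)" for x
    obtain ga gf where ja: "C2_jet (avg t0 a) ga Ha" and jf: "C2_jet (avg t0 f) gf Hf"
      using avg_jet[OF am a(2) t0pos] avg_jet[OF fm f(2) t0pos] unfolding Ha_def Hf_def by blast
    have jV: "C2_jet (\<lambda>x. (avg t0 a x + t0 * avg t0 f x + (- t0 * e)) - \<theta> * (norm (x - 0))\<^sup>2)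
        (\<lambda>x. (ga x + t0 *\<^sub>R gf x + 0) - \<theta> *\<^sub>R (2 *\<^sub>R (x - 0))) (\<lambda>x. (Ha x + t0 *\<^sub>R Hf x + 0) - \<theta> *\<^sub>R (2 *\<^sub>R mat 1))"
      by (intro C2_jet_diff C2_jet_add C2_jet_scale C2_jet_const C2_jet_norm_square ja jf)
    have "A \<bullet> ((Ha x0 + t0 *\<^sub>R Hf x0 + 0) - \<theta> *\<^sub>R (2 *\<^sub>R mat 1)) + f x0 \<le> 0"
    proof (rule linear_supersolutionD[OF super jV])
      show "transpose ((Ha x + t0 *\<^sub>R Hf x + 0) - \<theta> *\<^sub>R (2 *\<^sub>R mat 1)) = (Ha x + t0 *\<^sub>R Hf x + 0) - \<theta> *\<^sub>R (2 *\<^sub>R mat 1)" for x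
        unfolding Ha_def Hf_def
        by (simp add: transpose_diff transpose_add transpose_scaleR transpose_mat
            avg_hessian_symmetric[OF am a(2) t0pos] avg_hessian_symmetric[OF fm f(2) t0pos])
      show "a x0 - ((avg t0 a x0 + t0 * avg t0 f x0 + (- t0 * e)) - \<theta> * (norm (x0 - 0))\<^sup>2)
          \<le> a x - ((avg t0 a x + t0 * avg t0 f x + (- t0 * e)) - \<theta> * (norm (x - 0))\<^sup>2)" for x
        using gmax[OF t0, of x] by (simp add: W_def V_def)
    qed
    then have space: "A \<bullet> Ha x0 + t0 * (A \<bullet> Hf x0) + f x0 \<le> 2 * \<theta> * trace A"
      by (simp add: inner_diff_right inner_add_right inner_mat_1 mult_ac)
    have "((\<lambda>t. avg t a x0 + t * avg t f x0 - t * e) has_real_derivative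
        A \<bullet> Ha x0 + (1 * avg t0 f x0 + A \<bullet> Hf x0 * t0) - 1 * e) (at t0)"
      unfolding Ha_def Hf_def
      by (intro DERIV_diff DERIV_add DERIV_mult DERIV_cmult_right DERIV_ident
           avg_time_derivative[OF am a(2) t0pos] avg_time_derivative[OF fm f(2) t0pos])
    \<comment> \<open>By the two conditions at the maximum, the time derivative is negative, so slightly earlier the difference was larger.\<close>
    then have time: "((\<lambda>t. V t x0) has_real_derivative A \<bullet> Ha x0 + (avg t0 f x0 + A \<bullet> Hf x0 * t0) - e) (at t0)"
      by (simp add: V_def)
    have "2 * \<theta> * trace A \<le> e / 4"
    proof -
      have "2 * \<theta> * trace A \<le> 2 * \<theta> * (\<bar>trace A\<bar> + 1)" using \<theta> by (intro mult_left_mono) auto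
      also have "\<dots> \<le> 2 * \<theta>0 * (\<bar>trace A\<bar> + 1)" using \<theta> by (intro mult_right_mono) auto
      also have "\<dots> = e / 4" unfolding \<theta>0_def by (simp add: field_simps)
      finally show ?thesis .
    qed
    then have "A \<bullet> Ha x0 + (avg t0 f x0 + A \<bullet> Hf x0 * t0) - e < 0"
      using space abs_le_D1[OF close[OF t0, of x0]] e mult.commute[of "A \<bullet> Hf x0" t0] by linarith
    from DERIV_neg_dec_left[OF time this] obtain d where d: "d > 0"
      "\<And>h. h > 0 \<Longrightarrow> h < d \<Longrightarrow> V t0 x0 < V (t0 - h) x0" by blast
    define h where "h = min (d / 2) t0"
    have h: "h > 0" "h < d" "0 \<le> t0 - h" "t0 - h \<le> T" using d t0pos t0 by (auto simp: h_def min_def)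
    have "V t0 x0 < V (t0 - h) x0" by (rule d(2)[OF h(1,2)])
    moreover have "W (t0 - h, x0) \<le> W (t0, x0)" by (rule gmax[OF h(3,4)])
    ultimately show False by (simp add: W_def)
  qed
  have "V t x \<le> a x" if t: "0 \<le> t" "t \<le> T" for t x
  proof (rule field_le_epsilon)
    fix d :: real assume d: "d > 0"
    have n: "1 + (norm x)\<^sup>2 > 0" by (simp add: add_pos_nonneg)
    define \<theta> where "\<theta> = min \<theta>0 (d / (1 + (norm x)\<^sup>2))"
    have \<theta>: "0 < \<theta>" "\<theta> \<le> \<theta>0" using th0 d n by (auto simp: \<theta>_def)
    have "\<theta> * (norm x)\<^sup>2 \<le> d / (1 + (norm x)\<^sup>2) * (1 + (norm x)\<^sup>2)"
      using d n by (intro mult_mono) (auto simp: \<theta>_def)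
    also have "\<dots> = d" using n by simp
    finally show "V t x \<le> a x + d" using penal[OF \<theta> t, of x] by linarith
  qed
  with T that show ?thesis by (simp add: V_def)
qed

end

lemma isotropic_heat_kernel: "heat_kernel (mat 1) (mat 1 :: real ^ 'n ^ 'n) 1"
  by unfold_locales (simp_all add: transpose_mat)

interpretation iso: heat_kernel "mat 1 :: real ^ 'n ^ 'n" "mat 1" 1
  by (rule isotropic_heat_kernel)

definition smoothed_hessian :: "real \<Rightarrow> (real ^ 'n \<Rightarrow> real) \<Rightarrow> real ^ 'n \<Rightarrow> real ^ 'n ^ 'n" where
  "smoothed_hessian \<tau> h x = (\<integral>z. h z *\<^sub>R iso.K2 \<tau> (x - z) \<partial>lborel)"

text \<open>The mollifier is the isotropic Gaussian, whatever \<open>A\<close> is, since the same mollified function has to serve all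
elliptic \<open>A\<close> at once. Mollify the inequality between \<open>a\<close> and its heat flow, use that the two averages commute,
and divide by \<open>t\<close>: by the mean value theorem the difference quotient is \<open>A \<bullet> D\<^sup>2\<close> of the mollified heat flow at
an intermediate time, which converges because the Hessian falls on the mollifier.\<close>
lemma mollified_linear_supersolution:
  fixes A C :: "real ^ 'n ^ 'n"
  assumes hk: "heat_kernel A C q"
    and a: "uniformly_continuous_on UNIV a" "\<And>z. \<bar>a z\<bar> \<le> Ba"
    and f: "uniformly_continuous_on UNIV f" "\<And>z. \<bar>f z\<bar> \<le> Bf"
    and super: "linear_supersolution A f a"
    and \<tau>: "\<tau> > 0"
  shows "A \<bullet> smoothed_hessian \<tau> a x + iso.avg \<tau> f x \<le> 0"
proof -
  interpret k: heat_kernel A C q by fact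
  have ac: "continuous_on UNIV a" and fc: "continuous_on UNIV f"
    using a f by (auto intro: uniformly_continuous_imp_continuous)
  have am[measurable]: "a \<in> borel_measurable borel" and fm[measurable]: "f \<in> borel_measurable borel"
    using ac fc by (auto intro: borel_measurable_continuous_onI)
  have k2m[measurable]: "iso.K2 \<tau> \<in> borel_measurable borel"
    using C2_jetD(3)[OF iso.K_jet[OF \<tau>]] by (rule borel_measurable_continuous_onI)
  define g where "g = iso.avg \<tau> a"
  \<comment> \<open>bounds the change of \<open>A \<bullet> smoothed_hessian\<close> when its argument changes by at most 1\<close>
  define I where "I = norm A * (\<integral>z. norm (iso.K2 \<tau> z :: real ^ 'n ^ 'n) \<partial>lborel)"
  have gb: "\<bar>g z\<bar> \<le> Ba" for z unfolding g_def by (rule iso.avg_bounded[OF am a(2)])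
  have gc: "continuous_on UNIV g" unfolding g_def
    by (rule iso.avg_continuous_fixed_time[OF ac a(2)]) (use \<tau> in simp)
  have gm[measurable]: "g \<in> borel_measurable borel" using gc by (rule borel_measurable_continuous_onI)
  have main: "A \<bullet> smoothed_hessian \<tau> a x + iso.avg \<tau> f x \<le> e * (2 + I)" if e: "e > 0" for e
  proof -
    obtain T1 where T1: "T1 > 0" "\<And>t x. 0 \<le> t \<Longrightarrow> t \<le> T1 \<Longrightarrow> k.avg t a x + t * k.avg t f x - t * e \<le> a x"
      using k.supersolution_dominates_heat_flow[OF a f super e] by blast
    obtain T2 where T2: "T2 > 0" "\<And>t x. 0 \<le> t \<Longrightarrow> t \<le> T2 \<Longrightarrow> \<bar>k.avg t a x - a x\<bar> \<le> e"
      using k.avg_uniformly_close[OF a e] by blast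
    obtain T3 where T3: "T3 > 0" "\<And>t x. 0 \<le> t \<Longrightarrow> t \<le> T3 \<Longrightarrow> \<bar>k.avg t f x - f x\<bar> \<le> e"
      using k.avg_uniformly_close[OF f e] by blast
    define t where "t = min T1 (min T2 T3)"
    have t: "t > 0" "t \<le> T1" "t \<le> T2" "t \<le> T3" using T1 T2 T3 by (auto simp: t_def)
    define D where "D s = k.avg s g x" for s
    have D_eq: "D s = iso.avg \<tau> (k.avg s a) x" for s
      unfolding D_def g_def by (rule avg_commute[OF hk isotropic_heat_kernel am a(2)])
    have kab: "\<bar>k.avg s a z\<bar> \<le> Ba" for s z by (rule k.avg_bounded[OF am a(2)])
    have kfb: "\<bar>k.avg s f z\<bar> \<le> Bf" for s z by (rule k.avg_bounded[OF fm f(2)])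
    have kam[measurable]: "k.avg s a \<in> borel_measurable borel" if "s \<ge> 0" for s
      by (rule borel_measurable_continuous_onI[OF k.avg_continuous_fixed_time[OF ac a(2) that]])
    have kfm[measurable]: "k.avg s f \<in> borel_measurable borel" if "s \<ge> 0" for s
      by (rule borel_measurable_continuous_onI[OF k.avg_continuous_fixed_time[OF fc f(2) that]])
    have bound: "D t - D 0 \<le> t * (2 * e - iso.avg \<tau> f x)"
    proof -
      have "iso.avg \<tau> (\<lambda>z. k.avg t a z + t * f z) x \<le> iso.avg \<tau> (\<lambda>z. a z + 2 * t * e) x"
      proof (rule iso.avg_mono)
        show "(\<lambda>z. k.avg t a z + t * f z) \<in> borel_measurable borel" using kam[of t] t by simp
        show "\<bar>k.avg t a z + t * f z\<bar> \<le> Ba + t * Bf" for z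
        proof -
          have "\<bar>t * f z\<bar> \<le> t * Bf" using f(2)[of z] t by (simp add: abs_mult)
          then show ?thesis using kab[of t z] by linarith
        qed
        show "\<bar>a z + 2 * t * e\<bar> \<le> Ba + 2 * t * e" for z using a(2)[of z] t e
          by (intro order_trans[OF abs_triangle_ineq]) simp
        show "k.avg t a z + t * f z \<le> a z + 2 * t * e" for z
        proof -
          have "t * f z \<le> t * (k.avg t f z + e)"
            using T3(2)[of t z] t by (intro mult_left_mono) (auto simp: abs_le_iff)
          then show ?thesis using T1(2)[of t z] t by (simp add: algebra_simps)
        qed
      qed simp
      moreover have "iso.avg \<tau> (\<lambda>z. k.avg t a z + t * f z) x = D t + t * iso.avg \<tau> f x"
        unfolding D_eq by (rule iso.avg_add[OF kam kab fm f(2)]) (use t in simp)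
      moreover have "iso.avg \<tau> (\<lambda>z. a z + (2 * t * e) * 1) x = g x + (2 * t * e) * iso.avg \<tau> (\<lambda>_. 1) x"
        unfolding g_def by (rule iso.avg_add[OF am a(2), of "\<lambda>_. 1" 1]) simp_all
      ultimately show ?thesis by (simp add: iso.avg_const D_def k.avg_0 algebra_simps)
    qed
    have Dder: "(D has_real_derivative A \<bullet> smoothed_hessian \<tau> (k.avg s a) x) (at s)" if s: "s > 0" for s
    proof -
      have j1: "C2_jet (k.avg s g) (\<lambda>x. \<integral>z. g z *\<^sub>R k.K1 s (x - z) \<partial>lborel) (\<lambda>x. \<integral>z. g z *\<^sub>R k.K2 s (x - z) \<partial>lborel)"
        by (rule k.avg_jet[OF gm gb s])
      have "k.avg s g = iso.avg \<tau> (k.avg s a)"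
        unfolding g_def by (rule ext, rule avg_commute[OF hk isotropic_heat_kernel am a(2)])
      then have j2: "C2_jet (k.avg s g) (\<lambda>x. \<integral>z. k.avg s a z *\<^sub>R iso.K1 \<tau> (x - z) \<partial>lborel) (\<lambda>x. smoothed_hessian \<tau> (k.avg s a) x)"
        unfolding smoothed_hessian_def using iso.avg_jet[OF kam kab \<tau>, of s] s by simp
      have "(\<integral>z. g z *\<^sub>R k.K2 s (x - z) \<partial>lborel) = smoothed_hessian \<tau> (k.avg s a) x"
        using C2_jet_unique(2)[OF j1 j2] by (rule fun_cong)
      then show ?thesis using k.avg_time_derivative[OF gm gb s, of x] unfolding D_def by simp
    qed
    have Dcont: "continuous_on {0..t} D"
    proof -
      have "continuous_on {0..t} (\<lambda>s. (s, x))" by (intro continuous_intros)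
      from continuous_on_compose2[OF k.avg_continuous[OF gc gb] this] have "continuous_on {0..t} (\<lambda>s. k.avg s g x)" by force
      then show ?thesis unfolding D_def .
    qed
    obtain s where s: "0 < s" "s < t" "D t - D 0 = (t - 0) * (A \<bullet> smoothed_hessian \<tau> (k.avg s a) x)"
    proof -
      have "(D has_derivative (\<lambda>d. A \<bullet> smoothed_hessian \<tau> (k.avg s a) x * d)) (at s)" if "0 < s" "s < t" for s
        using Dder[OF that(1)] by (simp add: has_field_derivative_def)
      from mvt[OF t(1) Dcont this] that show ?thesis by (auto simp: mult.commute)
    qed
    have "A \<bullet> smoothed_hessian \<tau> (k.avg s a) x \<le> 2 * e - iso.avg \<tau> f x"
      using bound s(3) t(1) by simp
    moreover have "\<bar>A \<bullet> smoothed_hessian \<tau> (k.avg s a) x - A \<bullet> smoothed_hessian \<tau> a x\<bar> \<le> e * I"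
    proof -
      have i1: "integrable lborel (\<lambda>z. k.avg s a z *\<^sub>R iso.K2 \<tau> (x - z))"
        by (rule integrable_bounded_times_kernel[where M = "\<lambda>y. norm (iso.K2 \<tau> y)"])
           (use kam[of s] s kab iso.K2_integrable[OF \<tau>] in auto)
      have i2: "integrable lborel (\<lambda>z. a z *\<^sub>R iso.K2 \<tau> (x - z))"
        by (rule integrable_bounded_times_kernel[where M = "\<lambda>y. norm (iso.K2 \<tau> y)"])
           (use a(2) iso.K2_integrable[OF \<tau>] in auto)
      have "norm (smoothed_hessian \<tau> (k.avg s a) x - smoothed_hessian \<tau> a x)
          = norm (\<integral>z. (k.avg s a z - a z) *\<^sub>R iso.K2 \<tau> (x - z) \<partial>lborel)"
        unfolding smoothed_hessian_def using i1 i2 by (simp add: scaleR_diff_left)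
      also have "\<dots> \<le> (\<integral>z. norm ((k.avg s a z - a z) *\<^sub>R iso.K2 \<tau> (x - z)) \<partial>lborel)" by (rule integral_norm_bound)
      also have "\<dots> \<le> (\<integral>z. e * norm (iso.K2 \<tau> (x - z)) \<partial>lborel)"
      proof (rule integral_mono)
        show "integrable lborel (\<lambda>z. norm ((k.avg s a z - a z) *\<^sub>R iso.K2 \<tau> (x - z)))"
          using integrable_norm[OF Bochner_Integration.integrable_diff[OF i1 i2]] by (simp add: scaleR_diff_left[symmetric])
        show "integrable lborel (\<lambda>z. e * norm (iso.K2 \<tau> (x - z)))"
          using lborel_integrable_reflect[OF integrable_norm[OF iso.K2_integrable[OF \<tau>]], of x] by simp
        show "norm ((k.avg s a z - a z) *\<^sub>R iso.K2 \<tau> (x - z)) \<le> e * norm (iso.K2 \<tau> (x - z))" for z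
          using T2(2)[of s z] s t by (simp add: mult_right_mono)
      qed
      also have "\<dots> = e * (\<integral>z. norm (iso.K2 \<tau> z :: real ^ 'n ^ 'n) \<partial>lborel)"
        using lborel_integral_reflect[of "\<lambda>z. norm (iso.K2 \<tau> z)" x] by simp
      finally have "norm A * norm (smoothed_hessian \<tau> (k.avg s a) x - smoothed_hessian \<tau> a x) \<le> e * I"
        unfolding I_def by (metis mult.left_commute mult_left_mono norm_ge_zero)
      then show ?thesis using Cauchy_Schwarz_ineq2[of A "smoothed_hessian \<tau> (k.avg s a) x - smoothed_hessian \<tau> a x"]
        by (simp add: inner_diff_right)
    qed
    ultimately show ?thesis by (simp add: algebra_simps abs_le_iff)
  qed
  have I0: "I \<ge> 0" unfolding I_def by simp
  show ?thesis
  proof (rule field_le_epsilon)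
    fix d :: real assume "d > 0"
    then show "A \<bullet> smoothed_hessian \<tau> a x + iso.avg \<tau> f x \<le> 0 + d"
      using main[of "d / (2 + I)"] I0 by simp
  qed
qed

lemma elliptic_heat_kernel:
  fixes A :: "real ^ 'n ^ 'n"
  assumes A: "elliptic l L A" and l: "0 < l"
  obtains C q where "heat_kernel A C q"
proof -
  have sym: "transpose A = A" using A by (simp add: elliptic_def)
  have "x = 0" if "A *v x = 0" for x
  proof -
    have "l * (x \<bullet> x) \<le> 0" using A that unfolding elliptic_def by (metis inner_zero_right)
    then show ?thesis using l by (metis inner_gt_zero_iff mult_pos_pos not_less)
  qed
  then obtain C where CA: "C ** A = mat 1" using matrix_left_invertible_ker by blast
  then have AC: "A ** C = mat 1" by (simp add: matrix_left_right_inverse)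
  have "transpose C = transpose C ** (A ** C)" by (simp add: AC)
  also have "\<dots> = transpose (A ** C) ** C" by (simp add: matrix_transpose_mul sym matrix_mul_assoc)
  finally have symC: "transpose C = C" by (simp add: AC transpose_mat)
  have "heat_kernel A C (l / ((norm A)\<^sup>2 + 1))"
  proof
    have p: "(norm A)\<^sup>2 + 1 > 0" by (simp add: add_nonneg_pos)
    show "0 < l / ((norm A)\<^sup>2 + 1)" using l p by simp
    fix y
    define w where "w = C *v y"
    have y: "y = A *v w" by (simp add: w_def matrix_vector_mul_assoc AC)
    have "(norm y)\<^sup>2 \<le> (norm A * norm w)\<^sup>2" unfolding y by (intro power_mono norm_matrix_vector_le) simp
    also have "\<dots> \<le> ((norm A)\<^sup>2 + 1) * (w \<bullet> w)" by (simp add: power_mult_distrib power2_norm_eq_inner algebra_simps)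
    finally have "y \<bullet> y \<le> ((norm A)\<^sup>2 + 1) * (w \<bullet> w)" by (simp add: power2_norm_eq_inner)
    then have "l / ((norm A)\<^sup>2 + 1) * (y \<bullet> y) \<le> l / ((norm A)\<^sup>2 + 1) * (((norm A)\<^sup>2 + 1) * (w \<bullet> w))"
      using l p by (intro mult_left_mono) auto
    also have "\<dots> = l * (w \<bullet> w)" using p by simp
    also have "\<dots> \<le> w \<bullet> (A *v w)" using A by (simp add: elliptic_def)
    also have "\<dots> = y \<bullet> (C *v y)" unfolding y[symmetric] by (simp add: w_def inner_commute)
    finally show "l / ((norm A)\<^sup>2 + 1) * (y \<bullet> y) \<le> y \<bullet> (C *v y)" .
  qed (fact sym symC AC)+
  with that show ?thesis by blast
qed

text \<open>The viscosity notions for \<open>\<M>\<^sup>+(D\<^sup>2 a) + f = 0\<close> with a prescribed function \<open>f\<close> in place of the power of the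
solution. For \<open>\<M>\<^sup>-\<close> this allows to pass from \<open>u\<close> to \<open>- u\<close>, with \<open>f = - u\<^sup>p\<close>.\<close>
definition pucci_supersolution :: "real \<Rightarrow> real \<Rightarrow> (real ^ 'n \<Rightarrow> real) \<Rightarrow> (real ^ 'n \<Rightarrow> real) \<Rightarrow> bool" where
  "pucci_supersolution l L f a \<longleftrightarrow> (\<forall>\<phi> g H x\<^sub>0. C2_jet \<phi> g H \<and> (\<forall>x. transpose (H x) = H x) \<and>
     local_min_at (\<lambda>x. a x - \<phi> x) x\<^sub>0 \<longrightarrow> pucci_plus l L (H x\<^sub>0) + f x\<^sub>0 \<le> 0)"

definition pucci_subsolution :: "real \<Rightarrow> real \<Rightarrow> (real ^ 'n \<Rightarrow> real) \<Rightarrow> (real ^ 'n \<Rightarrow> real) \<Rightarrow> bool" where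
  "pucci_subsolution l L f a \<longleftrightarrow> (\<forall>\<phi> g H x\<^sub>0. C2_jet \<phi> g H \<and> (\<forall>x. transpose (H x) = H x) \<and>
     local_max_at (\<lambda>x. a x - \<phi> x) x\<^sub>0 \<longrightarrow> pucci_plus l L (H x\<^sub>0) + f x\<^sub>0 \<ge> 0)"

text \<open>Here the convexity of \<open>\<M>\<^sup>+\<close> enters: as a maximum of linear operators, its supersolutions are the common
supersolutions of these, and the mollification inherits all the linear inequalities.\<close>
lemma smooth_supersolution_approximation:
  fixes a :: "real ^ 'n \<Rightarrow> real"
  assumes l: "0 < l" "l \<le> L"
    and a: "uniformly_continuous_on UNIV a" "\<And>z. \<bar>a z\<bar> \<le> Ba"
    and f: "uniformly_continuous_on UNIV f" "\<And>z. \<bar>f z\<bar> \<le> Bf"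
    and super: "pucci_supersolution l L f a" and e: "e > 0"
  obtains v g H where "C2_jet v g H" "\<And>x. transpose (H x) = H x"
    "\<And>x. \<bar>v x - a x\<bar> \<le> e" "\<And>x. pucci_plus l L (H x) + f x \<le> e"
proof -
  have am: "a \<in> borel_measurable borel"
    using a by (auto intro: borel_measurable_continuous_onI uniformly_continuous_imp_continuous)
  obtain T1 where T1: "T1 > 0" "\<And>t x. 0 \<le> t \<Longrightarrow> t \<le> T1 \<Longrightarrow> \<bar>iso.avg t a x - a x\<bar> \<le> e"
    using iso.avg_uniformly_close[OF a e] by blast
  obtain T2 where T2: "T2 > 0" "\<And>t x. 0 \<le> t \<Longrightarrow> t \<le> T2 \<Longrightarrow> \<bar>iso.avg t f x - f x\<bar> \<le> e"
    using iso.avg_uniformly_close[OF f e] by blast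
  define \<tau> where "\<tau> = min T1 T2"
  have \<tau>: "\<tau> > 0" "\<tau> \<le> T1" "\<tau> \<le> T2" using T1 T2 by (auto simp: \<tau>_def)
  have sym: "transpose (smoothed_hessian \<tau> a x) = smoothed_hessian \<tau> a x" for x
    unfolding smoothed_hessian_def by (rule iso.avg_hessian_symmetric[OF am a(2) \<tau>(1)])
  have "pucci_plus l L (smoothed_hessian \<tau> a x) + f x \<le> e" for x
  proof -
    have "pucci_plus l L (smoothed_hessian \<tau> a x) \<le> - iso.avg \<tau> f x"
    proof (rule pucci_plus_leI[OF sym l(2)])
      fix A :: "real ^ 'n ^ 'n" assume A: "elliptic l L A"
      obtain C q where hk: "heat_kernel A C q" using elliptic_heat_kernel[OF A l(1)] by blast
      have "A \<bullet> smoothed_hessian \<tau> a x + iso.avg \<tau> f x \<le> 0"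
      proof (rule mollified_linear_supersolution[OF hk a f _ \<tau>(1)], unfold linear_supersolution_def, intro allI impI, elim conjE)
        fix \<phi> g H x\<^sub>0
        assume j: "C2_jet \<phi> g H" and s: "\<forall>x. transpose (H x) = (H x :: real ^ 'n ^ 'n)" and m: "\<forall>x. a x\<^sub>0 - \<phi> x\<^sub>0 \<le> a x - \<phi> x"
        have "pucci_plus l L (H x\<^sub>0) + f x\<^sub>0 \<le> 0"
          using super j s m unfolding pucci_supersolution_def local_min_at_def by (blast intro: always_eventually)
        then show "A \<bullet> H x\<^sub>0 + f x\<^sub>0 \<le> 0" using elliptic_le_pucci_plus[OF A s[rule_format], of x\<^sub>0] by linarith
      qed
      then show "A \<bullet> smoothed_hessian \<tau> a x \<le> - iso.avg \<tau> f x" by linarith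
    qed
    moreover have "\<bar>iso.avg \<tau> f x - f x\<bar> \<le> e" using T2(2) \<tau> by simp
    ultimately show ?thesis by (simp add: abs_le_iff)
  qed
  moreover have "C2_jet (iso.avg \<tau> a) (\<lambda>x. \<integral>z. a z *\<^sub>R iso.K1 \<tau> (x - z) \<partial>lborel) (smoothed_hessian \<tau> a)"
    using iso.avg_jet[OF am a(2) \<tau>(1)] unfolding smoothed_hessian_def by simp
  moreover have "\<bar>iso.avg \<tau> a x - a x\<bar> \<le> e" for x using T1(2) \<tau> by simp
  ultimately show ?thesis using that sym by blast
qed

text \<open>Replace \<open>a\<close> by a smooth approximate supersolution \<open>v\<close>. A strict minimum of \<open>a - b - \<phi>\<close> persists nearby as a
minimum of \<open>v - b - \<phi>\<close>, that is, \<open>v - \<phi>\<close> is a smooth function touching \<open>b\<close> from above. The subsolution property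
of \<open>b\<close> and \<open>\<M>\<^sup>+(D\<^sup>2 v - D\<^sup>2 \<phi>) \<le> \<M>\<^sup>+(D\<^sup>2 v) + \<M>\<^sup>+(- D\<^sup>2 \<phi>)\<close> give the claim. Note that
\<open>- \<M>\<^sup>+(- X) = \<M>\<^sup>-(X)\<close>.\<close>
theorem difference_is_supersolution:
  fixes a b :: "real ^ 'n \<Rightarrow> real"
  assumes l: "0 < l" "l \<le> L"
    and a: "uniformly_continuous_on UNIV a" "\<And>z. \<bar>a z\<bar> \<le> Ba"
    and fa: "uniformly_continuous_on UNIV fa" "\<And>z. \<bar>fa z\<bar> \<le> Bf"
    and super: "pucci_supersolution l L fa a"
    and b: "continuous_on UNIV b" and fb: "continuous_on UNIV fb" and sub: "pucci_subsolution l L fb b"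
    and \<phi>: "C2_jet \<phi> g H" and symH: "\<And>x. transpose (H x) = H x"
    and min: "local_min_at (\<lambda>x. (a x - b x) - \<phi> x) x\<^sub>0"
  shows "- pucci_plus l L (- H x\<^sub>0) + fa x\<^sub>0 - fb x\<^sub>0 \<le> 0"
proof (rule ccontr)
  assume neg: "\<not> ?thesis"
  define \<eta> where "\<eta> = (- pucci_plus l L (- H x\<^sub>0) + fa x\<^sub>0 - fb x\<^sub>0) / 4"
  have \<eta>: "\<eta> > 0" using neg by (simp add: \<eta>_def)
  define N where "N = (real CARD('n))\<^sup>2 * L"
  have N: "N > 0" using l by (simp add: N_def)
  have pn: "pucci_plus l L X \<le> N * norm X" if "transpose X = X" for X :: "real ^ 'n ^ 'n"
    unfolding N_def using pucci_plus_le_norm[OF that, of l L] l by simp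
  define S where "S = norm (2 *\<^sub>R mat 1 :: real ^ 'n ^ 'n) + 1"
  define \<delta> where "\<delta> = \<eta> / (N * S)"
  have "S > 0" unfolding S_def by (intro add_nonneg_pos) auto
  then have pp: "0 < N * S" using N by simp
  have \<delta>: "\<delta> > 0" unfolding \<delta>_def using \<eta> pp by simp
  have N\<delta>: "N * norm (\<delta> *\<^sub>R (2 *\<^sub>R mat 1 :: real ^ 'n ^ 'n)) \<le> \<eta>"
  proof -
    have "N * norm (\<delta> *\<^sub>R (2 *\<^sub>R mat 1 :: real ^ 'n ^ 'n)) = \<delta> * (N * norm (2 *\<^sub>R mat 1 :: real ^ 'n ^ 'n))" using \<delta> by simp
    also have "\<dots> \<le> \<delta> * (N * S)" unfolding S_def using \<delta> N by (intro mult_left_mono) auto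
    also have "\<dots> = \<eta>" using pp unfolding \<delta>_def by (metis less_irrefl nonzero_eq_divide_eq)
    finally show ?thesis .
  qed
  obtain r1 where r1: "r1 > 0" "\<And>x. dist x x\<^sub>0 < r1 \<Longrightarrow> (a x\<^sub>0 - b x\<^sub>0) - \<phi> x\<^sub>0 \<le> (a x - b x) - \<phi> x"
    using min unfolding local_min_at_def eventually_nhds_metric by blast
  have "isCont H x\<^sub>0" using C2_jetD(3)[OF \<phi>] by (simp add: continuous_on_eq_continuous_within)
  then obtain r2 where r2: "r2 > 0" "\<And>x. dist x x\<^sub>0 < r2 \<Longrightarrow> dist (H x) (H x\<^sub>0) < \<eta> / N"
    unfolding continuous_at_eps_delta using \<eta> N by (meson divide_pos_pos)
  have "continuous_on UNIV fa" using fa by (auto intro: uniformly_continuous_imp_continuous)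
  then have "isCont (\<lambda>x. fa x - fb x) x\<^sub>0" using fb
    by (intro continuous_intros) (auto simp: continuous_on_eq_continuous_within)
  then obtain r3 where r3: "r3 > 0" "\<And>x. dist x x\<^sub>0 < r3 \<Longrightarrow> dist (fa x - fb x) (fa x\<^sub>0 - fb x\<^sub>0) < \<eta>"
    unfolding continuous_at_eps_delta using \<eta> by meson
  define r where "r = Min {r1, r2, r3} / 2"
  have r: "r > 0" "r < r1" "r < r2" "r < r3" using r1 r2 r3 by (auto simp: r_def min_def)
  define e where "e = min (\<eta> / 2) (\<delta> * r\<^sup>2 / 4)"
  have e: "e > 0" "e \<le> \<eta> / 2" "e \<le> \<delta> * r\<^sup>2 / 4" using \<eta> \<delta> r by (auto simp: e_def)
  obtain v gv Hv where v: "C2_jet v gv Hv" "\<And>x. transpose (Hv x) = Hv x"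
    "\<And>x. \<bar>v x - a x\<bar> \<le> e" "\<And>x. pucci_plus l L (Hv x) + fa x \<le> e"
    using smooth_supersolution_approximation[OF l a fa super e(1)] by blast
  \<comment> \<open>The quadratic term makes the minimum strict; \<open>e\<close> is small against its size on the boundary of the ball.\<close>
  define \<psi> where "\<psi> x = v x - \<phi> x + \<delta> * (norm (x - x\<^sub>0))\<^sup>2" for x
  have j\<psi>: "C2_jet \<psi> (\<lambda>x. gv x - g x + \<delta> *\<^sub>R (2 *\<^sub>R (x - x\<^sub>0))) (\<lambda>x. Hv x - H x + \<delta> *\<^sub>R (2 *\<^sub>R mat 1))"
    unfolding \<psi>_def by (intro C2_jet_add C2_jet_diff C2_jet_scale C2_jet_norm_square v \<phi>)
  have "continuous_on (cball x\<^sub>0 r) (\<lambda>x. b x - \<psi> x)"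
    by (intro continuous_on_diff continuous_on_subset[OF b] continuous_on_subset[OF C2_jetD(4)[OF j\<psi>]]) auto
  then obtain y where y: "y \<in> cball x\<^sub>0 r" "\<And>x. x \<in> cball x\<^sub>0 r \<Longrightarrow> b x - \<psi> x \<le> b y - \<psi> y"
    using continuous_attains_sup[of "cball x\<^sub>0 r" "\<lambda>x. b x - \<psi> x"] r by auto
  have yr: "dist x\<^sub>0 y < r"
  proof (rule ccontr)
    assume "\<not> dist x\<^sub>0 y < r"
    then have yn: "norm (y - x\<^sub>0) = r" using y(1) by (simp add: dist_norm norm_minus_commute)
    have "(a x\<^sub>0 - b x\<^sub>0) - \<phi> x\<^sub>0 \<le> (a y - b y) - \<phi> y" by (rule r1(2)) (use yn r in \<open>simp add: dist_norm\<close>)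
    moreover have "b x\<^sub>0 - \<psi> x\<^sub>0 \<le> b y - \<psi> y" using y(2)[of x\<^sub>0] r by simp
    moreover have "\<delta> * r\<^sup>2 > 0" using \<delta> r by simp
    ultimately show False using v(3)[of y] v(3)[of x\<^sub>0] e(3) by (simp add: \<psi>_def yn abs_le_iff)
  qed
  have "local_max_at (\<lambda>x. b x - \<psi> x) y" unfolding local_max_at_def
  proof (rule eventually_mono[OF eventually_nhds_in_open[of "ball x\<^sub>0 r" y]])
    show "b x - \<psi> x \<le> b y - \<psi> y" if "x \<in> ball x\<^sub>0 r" for x using y(2)[of x] that by simp
  qed (use yr in auto)
  moreover have symI: "transpose (\<delta> *\<^sub>R (2 *\<^sub>R mat 1) :: real ^ 'n ^ 'n) = \<delta> *\<^sub>R (2 *\<^sub>R mat 1)"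
    by (simp add: transpose_scaleR transpose_mat)
  moreover have "transpose (Hv x - H x + \<delta> *\<^sub>R (2 *\<^sub>R mat 1)) = Hv x - H x + \<delta> *\<^sub>R (2 *\<^sub>R mat 1)" for x
    using symI by (simp add: transpose_add transpose_diff v(2) symH)
  ultimately have "pucci_plus l L (Hv y - H y + \<delta> *\<^sub>R (2 *\<^sub>R mat 1)) + fb y \<ge> 0"
    using sub j\<psi> unfolding pucci_subsolution_def by blast
  moreover have "pucci_plus l L (Hv y - H y + \<delta> *\<^sub>R (2 *\<^sub>R mat 1))
    \<le> pucci_plus l L (Hv y) + pucci_plus l L (- H x\<^sub>0) + pucci_plus l L (H x\<^sub>0 - H y)
      + pucci_plus l L (\<delta> *\<^sub>R (2 *\<^sub>R mat 1) :: real ^ 'n ^ 'n)"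
  proof -
    have eq: "Hv y - H y + \<delta> *\<^sub>R (2 *\<^sub>R mat 1) = ((Hv y + (- H x\<^sub>0)) + (H x\<^sub>0 - H y)) + \<delta> *\<^sub>R (2 *\<^sub>R mat 1)" by simp
    have quad: "pucci_plus l L (((P + Q) + R) + J) \<le> pucci_plus l L P + pucci_plus l L Q + pucci_plus l L R + pucci_plus l L J"
      if "transpose P = P" "transpose Q = Q" "transpose R = R" "transpose J = J" for P Q R J :: "real ^ 'n ^ 'n"
      by (intro order_trans[OF pucci_plus_subadditive] add_mono order_refl) (use l that in \<open>simp_all add: transpose_add\<close>)
    have T: "transpose (- H x\<^sub>0) = - H x\<^sub>0" "transpose (H x\<^sub>0 - H y) = H x\<^sub>0 - H y"
      by (simp_all add: transpose_diff transpose_minus symH)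
    show ?thesis unfolding eq by (rule quad[OF v(2) T symI])
  qed
  moreover have "pucci_plus l L (\<delta> *\<^sub>R (2 *\<^sub>R mat 1) :: real ^ 'n ^ 'n) \<le> \<eta>" using pn[OF symI] N\<delta> by linarith
  moreover have "pucci_plus l L (H x\<^sub>0 - H y) \<le> \<eta>"
  proof -
    have "norm (H x\<^sub>0 - H y) \<le> \<eta> / N" using r2(2)[of y] yr r by (simp add: dist_norm dist_commute norm_minus_commute)
    then have "N * norm (H x\<^sub>0 - H y) \<le> \<eta>" using N by (simp add: field_simps)
    then show ?thesis using pn[of "H x\<^sub>0 - H y"] by (simp add: transpose_diff symH)
  qed
  moreover have "fa x\<^sub>0 - fb x\<^sub>0 - \<eta> \<le> fa y - fb y"
    using r3(2)[of y] yr r by (simp add: dist_real_def dist_commute abs_less_iff)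
  moreover have "4 * \<eta> = - pucci_plus l L (- H x\<^sub>0) + fa x\<^sub>0 - fb x\<^sub>0" by (simp add: \<eta>_def)
  ultimately show False using v(4)[of y] e(2) \<eta> by linarith
qed

section \<open>The method of moving planes\<close>

lemma powr_difference_le:
  fixes x y p :: real
  assumes "0 \<le> y" "y \<le> x" "1 < p"
  shows "x powr p - y powr p \<le> p * x powr (p - 1) * (x - y)"
proof (cases "y = 0 \<or> y = x")
  case True
  then show ?thesis
  proof
    assume "y = 0"
    have "x powr p = x powr (p - 1) * x" using assms by (cases "x = 0") (auto simp: powr_diff)
    moreover have "1 * (x powr (p - 1) * x) \<le> p * (x powr (p - 1) * x)" using assms by (intro mult_right_mono) auto
    ultimately show ?thesis using \<open>y = 0\<close> by simp
  qed simp
next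
  case False
  then have y: "0 < y" "y < x" using assms by auto
  have "((\<lambda>t. t powr p) has_real_derivative p * t powr (p - 1)) (at t)" if "y \<le> t" "t \<le> x" for t
    using that y by (intro has_real_derivative_powr) auto
  then obtain z where z: "y < z" "z < x" "x powr p - y powr p = (x - y) * (p * z powr (p - 1))"
    using MVT2[OF y(2), of "\<lambda>t. t powr p" "\<lambda>t. p * t powr (p - 1)"] by blast
  have "z powr (p - 1) \<le> x powr (p - 1)" using z y assms by (intro powr_mono2) auto
  then have "(x - y) * (p * z powr (p - 1)) \<le> (x - y) * (p * x powr (p - 1))"
    using y assms by (intro mult_left_mono) auto
  then show ?thesis using z(3) by (simp add: mult_ac)
qed

lemma elliptic_trace_upper_bound:
  fixes A :: "real ^ 'n ^ 'n"
  assumes A: "elliptic l L A"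
  shows "trace A \<le> real CARD('n) * L"
proof -
  have "A $ i $ i \<le> L" for i
  proof -
    have "A $ i $ i = axis i 1 \<bullet> (A *v axis i 1)"
      by (simp add: matrix_vector_mul_component inner_axis' inner_axis)
    also have "\<dots> \<le> L * (axis i 1 \<bullet> axis i (1::real) )" using A by (simp only: elliptic_def)
    finally show ?thesis by (simp add: inner_axis_axis)
  qed
  then have "trace A \<le> (\<Sum>i\<in>(UNIV::'n set). L)" unfolding trace_def by (intro sum_mono)
  then show ?thesis by simp
qed

text \<open>A smooth version of \<open>|x|\<^sup>-\<^sup>s\<close>, with its gradient and Hessian.\<close>
definition decay :: "real \<Rightarrow> real ^ 'n \<Rightarrow> real" where
  "decay s x = (1 + (norm x)\<^sup>2) powr (- (s / 2))"

definition decay_grad :: "real \<Rightarrow> real ^ 'n \<Rightarrow> real ^ 'n" where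
  "decay_grad s x = - (s * decay s x / (1 + (norm x)\<^sup>2)) *\<^sub>R x"

definition decay_hess :: "real \<Rightarrow> real ^ 'n \<Rightarrow> real ^ 'n ^ 'n" where
  "decay_hess s x = (s * decay s x / (1 + (norm x)\<^sup>2)) *\<^sub>R
     (((s + 2) / (1 + (norm x)\<^sup>2)) *\<^sub>R outer x x - mat 1)"

lemma one_plus_norm_square_pos: "0 < 1 + (norm x)\<^sup>2"
  by (simp add: add_pos_nonneg)

lemma decay_pos: "0 < decay s x"
  using one_plus_norm_square_pos[of x] by (simp add: decay_def)

lemma decay_le_one: "0 < s \<Longrightarrow> decay s x \<le> 1"
  using powr_mono2'[of "- (s / 2)" 1 "1 + (norm x)\<^sup>2"] by (simp add: decay_def)

lemma decay_jet: "C2_jet (decay s) (decay_grad s) (decay_hess s :: real ^ 'n \<Rightarrow> real ^ 'n ^ 'n)"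
proof -
  have P: "0 < 1 + (norm x)\<^sup>2" for x :: "real ^ 'n" by (rule one_plus_norm_square_pos)
  define \<psi> \<psi>' \<psi>'' where "\<psi> = (\<lambda>r. (1 + r) powr (- (s / 2)))"
    and "\<psi>' = (\<lambda>r. - (s / 2) * (1 + r) powr (- (s / 2) - 1))"
    and "\<psi>'' = (\<lambda>r. - (s / 2) * ((- (s / 2) - 1) * (1 + r) powr (- (s / 2) - 1 - 1)))"
  have j: "C2_jet (\<lambda>x::real^'n. (norm x)\<^sup>2) (\<lambda>x. 2 *\<^sub>R x) (\<lambda>x. 2 *\<^sub>R mat 1)"
    using C2_jet_norm_square[of 0] by simp
  have pw: "((\<lambda>r. (1 + r) powr q) has_real_derivative q * (1 + r) powr (q - 1)) (at r)" if "1 + r > 0" for q r :: real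
    using that by (auto intro!: derivative_eq_intros)
  have "C2_jet (\<lambda>x::real^'n. \<psi> ((norm x)\<^sup>2)) (\<lambda>x. \<psi>' ((norm x)\<^sup>2) *\<^sub>R (2 *\<^sub>R x))
     (\<lambda>x. \<psi>' ((norm x)\<^sup>2) *\<^sub>R (2 *\<^sub>R mat 1) + \<psi>'' ((norm x)\<^sup>2) *\<^sub>R outer (2 *\<^sub>R x) (2 *\<^sub>R x))"
  proof (rule C2_jet_compose[OF j])
    show "(\<psi> has_real_derivative \<psi>' ((norm x)\<^sup>2)) (at ((norm x)\<^sup>2))" for x :: "real ^ 'n"
      unfolding \<psi>_def \<psi>'_def by (rule pw[OF P])
    show "(\<psi>' has_real_derivative \<psi>'' ((norm x)\<^sup>2)) (at ((norm x)\<^sup>2))" for x :: "real ^ 'n"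
      unfolding \<psi>'_def \<psi>''_def by (rule DERIV_cmult[OF pw[OF P]])
    have "1 + (norm x)\<^sup>2 \<noteq> 0" for x :: "real ^ 'n" using P[of x] by linarith
    then show "continuous_on UNIV (\<lambda>x::real^'n. \<psi>'' ((norm x)\<^sup>2))"
      unfolding \<psi>''_def by (intro continuous_intros) auto
  qed
  moreover have pm: "r powr (q - 1) = r powr q / r" if "r > 0" for r q :: real using that by (simp add: powr_diff)
  have "\<psi>' ((norm x)\<^sup>2) *\<^sub>R (2 *\<^sub>R x) = decay_grad s x" for x :: "real ^ 'n"
  proof -
    define r where "r = 1 + (norm x)\<^sup>2"
    have "r > 0" using P r_def by simp
    then have "\<psi>' ((norm x)\<^sup>2) * 2 = - (s * decay s x / r)"
      by (simp add: \<psi>'_def decay_def pm r_def[symmetric])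
    then show ?thesis by (simp add: decay_grad_def r_def[symmetric])
  qed
  moreover have "\<psi>' ((norm x)\<^sup>2) *\<^sub>R (2 *\<^sub>R mat 1) + \<psi>'' ((norm x)\<^sup>2) *\<^sub>R outer (2 *\<^sub>R x) (2 *\<^sub>R x) = decay_hess s x" for x :: "real ^ 'n"
  proof -
    have o: "outer (2 *\<^sub>R x) (2 *\<^sub>R x) = 4 *\<^sub>R outer x x" by (simp add: outer_def vec_eq_iff)
    define r where "r = 1 + (norm x)\<^sup>2"
    have "r > 0" using P r_def by simp
    have 1: "\<psi>' ((norm x)\<^sup>2) * 2 = - (s * decay s x / r)"
      using \<open>r > 0\<close> by (simp add: \<psi>'_def decay_def pm r_def[symmetric])
    have 2: "\<psi>'' ((norm x)\<^sup>2) * 4 = s * decay s x / r * ((s + 2) / r)"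
    proof -
      have q: "(1 + (norm x)\<^sup>2) powr (- (s / 2) - 1 - 1) = decay s x / r / r"
        by (simp only: pm[OF \<open>r > 0\<close>] decay_def r_def[symmetric])
      have "- (s / 2) * ((- (s / 2) - 1) * X) * 4 = s * (s + 2) * X" for X by (simp add: algebra_simps)
      note this[of "decay s x / r / r"]
      then show ?thesis unfolding \<psi>''_def q by (rule trans) simp
    qed
    have "\<psi>' ((norm x)\<^sup>2) *\<^sub>R (2 *\<^sub>R mat 1) + \<psi>'' ((norm x)\<^sup>2) *\<^sub>R outer (2 *\<^sub>R x) (2 *\<^sub>R x)
       = (\<psi>' ((norm x)\<^sup>2) * 2) *\<^sub>R mat 1 + (\<psi>'' ((norm x)\<^sup>2) * 4) *\<^sub>R outer x x" by (simp add: o)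
    also have "\<dots> = decay_hess s x" unfolding 1 2 by (simp add: decay_hess_def r_def[symmetric] scaleR_diff_right)
    finally show ?thesis .
  qed
  moreover have "(\<lambda>x::real^'n. \<psi> ((norm x)\<^sup>2)) = decay s" by (simp add: \<psi>_def decay_def fun_eq_iff)
  ultimately show ?thesis by simp
qed

text \<open>In the radial direction the Hessian contributes at most \<open>(s + 1) L\<close>, in the others at least \<open>(n - 1) l\<close> with
the opposite sign; \<open>\<kappa> > 0\<close> means \<open>s < n\<^sup>* - 2\<close>.\<close>
lemma decay_hess_bound:
  fixes A :: "real ^ 'n ^ 'n"
  assumes A: "elliptic l L A" and l: "0 < l" and s: "0 < s"
    and \<kappa>: "\<kappa> = (real CARD('n) - 1) * l - (s + 1) * L"
  shows "A \<bullet> decay_hess s x \<le> - (s * \<kappa> * decay s x / (1 + (norm x)\<^sup>2))"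
proof -
  define v where "v = (if x = 0 then axis undefined 1 else x /\<^sub>R norm x)"
  define r where "r = 1 + (norm x)\<^sup>2"
  define \<alpha> where "\<alpha> = v \<bullet> (A *v v)"
  have r: "r > 0" unfolding r_def by (rule one_plus_norm_square_pos)
  have v: "norm v = 1" "x = norm x *\<^sub>R v" by (auto simp: v_def)
  have "v \<bullet> v = 1" using v(1) by (simp add: norm_eq_1)
  then have \<alpha>: "l \<le> \<alpha>" "\<alpha> \<le> L" using A unfolding elliptic_def \<alpha>_def by (metis mult.right_neutral)+
  have q: "x \<bullet> (A *v x) = (norm x)\<^sup>2 * \<alpha>"
  proof -
    have "x \<bullet> (A *v x) = (norm x *\<^sub>R v) \<bullet> (A *v (norm x *\<^sub>R v))" using v(2) by simp
    then show ?thesis by (simp add: \<alpha>_def matrix_vector_mult_scaleR power2_eq_square mult.assoc)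
  qed
  have "(s + 2) / r * (x \<bullet> (A *v x)) \<le> (s + 2) * \<alpha>"
  proof -
    have "(norm x)\<^sup>2 / r \<le> 1" using r by (simp add: r_def)
    then have "(s + 2) * \<alpha> * ((norm x)\<^sup>2 / r) \<le> (s + 2) * \<alpha> * 1" using s \<alpha> l by (intro mult_left_mono) auto
    then show ?thesis by (simp add: q mult_ac)
  qed
  moreover have "\<alpha> + (real CARD('n) - 1) * l \<le> trace A"
    unfolding \<alpha>_def by (rule elliptic_trace_lower_bound[OF A v(1)])
  moreover have "(s + 1) * \<alpha> \<le> (s + 1) * L" using s \<alpha> by (intro mult_left_mono) auto
  ultimately have "(s + 2) / r * (x \<bullet> (A *v x)) - trace A \<le> - \<kappa>" unfolding \<kappa> by (simp add: algebra_simps)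
  then have "s * decay s x / r * ((s + 2) / r * (x \<bullet> (A *v x)) - trace A) \<le> s * decay s x / r * (- \<kappa>)"
    using s decay_pos[of s x] r by (intro mult_left_mono) auto
  then show ?thesis
    by (simp add: decay_hess_def r_def[symmetric] inner_diff_right inner_outer inner_mat_1 mult_ac)
qed

lemma decay_grad_norm: "0 < s \<Longrightarrow> norm (decay_grad s x) \<le> s * decay s x"
proof -
  assume s: "0 < s"
  have "2 * norm x \<le> 1 + (norm x)\<^sup>2"
    using zero_le_power2[of "norm x - 1"] by (simp add: power2_eq_square algebra_simps)
  then have "norm x \<le> 1 + (norm x)\<^sup>2" using norm_ge_zero[of x] by linarith
  then have "norm x / (1 + (norm x)\<^sup>2) \<le> 1" using one_plus_norm_square_pos[of x] by simp
  then have "s * decay s x * (norm x / (1 + (norm x)\<^sup>2)) \<le> s * decay s x * 1"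
    using s decay_pos[of s x] by (intro mult_left_mono) auto
  moreover have "norm (decay_grad s x) = s * decay s x * (norm x / (1 + (norm x)\<^sup>2))"
    using s decay_pos[of s x] one_plus_norm_square_pos[of x] by (simp add: decay_grad_def)
  ultimately show ?thesis by simp
qed

text \<open>The second factor lies between 1 and 2 in the half space \<open>\<mu> \<le> e \<bullet> x\<close> and is strongly concave near its boundary.\<close>
definition barrier :: "real \<Rightarrow> real \<Rightarrow> real ^ 'n \<Rightarrow> real \<Rightarrow> real ^ 'n \<Rightarrow> real" where
  "barrier s B e \<mu> x = decay s x * (2 - exp (- B * (e \<bullet> x - \<mu>)))"

lemma barrier_bounds:
  assumes "B > 0" "\<mu> \<le> e \<bullet> x"
  shows "decay s x \<le> barrier s B e \<mu> x" "barrier s B e \<mu> x \<le> 2 * decay s x"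
proof -
  have "exp (- B * (e \<bullet> x - \<mu>)) \<le> 1" using assms by simp
  then have "decay s x * 1 \<le> barrier s B e \<mu> x" unfolding barrier_def
    using decay_pos[of s x] by (intro mult_left_mono) auto
  then show "decay s x \<le> barrier s B e \<mu> x" by simp
  have "barrier s B e \<mu> x \<le> decay s x * 2" unfolding barrier_def
    using decay_pos[of s x] by (intro mult_left_mono) auto
  then show "barrier s B e \<mu> x \<le> 2 * decay s x" by simp
qed

text \<open>The term with \<open>\<kappa>\<close> comes from \<open>decay\<close> and beats a potential \<open>o(|x|\<^sup>-\<^sup>2)\<close> at infinity; the term with \<open>B\<close> comes
from the concave factor, absorbs the mixed derivatives, and beats any bounded potential in a strip of width \<open>1 / B\<close>
when \<open>B\<close> is large.\<close>
lemma barrier_jet: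
  fixes e :: "real ^ 'n"
  assumes e: "norm e = 1" and B: "B > 0" and l: "0 < l" and s: "0 < s"
    and \<kappa>: "\<kappa> = (real CARD('n) - 1) * l - (s + 1) * L" "0 \<le> \<kappa>"
  obtains g H where "C2_jet (barrier s B e \<mu>) g H" "\<And>x. transpose (H x) = H x"
    "\<And>x A. elliptic l L A \<Longrightarrow> \<mu> \<le> e \<bullet> x \<Longrightarrow>
       A \<bullet> H x \<le> - decay s x * (s * \<kappa> / (1 + (norm x)\<^sup>2) + B * (B * l - 2 * L * s) * exp (- B * (e \<bullet> x - \<mu>)))"
proof -
  define E where "E x = exp (- B * (e \<bullet> x - \<mu>))" for x
  define H\<eta> where "H\<eta> x = (B * E x) *\<^sub>R 0 + (- (B * (B * E x))) *\<^sub>R outer e e" for x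
  have jl: "C2_jet (\<lambda>x. e \<bullet> x) (\<lambda>x. e) (\<lambda>x. 0)" by (rule C2_jet_linear)
  have j\<eta>: "C2_jet (\<lambda>x. 2 - E x) (\<lambda>x. (B * E x) *\<^sub>R e) H\<eta>"
    unfolding E_def H\<eta>_def
  proof (rule C2_jet_compose[OF jl, where \<psi> = "\<lambda>r. 2 - exp (- B * (r - \<mu>))" and \<psi>' = "\<lambda>r. B * exp (- B * (r - \<mu>))"
        and \<psi>'' = "\<lambda>r. - (B * (B * exp (- B * (r - \<mu>))))"])
    show "((\<lambda>r. 2 - exp (- B * (r - \<mu>))) has_real_derivative B * exp (- B * (e \<bullet> x - \<mu>))) (at (e \<bullet> x))" for x
      by (auto intro!: derivative_eq_intros)
    show "((\<lambda>r. B * exp (- B * (r - \<mu>))) has_real_derivative - (B * (B * exp (- B * (e \<bullet> x - \<mu>))))) (at (e \<bullet> x))" for x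
      by (auto intro!: derivative_eq_intros)
  qed (intro continuous_intros)
  define H where "H x = decay s x *\<^sub>R H\<eta> x + (2 - E x) *\<^sub>R decay_hess s x
      + outer ((B * E x) *\<^sub>R e) (decay_grad s x) + outer (decay_grad s x) ((B * E x) *\<^sub>R e)" for x
  have jb: "C2_jet (barrier s B e \<mu>) (\<lambda>x. decay s x *\<^sub>R ((B * E x) *\<^sub>R e) + (2 - E x) *\<^sub>R decay_grad s x) H"
    using C2_jet_mult[OF decay_jet j\<eta>] unfolding H_def barrier_def E_def by simp
  have sym: "transpose (H x) = H x" for x
    by (simp add: H_def H\<eta>_def decay_hess_def transpose_add transpose_diff transpose_minus transpose_scaleR transpose_outer transpose_mat add_ac)
  have "A \<bullet> H x \<le> - decay s x * (s * \<kappa> / (1 + (norm x)\<^sup>2) + B * (B * l - 2 * L * s) * exp (- B * (e \<bullet> x - \<mu>)))"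
    if A: "elliptic l L A" and x: "\<mu> \<le> e \<bullet> x" for A x
  proof -
    define d where "d = decay s x"
    have d: "d > 0" unfolding d_def by (rule decay_pos)
    have Ex: "0 < E x" "E x \<le> 1" using x B by (simp_all add: E_def)
    have sA: "transpose A = A" using A by (simp add: elliptic_def)
    have cross: "decay_grad s x \<bullet> (A *v e) = e \<bullet> (A *v decay_grad s x)"
      using dot_lmul_symmetric[OF sA, of "decay_grad s x" e] by (simp add: inner_commute)
    have ll: "l \<le> L" using A e unfolding elliptic_def by (metis inner_commute mult.right_neutral norm_eq_1 order_trans)
    have AH: "A \<bullet> H x = d * (- (B * (B * E x)) * (e \<bullet> (A *v e))) + (2 - E x) * (A \<bullet> decay_hess s x)
        + 2 * (B * E x) * (e \<bullet> (A *v decay_grad s x))"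
      by (simp add: H_def H\<eta>_def inner_add_right inner_outer d_def[symmetric] cross matrix_vector_mult_scaleR algebra_simps)
    have 1: "d * (- (B * (B * E x)) * (e \<bullet> (A *v e))) \<le> d * (- (B * (B * E x)) * l)"
    proof -
      have "e \<bullet> e = 1" using e by (simp add: norm_eq_1)
      then have "l \<le> e \<bullet> (A *v e)" using A unfolding elliptic_def by (metis mult.right_neutral)
      then show ?thesis using d B Ex by (intro mult_left_mono mult_left_mono_neg) auto
    qed
    have 2: "(2 - E x) * (A \<bullet> decay_hess s x) \<le> - (s * \<kappa> * d / (1 + (norm x)\<^sup>2))"
    proof -
      have h: "A \<bullet> decay_hess s x \<le> - (s * \<kappa> * d / (1 + (norm x)\<^sup>2))"
        unfolding d_def by (rule decay_hess_bound[OF A l s \<kappa>(1)])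
      have "0 \<le> s * \<kappa> * d / (1 + (norm x)\<^sup>2)" using s \<kappa> d one_plus_norm_square_pos[of x] by simp
      then have "(2 - E x) * (A \<bullet> decay_hess s x) \<le> 1 * (A \<bullet> decay_hess s x)"
        using h Ex by (intro mult_right_mono_neg) auto
      then show ?thesis using h by simp
    qed
    have 3: "2 * (B * E x) * (e \<bullet> (A *v decay_grad s x)) \<le> 2 * (B * E x) * (L * (s * d))"
    proof -
      have "e \<bullet> (A *v decay_grad s x) \<le> L * (norm e * norm (decay_grad s x))"
        using elliptic_bilinear_bound[OF A, of e "decay_grad s x"] l by simp
      also have "\<dots> \<le> L * (s * d)" using decay_grad_norm[OF s, of x] e l ll
        by (intro mult_left_mono) (auto simp: d_def)
      finally show ?thesis using B Ex by (intro mult_left_mono) auto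
    qed
    have "A \<bullet> H x \<le> d * (- (B * (B * E x)) * l) - (s * \<kappa> * d / (1 + (norm x)\<^sup>2)) + 2 * (B * E x) * (L * (s * d))"
      using AH 1 2 3 by linarith
    also have "\<dots> = - d * (s * \<kappa> / (1 + (norm x)\<^sup>2) + B * (B * l - 2 * L * s) * E x)" by (simp add: algebra_simps)
    finally show ?thesis by (simp add: d_def E_def)
  qed
  with jb sym that show ?thesis by blast
qed

definition reflect :: "real ^ 'n \<Rightarrow> real \<Rightarrow> real ^ 'n \<Rightarrow> real ^ 'n" where
  "reflect e \<mu> x = x - (2 * (e \<bullet> x - \<mu>)) *\<^sub>R e"

lemma reflect_on_plane: "e \<bullet> x = \<mu> \<Longrightarrow> reflect e \<mu> x = x"
  by (simp add: reflect_def)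

lemma inner_reflect: "norm e = 1 \<Longrightarrow> e \<bullet> reflect e \<mu> x = 2 * \<mu> - e \<bullet> x"
  by (simp add: reflect_def inner_diff_right norm_eq_1 algebra_simps)

lemma reflect_reflect: "norm e = 1 \<Longrightarrow> reflect e \<mu> (reflect e \<mu> x) = x"
  by (simp add: reflect_def[of e \<mu> "reflect e \<mu> x"] inner_reflect) (simp add: reflect_def algebra_simps)

lemma dist_reflect_planes: "norm e = 1 \<Longrightarrow> dist (reflect e \<mu> x) (reflect e \<mu>' x) = 2 * \<bar>\<mu> - \<mu>'\<bar>"
proof -
  assume e: "norm e = 1"
  have "reflect e \<mu> x - reflect e \<mu>' x = (2 * (\<mu> - \<mu>')) *\<^sub>R e" by (simp add: reflect_def algebra_simps)
  then show ?thesis using e by (simp only: dist_norm norm_scaleR abs_mult)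
qed

lemma continuous_on_reflect: "continuous_on UNIV (reflect e \<mu>)"
  unfolding reflect_def by (intro continuous_intros)

text \<open>Walk along the segment from \<open>x1\<close> to \<open>x2\<close> and stop just before the first zero of \<open>w\<close>, closer to it than to the
boundary of the half space. The largest ball around this point on which \<open>w\<close> is positive stays in the open half
space.\<close>
lemma touching_ball:
  fixes w :: "real ^ 'n \<Rightarrow> real"
  assumes e: "norm e = 1" and wc: "continuous_on UNIV w" and w0: "\<And>x. \<mu> \<le> e \<bullet> x \<Longrightarrow> 0 \<le> w x"
    and x1: "\<mu> < e \<bullet> x1" "w x1 \<noteq> 0" and x2: "\<mu> < e \<bullet> x2" "w x2 = 0"
  obtains y z r where "0 < r" "norm (z - y) = r" "w z = 0"
    "\<And>x. norm (x - y) \<le> r \<Longrightarrow> \<mu> < e \<bullet> x" "\<And>x. norm (x - y) < r \<Longrightarrow> 0 < w x"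
proof -
  define Zs where "Zs = {x. \<mu> \<le> e \<bullet> x \<and> w x = 0}"
  have Zcl: "closed Zs" unfolding Zs_def
    by (intro closed_Collect_conj closed_Collect_le closed_Collect_eq continuous_intros wc)
  define \<gamma> where "\<gamma> t = x1 + t *\<^sub>R (x2 - x1)" for t :: real
  define d where "d = min (e \<bullet> x1 - \<mu>) (e \<bullet> x2 - \<mu>)"
  have d: "d > 0" using x1 x2 by (simp add: d_def)
  have \<gamma>e: "\<mu> + d \<le> e \<bullet> \<gamma> t" if "0 \<le> t" "t \<le> 1" for t
  proof -
    have "e \<bullet> \<gamma> t - \<mu> = (1 - t) * (e \<bullet> x1 - \<mu>) + t * (e \<bullet> x2 - \<mu>)" by (simp add: \<gamma>_def inner_simps algebra_simps)
    also have "\<dots> \<ge> (1 - t) * d + t * d" using that by (intro add_mono mult_left_mono) (auto simp: d_def)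
    finally show ?thesis by (simp add: algebra_simps)
  qed
  have \<gamma>c: "continuous_on UNIV \<gamma>" unfolding \<gamma>_def by (intro continuous_intros)
  define Ts where "Ts = {0..1} \<inter> {t. w (\<gamma> t) = 0}"
  have "compact Ts" unfolding Ts_def
    by (intro compact_Int_closed compact_Icc closed_Collect_eq continuous_on_compose2[OF wc \<gamma>c] continuous_intros) auto
  moreover have "1 \<in> Ts" using x2 by (simp add: Ts_def \<gamma>_def)
  ultimately obtain ts where ts: "ts \<in> Ts" and tsmin: "\<And>t. t \<in> Ts \<Longrightarrow> ts \<le> t"
    using compact_attains_inf[of Ts] by auto
  have ts0: "0 < ts" "ts \<le> 1" "w (\<gamma> ts) = 0" using ts x1(2) by (auto simp: Ts_def \<gamma>_def less_le)
  define t' where "t' = max 0 (ts - d / (2 * (norm (x2 - x1) + 1)))"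
  have npos: "norm (x2 - x1) + 1 > 0" by (simp add: add_nonneg_pos)
  have t': "0 \<le> t'" "t' < ts" "ts - t' \<le> d / (2 * (norm (x2 - x1) + 1))"
    using ts0 d npos by (auto simp: t'_def max_def)
  define y where "y = \<gamma> t'"
  have ye: "\<mu> + d \<le> e \<bullet> y" unfolding y_def using t' ts0 by (intro \<gamma>e) auto
  have ynZ: "y \<notin> Zs" using tsmin[of t'] t' ts0 by (auto simp: Zs_def y_def Ts_def)
  have \<gamma>Z: "\<gamma> ts \<in> Zs" using \<gamma>e[of ts] ts0 d by (simp add: Zs_def)
  obtain z where z: "z \<in> Zs" "\<And>z'. z' \<in> Zs \<Longrightarrow> dist y z \<le> dist y z'"
    using distance_attains_inf[OF Zcl, of y] \<gamma>Z by blast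
  define r where "r = dist y z"
  have r: "r > 0" using z ynZ by (auto simp: r_def)
  have rd: "r < d"
  proof -
    have "r \<le> dist y (\<gamma> ts)" unfolding r_def by (rule z(2)[OF \<gamma>Z])
    also have "\<dots> = (ts - t') * norm (x2 - x1)"
    proof -
      have "y - \<gamma> ts = (t' - ts) *\<^sub>R (x2 - x1)" by (simp add: y_def \<gamma>_def algebra_simps)
      then show ?thesis using t' by (simp add: dist_norm)
    qed
    also have "\<dots> \<le> d / (2 * (norm (x2 - x1) + 1)) * (norm (x2 - x1) + 1)" using t' by (intro mult_mono) auto
    also have "\<dots> = d / 2"
    proof -
      have "d / (2 * q) * q = d / 2" if "q > 0" for q :: real using that by simp
      then show ?thesis using npos by blast
    qed
    finally show ?thesis using d by simp
  qed
  have inS: "\<mu> < e \<bullet> x" if "norm (x - y) \<le> r" for x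
  proof -
    have "\<bar>e \<bullet> (x - y)\<bar> \<le> norm e * norm (x - y)" by (rule Cauchy_Schwarz_ineq2)
    then have "e \<bullet> y - e \<bullet> x \<le> r" using that e by (simp add: inner_diff_right)
    then show ?thesis using ye rd by simp
  qed
  have pos: "0 < w x" if "norm (x - y) < r" for x
  proof -
    have "r \<le> dist y x" if "x \<in> Zs" unfolding r_def by (rule z(2)[OF that])
    then have "x \<notin> Zs" using that by (auto simp: dist_norm norm_minus_commute)
    then show ?thesis using w0[of x] inS[of x] that by (auto simp: Zs_def less_le)
  qed
  have "norm (z - y) = r" "w z = 0" using z(1) by (simp_all add: r_def dist_norm norm_minus_commute Zs_def)
  with r inS pos that show ?thesis by blast
qed

text \<open>The classical choice \<open>exp (- \<alpha> |x - y|\<^sup>2) - exp (- \<alpha> r\<^sup>2)\<close>: away from the centre, the radial second derivative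
dominates for large \<open>\<alpha>\<close>.\<close>
lemma hopf_barrier:
  fixes y :: "real ^ 'n"
  assumes l: "0 < l" "l \<le> L" and r: "0 < r" and \<epsilon>: "0 < \<epsilon>"
  obtains \<phi> g H where "C2_jet \<phi> g H" "\<And>x. transpose (H x) = H x" "\<And>x. \<phi> x < \<epsilon>"
    "\<And>x. r \<le> norm (x - y) \<Longrightarrow> \<phi> x \<le> 0" "\<And>x. norm (x - y) = r \<Longrightarrow> \<phi> x = 0"
    "\<And>x. r / 2 \<le> norm (x - y) \<Longrightarrow> pucci_plus l L (- H x) < 0"
proof -
  define n where "n = real CARD('n)"
  define \<alpha> where "\<alpha> = 2 * n * L / (l * r\<^sup>2) + 1"
  have nL: "n * L > 0" using l by (simp add: n_def)
  have \<alpha>: "\<alpha> > 0" "2 * n * L < \<alpha> * (l * r\<^sup>2)"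
    using nL l r by (simp_all add: \<alpha>_def field_simps add_pos_pos)
  define \<phi> where "\<phi> x = \<epsilon> * exp (- \<alpha> * (norm (x - y))\<^sup>2) + - (\<epsilon> * exp (- \<alpha> * r\<^sup>2))" for x
  define H\<phi> where "H\<phi> x = \<epsilon> *\<^sub>R ((- \<alpha> * exp (- \<alpha> * (norm (x - y))\<^sup>2)) *\<^sub>R (2 *\<^sub>R mat 1)
      + (- \<alpha> * (- \<alpha> * exp (- \<alpha> * (norm (x - y))\<^sup>2))) *\<^sub>R outer (2 *\<^sub>R (x - y)) (2 *\<^sub>R (x - y))) + 0" for x
  have je: "C2_jet (\<lambda>x. exp (- \<alpha> * (norm (x - y))\<^sup>2)) (\<lambda>x. (- \<alpha> * exp (- \<alpha> * (norm (x - y))\<^sup>2)) *\<^sub>R (2 *\<^sub>R (x - y)))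
     (\<lambda>x. (- \<alpha> * exp (- \<alpha> * (norm (x - y))\<^sup>2)) *\<^sub>R (2 *\<^sub>R mat 1)
      + (- \<alpha> * (- \<alpha> * exp (- \<alpha> * (norm (x - y))\<^sup>2))) *\<^sub>R outer (2 *\<^sub>R (x - y)) (2 *\<^sub>R (x - y)))"
    by (rule C2_jet_compose[OF C2_jet_norm_square, where \<psi> = "\<lambda>t. exp (- \<alpha> * t)" and \<psi>' = "\<lambda>t. - \<alpha> * exp (- \<alpha> * t)"
          and \<psi>'' = "\<lambda>t. - \<alpha> * (- \<alpha> * exp (- \<alpha> * t))"])
       (auto intro!: derivative_eq_intros continuous_intros)
  have j\<phi>: "C2_jet \<phi> (\<lambda>x. \<epsilon> *\<^sub>R ((- \<alpha> * exp (- \<alpha> * (norm (x - y))\<^sup>2)) *\<^sub>R (2 *\<^sub>R (x - y))) + 0) H\<phi>"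
    unfolding \<phi>_def H\<phi>_def by (intro C2_jet_add C2_jet_scale C2_jet_const je)
  have sym\<phi>: "transpose (H\<phi> x) = H\<phi> x" for x
    by (simp add: H\<phi>_def transpose_add transpose_diff transpose_minus transpose_scaleR transpose_outer transpose_mat)
  have neg: "pucci_plus l L (- H\<phi> x) < 0" if xr: "r / 2 \<le> norm (x - y)" for x
    proof -
      obtain A where A: "elliptic l L A" "A \<bullet> (- H\<phi> x) = pucci_plus l L (- H\<phi> x)"
        using pucci_plus_attained[of "- H\<phi> x" l L] sym\<phi>[of x] l by (auto simp: transpose_minus)
      define c where "c = \<epsilon> * (2 * \<alpha> * exp (- \<alpha> * (norm (x - y))\<^sup>2))"
      have c: "c > 0" unfolding c_def using \<epsilon> \<alpha> by simp
      have o: "outer (2 *\<^sub>R v) (2 *\<^sub>R v) = 4 *\<^sub>R outer v v" for v :: "real ^ 'n" by (simp add: outer_def vec_eq_iff)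
      have "A \<bullet> (- H\<phi> x) = c * (trace A - 2 * \<alpha> * ((x - y) \<bullet> (A *v (x - y))))"
        by (simp add: H\<phi>_def c_def inner_add_right inner_mat_1 o inner_outer algebra_simps)
      moreover have "trace A \<le> n * L" unfolding n_def by (rule elliptic_trace_upper_bound[OF A(1)])
      moreover have "n * L < 2 * \<alpha> * ((x - y) \<bullet> (A *v (x - y)))"
      proof -
        have "(r / 2)\<^sup>2 \<le> (norm (x - y))\<^sup>2" using xr r by (intro power_mono) auto
        then have "l * (r\<^sup>2 / 4) \<le> l * ((x - y) \<bullet> (x - y))"
          using l by (intro mult_left_mono) (auto simp: power2_norm_eq_inner power_divide)
        also have "\<dots> \<le> (x - y) \<bullet> (A *v (x - y))" using A(1) by (simp only: elliptic_def)
        finally have "2 * \<alpha> * (l * (r\<^sup>2 / 4)) \<le> 2 * \<alpha> * ((x - y) \<bullet> (A *v (x - y)))"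
          using \<alpha> by (intro mult_left_mono) auto
        then show ?thesis using \<alpha>(2) by (simp add: mult_ac)
      qed
      ultimately show ?thesis using A(2) c by (metis diff_less_0_iff_less le_less_trans mult_pos_neg)
    qed
  have \<phi>le: "\<phi> x < \<epsilon>" for x
  proof -
    have "\<epsilon> * exp (- \<alpha> * (norm (x - y))\<^sup>2) \<le> \<epsilon> * 1" using \<epsilon> \<alpha> by (intro mult_left_mono) auto
    moreover have "0 < \<epsilon> * exp (- \<alpha> * r\<^sup>2)" using \<epsilon> by simp
    ultimately show ?thesis by (simp add: \<phi>_def)
  qed
  have \<phi>out: "\<phi> x \<le> 0" if "r \<le> norm (x - y)" for x
  proof -
    have "r\<^sup>2 \<le> (norm (x - y))\<^sup>2" using that r by (intro power_mono) auto
    then show ?thesis using \<epsilon> \<alpha> by (simp add: \<phi>_def)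
  qed
  have "\<phi> x = 0" if "norm (x - y) = r" for x using that by (simp add: \<phi>_def)
  with j\<phi> sym\<phi> \<phi>le \<phi>out neg that show ?thesis by blast
qed

text \<open>What the moving plane argument needs to know about \<open>u\<close>. The assumption \<open>difference\<close> is the viscosity form of
\<open>\<M>\<^sup>-(D\<^sup>2 w) + (u \<circ> \<sigma>)\<^sup>p - u\<^sup>p \<le> 0\<close> for \<open>w = u \<circ> \<sigma> - u\<close>, with \<open>\<sigma>\<close> a reflection; it holds for
solutions for \<open>\<M>\<^sup>+\<close> as well as for \<open>\<M>\<^sup>-\<close>.\<close>
locale moving_planes =
  fixes u :: "real ^ 'n \<Rightarrow> real" and l L p s \<kappa> :: real
  assumes l: "0 < l" "l \<le> L" and p: "1 < p" and s: "0 < s"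
    and \<kappa>: "\<kappa> = (real CARD('n) - 1) * l - (s + 1) * L" "0 < \<kappa>"
    and nonneg: "\<And>x. 0 \<le> u x" and nontrivial: "\<exists>x. u x \<noteq> 0"
    and cont: "uniformly_continuous_on UNIV u"
    and decays: "\<And>\<epsilon>. 0 < \<epsilon> \<Longrightarrow> \<exists>R. \<forall>x. R \<le> norm x \<longrightarrow> u x \<le> \<epsilon> * decay s x"
    and potential: "\<exists>R. \<forall>x. R \<le> norm x \<longrightarrow> 2 * p * u x powr (p - 1) < s * \<kappa> / (1 + (norm x)\<^sup>2)"
    and difference: "\<And>e \<mu> \<phi> g H x\<^sub>0. norm e = 1 \<Longrightarrow> C2_jet \<phi> g H \<Longrightarrow> (\<And>x. transpose (H x) = H x) \<Longrightarrow>
      local_min_at (\<lambda>x. (u (reflect e \<mu> x) - u x) - \<phi> x) x\<^sub>0 \<Longrightarrow>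
      u (reflect e \<mu> x\<^sub>0) powr p - u x\<^sub>0 powr p \<le> pucci_plus l L (- H x\<^sub>0)"
begin

definition w :: "real ^ 'n \<Rightarrow> real \<Rightarrow> real ^ 'n \<Rightarrow> real" where
  "w e \<mu> x = u (reflect e \<mu> x) - u x"

lemma u_continuous: "continuous_on UNIV u"
  using cont by (rule uniformly_continuous_imp_continuous)

lemma w_continuous: "continuous_on UNIV (w e \<mu>)"
  unfolding w_def
  by (intro continuous_on_diff u_continuous continuous_on_compose2[OF u_continuous continuous_on_reflect]) auto

lemma vanishes:
  assumes "0 < c"
  shows "\<exists>R. \<forall>x. R \<le> norm x \<longrightarrow> u x \<le> c"
proof -
  have "c * decay s x \<le> c" for x :: "real ^ 'n" using assms decay_le_one[OF s, of x] by (simp add: mult_left_le)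
  then show ?thesis using decays[OF assms] by (meson order_trans)
qed

text \<open>If \<open>w\<close> were negative somewhere, then the quotient of \<open>w\<close> and the barrier would attain a negative minimum \<open>- m\<close>, as
\<open>u\<close> decays faster than the barrier and \<open>w\<close> vanishes on the plane. There \<open>- m\<close> times the barrier touches \<open>w\<close> from
below, and \<open>u\<^sup>p - (u \<circ> \<sigma>)\<^sup>p \<le> p u\<^sup>p\<^sup>-\<^sup>1 m b\<close>, with \<open>b\<close> the barrier, contradicts the strict inequality for it.\<close>
lemma nonneg_difference:
  assumes e: "norm e = 1" and B: "B > 0" "2 * L * s \<le> B * l"
    and small: "\<And>x. \<mu> < e \<bullet> x \<Longrightarrow> w e \<mu> x < 0 \<Longrightarrow>
      2 * p * u x powr (p - 1) < s * \<kappa> / (1 + (norm x)\<^sup>2) + B * (B * l - 2 * L * s) * exp (- B * (e \<bullet> x - \<mu>))"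
    and x: "\<mu> \<le> e \<bullet> x"
  shows "0 \<le> w e \<mu> x"
proof (rule ccontr)
  assume neg: "\<not> 0 \<le> w e \<mu> x"
  define b where "b = barrier s B e \<mu>"
  define q where "q y = w e \<mu> y / b y" for y
  have b: "decay s y \<le> b y" "b y \<le> 2 * decay s y" "0 < b y" if "\<mu> \<le> e \<bullet> y" for y
    using barrier_bounds[OF B(1) that, of s] decay_pos[of s y] by (auto simp: b_def)
  obtain g H where jb: "C2_jet b g H" and symH: "\<And>x. transpose (H x) = H x"
    and bound: "\<And>x A. elliptic l L A \<Longrightarrow> \<mu> \<le> e \<bullet> x \<Longrightarrow>
       A \<bullet> H x \<le> - decay s x * (s * \<kappa> / (1 + (norm x)\<^sup>2) + B * (B * l - 2 * L * s) * exp (- B * (e \<bullet> x - \<mu>)))"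
    using barrier_jet[OF e B(1) l(1) s \<kappa>(1) less_imp_le[OF \<kappa>(2)], of \<mu>] unfolding b_def by blast
  have qx: "q x < 0" using neg b(3)[OF x] by (simp add: q_def divide_neg_pos)
  obtain R where R: "\<And>y. R \<le> norm y \<Longrightarrow> u y \<le> (- q x / 2) * decay s y"
    using decays[of "- q x / 2"] qx by auto
  define S where "S = {y. \<mu> \<le> e \<bullet> y} \<inter> cball 0 (max R (norm x))"
  have "compact S" unfolding S_def
    by (intro closed_Int_compact compact_cball closed_Collect_le continuous_intros)
  moreover have xS: "x \<in> S" using x by (simp add: S_def)
  moreover have "continuous_on S q" unfolding q_def
    by (intro continuous_on_divide continuous_on_subset[OF w_continuous] continuous_on_subset[OF C2_jetD(4)[OF jb]])
       (use b(3) in \<open>force simp: S_def\<close>)+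
  ultimately obtain x0 where x0: "x0 \<in> S" and x0min: "\<And>y. y \<in> S \<Longrightarrow> q x0 \<le> q y"
    using continuous_attains_inf[of S q] by blast
  have q0: "q x0 \<le> q x" by (rule x0min[OF xS])
  have glob: "q x0 \<le> q y" if y: "\<mu> \<le> e \<bullet> y" for y
  proof (cases "y \<in> S")
    case False
    then have "R \<le> norm y" using y by (auto simp: S_def)
    then have "- w e \<mu> y \<le> (- q x / 2) * decay s y" using R[of y] nonneg[of "reflect e \<mu> y"] by (simp add: w_def)
    also have "\<dots> \<le> (- q x / 2) * b y" using b(1)[OF y] qx by (intro mult_left_mono) auto
    finally have "q x / 2 \<le> q y" using b(3)[OF y] by (simp add: q_def field_simps)
    then show ?thesis using q0 qx by simp
  qed (rule x0min)
  have mu0: "\<mu> \<le> e \<bullet> x0" using x0 by (simp add: S_def)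
  have w0: "w e \<mu> x0 = q x0 * b x0" using b(3)[OF mu0] by (simp add: q_def)
  have wneg: "w e \<mu> x0 < 0" unfolding w0 using q0 qx b(3)[OF mu0] by (intro mult_neg_pos) auto
  have mu0': "\<mu> < e \<bullet> x0"
    using mu0 wneg reflect_on_plane[of e x0 \<mu>] by (cases "\<mu> = e \<bullet> x0") (auto simp: w_def)
  \<comment> \<open>\<open>- m\<close> times the barrier touches the difference from below at \<open>x0\<close>\<close>
  define m where "m = - q x0"
  have m: "m > 0" using q0 qx by (simp add: m_def)
  have "local_min_at (\<lambda>y. (u (reflect e \<mu> y) - u y) - (- m) * b y) x0"
    unfolding local_min_at_def
  proof (rule eventually_mono[OF eventually_nhds_in_open[of "{y. \<mu> < e \<bullet> y}" x0]])
    show "open {y. \<mu> < e \<bullet> y}" by (intro open_Collect_less continuous_intros)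
    fix y assume "y \<in> {y. \<mu> < e \<bullet> y}"
    then have y: "\<mu> \<le> e \<bullet> y" by simp
    have "q x0 * b y \<le> w e \<mu> y" using glob[OF y] b(3)[OF y] by (simp add: q_def pos_le_divide_eq)
    then show "(u (reflect e \<mu> x0) - u x0) - (- m) * b x0 \<le> (u (reflect e \<mu> y) - u y) - (- m) * b y"
      using w0 by (simp add: w_def m_def)
  qed (use mu0' in simp)
  from difference[OF e C2_jet_scale[OF jb, of "- m"] _ this]
  have d: "u (reflect e \<mu> x0) powr p - u x0 powr p \<le> pucci_plus l L (m *\<^sub>R H x0)"
    by (simp add: transpose_minus transpose_scaleR symH)
  define Q where "Q = s * \<kappa> / (1 + (norm x0)\<^sup>2) + B * (B * l - 2 * L * s) * exp (- B * (e \<bullet> x0 - \<mu>))"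
  have "pucci_plus l L (m *\<^sub>R H x0) \<le> m * (- decay s x0 * Q)"
  proof (rule pucci_plus_leI)
    show "A \<bullet> (m *\<^sub>R H x0) \<le> m * (- decay s x0 * Q)" if "elliptic l L A" for A
      using bound[OF that mu0] m unfolding Q_def by (simp only: inner_scaleR_right mult_left_mono less_imp_le)
  qed (use l symH in \<open>auto simp: transpose_scaleR\<close>)
  then have "m * (decay s x0 * Q) \<le> u x0 powr p - u (reflect e \<mu> x0) powr p" using d by simp
  also have "\<dots> \<le> p * u x0 powr (p - 1) * (u x0 - u (reflect e \<mu> x0))"
    using wneg by (intro powr_difference_le nonneg p) (simp add: w_def)
  also have "u x0 - u (reflect e \<mu> x0) = m * b x0" using w0 by (simp add: w_def m_def)
  also have "p * u x0 powr (p - 1) * (m * b x0) \<le> p * u x0 powr (p - 1) * (m * (2 * decay s x0))"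
    using b(2)[OF mu0] m p by (intro mult_left_mono) auto
  finally have "(m * decay s x0) * Q \<le> (m * decay s x0) * (2 * p * u x0 powr (p - 1))" by (simp add: mult_ac)
  then have "Q \<le> 2 * p * u x0 powr (p - 1)" using m decay_pos[of s x0] by simp
  with small[OF mu0' wneg] show False by (simp add: Q_def)
qed

text \<open>As \<open>w \<ge> 0\<close> implies \<open>(u \<circ> \<sigma>)\<^sup>p \<ge> u\<^sup>p\<close>, the nonlinear terms have a favourable sign and \<open>w\<close> is a supersolution of
\<open>\<M>\<^sup>-(D\<^sup>2 w) \<le> 0\<close>. At an interior zero of \<open>w\<close> on the boundary of a ball of positivity, a Hopf barrier touches \<open>w\<close>
from below, which is impossible.\<close>
lemma strong_maximum_principle:
  assumes e: "norm e = 1" and w0: "\<And>x. \<mu> \<le> e \<bullet> x \<Longrightarrow> 0 \<le> w e \<mu> x"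
    and x1: "\<mu> < e \<bullet> x1" "w e \<mu> x1 \<noteq> 0" and x2: "\<mu> < e \<bullet> x2"
  shows "0 < w e \<mu> x2"
proof (rule ccontr)
  assume "\<not> 0 < w e \<mu> x2"
  then have wx2: "w e \<mu> x2 = 0" using w0[of x2] x2 by simp
  obtain y z r where r: "r > 0" and zn: "norm (z - y) = r" and wz: "w e \<mu> z = 0"
    and inS: "\<And>x. norm (x - y) \<le> r \<Longrightarrow> \<mu> < e \<bullet> x" and pos: "\<And>x. norm (x - y) < r \<Longrightarrow> 0 < w e \<mu> x"
    by (rule touching_ball[OF e w_continuous w0 x1 x2 wx2]) blast+
  obtain m0 where m0: "m0 > 0" "\<And>x. x \<in> cball y (r / 2) \<Longrightarrow> m0 \<le> w e \<mu> x"
  proof -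
    obtain x where "x \<in> cball y (r / 2)" "\<And>x'. x' \<in> cball y (r / 2) \<Longrightarrow> w e \<mu> x \<le> w e \<mu> x'"
      using continuous_attains_inf[of "cball y (r / 2)" "w e \<mu>"] r continuous_on_subset[OF w_continuous] by (metis compact_cball cball_eq_empty half_gt_zero not_less_iff_gr_or_eq subset_UNIV)
    then show ?thesis using that[of "w e \<mu> x"] pos[of x] r by (auto simp: dist_norm norm_minus_commute)
  qed
  obtain \<phi> g H where j\<phi>: "C2_jet \<phi> g H" and sym\<phi>: "\<And>x. transpose (H x) = H x"
    and \<phi>le: "\<And>x. \<phi> x < m0" and \<phi>out: "\<And>x. r \<le> norm (x - y) \<Longrightarrow> \<phi> x \<le> 0"
    and \<phi>sphere: "\<And>x. norm (x - y) = r \<Longrightarrow> \<phi> x = 0"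
    and neg: "\<And>x. r / 2 \<le> norm (x - y) \<Longrightarrow> pucci_plus l L (- H x) < 0"
    by (rule hopf_barrier[OF l r m0(1), of y]) blast
  have no_min: False if lm: "local_min_at (\<lambda>x. (u (reflect e \<mu> x) - u x) - \<phi> x) x"
    and xr: "r / 2 \<le> norm (x - y)" "norm (x - y) \<le> r" for x
  proof -
    have "u (reflect e \<mu> x) powr p - u x powr p \<le> pucci_plus l L (- H x)"
      by (rule difference[OF e j\<phi> sym\<phi> lm])
    moreover have "u x powr p \<le> u (reflect e \<mu> x) powr p"
      using w0[of x] inS[OF xr(2)] nonneg[of x] p by (intro powr_mono2) (auto simp: w_def)
    ultimately show False using neg[OF xr(1)] by linarith
  qed
  define Kn where "Kn = cball y r - ball y (r / 2)"
  have "compact Kn" unfolding Kn_def by (intro compact_diff compact_cball open_ball)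
  moreover have zK: "z \<in> Kn" using r zn by (simp add: Kn_def dist_norm norm_minus_commute)
  moreover have "continuous_on Kn (\<lambda>x. w e \<mu> x - \<phi> x)"
    by (intro continuous_on_diff continuous_on_subset[OF w_continuous] continuous_on_subset[OF C2_jetD(4)[OF j\<phi>]]) auto
  ultimately obtain xs where xs: "xs \<in> Kn" and xsmin: "\<And>x. x \<in> Kn \<Longrightarrow> w e \<mu> xs - \<phi> xs \<le> w e \<mu> x - \<phi> x"
    using continuous_attains_inf[of Kn "\<lambda>x. w e \<mu> x - \<phi> x"] by blast
  have xsn: "r / 2 \<le> norm (xs - y)" "norm (xs - y) \<le> r"
    using xs by (auto simp: Kn_def dist_norm norm_minus_commute)
  show False
  proof (cases "w e \<mu> xs - \<phi> xs < 0")
    case True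
    have "norm (xs - y) \<noteq> r"
      using True \<phi>out[of xs] w0[of xs] inS[OF xsn(2)] by auto
    moreover have "norm (xs - y) \<noteq> r / 2"
      using True \<phi>le[of xs] m0(2)[of xs] by (auto simp: dist_norm norm_minus_commute)
    ultimately have st: "r / 2 < norm (xs - y)" "norm (xs - y) < r" using xsn by auto
    have "local_min_at (\<lambda>x. (u (reflect e \<mu> x) - u x) - \<phi> x) xs"
      unfolding local_min_at_def
    proof (rule eventually_mono[OF eventually_nhds_in_open[of "ball y r - cball y (r / 2)" xs]])
      fix x assume "x \<in> ball y r - cball y (r / 2)"
      then have "x \<in> Kn" by (auto simp: Kn_def)
      from xsmin[OF this] show "(u (reflect e \<mu> xs) - u xs) - \<phi> xs \<le> (u (reflect e \<mu> x) - u x) - \<phi> x" by (simp add: w_def)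
    qed (use st in \<open>auto simp: dist_norm norm_minus_commute intro: open_Diff\<close>)
    then show False using no_min xsn by blast
  next
    case False
    have "local_min_at (\<lambda>x. (u (reflect e \<mu> x) - u x) - \<phi> x) z"
      unfolding local_min_at_def
    proof (rule eventually_mono[OF eventually_nhds_in_open[of "{x. \<mu> < e \<bullet> x} - cball y (r / 2)" z]])
      show "open ({x. \<mu> < e \<bullet> x} - cball y (r / 2))"
        by (intro open_Diff open_Collect_less continuous_intros closed_cball)
      show "z \<in> {x. \<mu> < e \<bullet> x} - cball y (r / 2)" using inS[of z] zn r by (simp add: dist_norm norm_minus_commute)
      fix x assume x: "x \<in> {x. \<mu> < e \<bullet> x} - cball y (r / 2)"
      have "0 \<le> w e \<mu> x - \<phi> x"
      proof (cases "norm (x - y) \<le> r")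
        case True
        then have "x \<in> Kn" using x by (auto simp: Kn_def dist_norm norm_minus_commute)
        then show ?thesis using xsmin[of x] False by simp
      next
        case False
        then show ?thesis using \<phi>out[of x] w0[of x] x by simp
      qed
      then show "(u (reflect e \<mu> z) - u z) - \<phi> z \<le> (u (reflect e \<mu> x) - u x) - \<phi> x" using wz \<phi>sphere[OF zn] by (simp add: w_def)
    qed
    then show False using no_min[of z] zn r by simp
  qed
qed

lemma bounded_above: "\<exists>M>0. \<forall>x. u x \<le> M"
proof -
  obtain R where R: "\<And>x. R \<le> norm x \<Longrightarrow> u x \<le> 1" using vanishes[of 1] by auto
  have "compact (u ` cball 0 R)" by (intro compact_continuous_image compact_cball continuous_on_subset[OF u_continuous]) auto
  then obtain M where M: "\<And>x. x \<in> cball 0 R \<Longrightarrow> norm (u x) \<le> M" using compact_imp_bounded bounded_iff by (metis imageI)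
  have "u x \<le> max 1 M" for x using M[of x] R[of x] by (cases "norm x \<le> R") auto
  then show ?thesis by (intro exI[of _ "max 1 M"]) auto
qed

text \<open>Nonnegativity of \<open>w\<close> in the whole half space follows from nonnegativity in a bounded part of it away from the plane:
elsewhere the barrier is a strict supersolution. The bounds \<open>R\<close> and \<open>\<delta>\<close> are uniform in the plane.\<close>
lemma nonneg_difference_localised:
  obtains R \<delta> where "0 < \<delta>"
    "\<And>e \<mu> x. norm e = 1 \<Longrightarrow> (\<And>y. norm y < R \<Longrightarrow> \<mu> + \<delta> < e \<bullet> y \<Longrightarrow> 0 \<le> w e \<mu> y) \<Longrightarrow> \<mu> \<le> e \<bullet> x \<Longrightarrow> 0 \<le> w e \<mu> x"
proof -
  obtain R where R: "\<And>x. R \<le> norm x \<Longrightarrow> 2 * p * u x powr (p - 1) < s * \<kappa> / (1 + (norm x)\<^sup>2)"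
    using potential by blast
  obtain M where M: "M > 0" "\<And>x. u x \<le> M" using bounded_above by blast
  \<comment> \<open>\<open>D\<close> times \<open>exp (- 1)\<close> bounds the potential, and \<open>exp (- 1)\<close> is the smallest value of the exponential in the strip.\<close>
  define D where "D = 2 * p * M powr (p - 1) * exp 1"
  have D: "D \<ge> 0" using p by (simp add: D_def)
  define B where "B = (2 * L * s + D + 1) / l + 1"
  have "0 < L * s" using l s by simp
  then have B1: "B > 1" "B * l \<ge> 2 * L * s + D + 1" using l(1) D by (simp_all add: B_def field_simps)
  define c where "c = B * (B * l - 2 * L * s)"
  have "1 * (D + 1) \<le> c" unfolding c_def using B1 D by (intro mult_mono) auto
  then have c: "D < c" "0 \<le> c" using D by auto
  show ?thesis
  proof (rule that[of "1 / B" R])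
    show "0 < 1 / B" using B1 by simp
    fix e x :: "real ^ 'n" and \<mu>
    assume e: "norm e = 1" and loc: "\<And>y. norm y < R \<Longrightarrow> \<mu> + 1 / B < e \<bullet> y \<Longrightarrow> 0 \<le> w e \<mu> y" and x: "\<mu> \<le> e \<bullet> x"
    show "0 \<le> w e \<mu> x"
    proof (rule nonneg_difference[OF e _ _ _ x])
      show "0 < B" "2 * L * s \<le> B * l" using B1 D by auto
      fix y assume y: "\<mu> < e \<bullet> y" "w e \<mu> y < 0"
      have k: "0 \<le> s * \<kappa> / (1 + (norm y)\<^sup>2)" using s \<kappa>(2) one_plus_norm_square_pos[of y] by simp
      have "2 * p * u y powr (p - 1) < s * \<kappa> / (1 + (norm y)\<^sup>2) + c * exp (- B * (e \<bullet> y - \<mu>))"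
      proof (cases "R \<le> norm y")
        case True
        then show ?thesis using R[of y] mult_nonneg_nonneg[OF c(2) exp_ge_zero] by (metis add_increasing2 less_le_trans order_refl)
      next
        case False
        then have "e \<bullet> y - \<mu> \<le> 1 / B" using loc[of y] y(2) by fastforce
        then have "B * (e \<bullet> y - \<mu>) \<le> 1" using B1 by (simp add: pos_le_divide_eq mult.commute)
        then have "c * exp (- 1) \<le> c * exp (- B * (e \<bullet> y - \<mu>))" using c by (intro mult_left_mono) auto
        moreover have "D * exp (- 1) < c * exp (- 1)" using c by simp
        moreover have "D * exp (- 1) = 2 * p * M powr (p - 1)" by (simp add: D_def mult.assoc exp_add[symmetric])
        moreover have "2 * p * u y powr (p - 1) \<le> 2 * p * M powr (p - 1)"
          using M(2)[of y] nonneg[of y] p by (intro mult_left_mono powr_mono2) auto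
        ultimately show ?thesis using k by linarith
      qed
      then show "2 * p * u y powr (p - 1) < s * \<kappa> / (1 + (norm y)\<^sup>2) + B * (B * l - 2 * L * s) * exp (- B * (e \<bullet> y - \<mu>))"
        by (simp add: c_def)
    qed
  qed
qed

text \<open>If \<open>w > 0\<close> beyond the plane, then \<open>w\<close> is bounded below by a positive constant on the compact set of the
localisation, and remains positive there after a small move of the plane.\<close>
lemma plane_moves_further:
  assumes e: "norm e = 1" and pos: "\<And>y. \<mu> < e \<bullet> y \<Longrightarrow> 0 < w e \<mu> y"
  obtains \<epsilon> where "0 < \<epsilon>" "\<And>\<nu> x. \<mu> - \<epsilon> \<le> \<nu> \<Longrightarrow> \<nu> < \<mu> \<Longrightarrow> \<nu> \<le> e \<bullet> x \<Longrightarrow> 0 \<le> w e \<nu> x"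
proof -
  obtain R \<delta> where \<delta>: "0 < \<delta>" and loc: "\<And>e \<mu> x. norm e = 1 \<Longrightarrow>
      (\<And>y. norm y < R \<Longrightarrow> \<mu> + \<delta> < e \<bullet> y \<Longrightarrow> 0 \<le> w e \<mu> y) \<Longrightarrow> \<mu> \<le> e \<bullet> x \<Longrightarrow> 0 \<le> w e \<mu> x"
    by (rule nonneg_difference_localised) blast
  define Kc where "Kc = {y. \<mu> + \<delta> / 2 \<le> e \<bullet> y} \<inter> cball 0 R"
  have Kc: "compact Kc" unfolding Kc_def by (intro closed_Int_compact compact_cball closed_Collect_le continuous_intros)
  obtain m where m: "m > 0" "\<And>y. y \<in> Kc \<Longrightarrow> m \<le> w e \<mu> y"
  proof (cases "Kc = {}")
    case False
    then obtain y where "y \<in> Kc" "\<And>y'. y' \<in> Kc \<Longrightarrow> w e \<mu> y \<le> w e \<mu> y'"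
      using continuous_attains_inf[OF Kc, of "w e \<mu>"] continuous_on_subset[OF w_continuous] by blast
    moreover have "0 < w e \<mu> y" by (rule pos) (use \<open>y \<in> Kc\<close> \<delta> in \<open>auto simp: Kc_def\<close>)
    ultimately show ?thesis using that by blast
  qed (use that[of 1] in auto)
  obtain d where d: "d > 0" "\<And>y y'. dist y' y < d \<Longrightarrow> dist (u y') (u y) < m"
    using cont m(1) unfolding uniformly_continuous_on_def by (metis UNIV_I)
  define \<epsilon> where "\<epsilon> = min (d / 4) (\<delta> / 2)"
  have \<epsilon>: "\<epsilon> > 0" "2 * \<epsilon> < d" "\<epsilon> \<le> \<delta> / 2" using d \<delta> by (auto simp: \<epsilon>_def min_def)
  have "0 \<le> w e \<nu> x" if \<nu>: "\<mu> - \<epsilon> \<le> \<nu>" "\<nu> < \<mu>" and x: "\<nu> \<le> e \<bullet> x" for \<nu> x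
  proof (rule loc[OF e _ x])
    fix y assume y: "norm y < R" "\<nu> + \<delta> < e \<bullet> y"
    have "dist (reflect e \<mu> y) (reflect e \<nu> y) < d" using \<nu> \<epsilon> by (simp add: dist_reflect_planes[OF e])
    from d(2)[OF this] have "\<bar>u (reflect e \<mu> y) - u (reflect e \<nu> y)\<bar> < m" by (simp add: dist_real_def)
    moreover have "y \<in> Kc" using y \<nu>(1) \<epsilon>(3) by (simp add: Kc_def)
    ultimately show "0 \<le> w e \<nu> y" using m(2)[of y] by (simp add: w_def abs_less_iff)
  qed
  with \<epsilon>(1) that show ?thesis by blast
qed

text \<open>The planes for which \<open>w \<ge> 0\<close>, together with all planes beyond them, form a half line that does not extend to
\<open>- \<infinity>\<close>, since otherwise \<open>u\<close> would be monotone along \<open>e\<close>, against decay. At the extreme position \<open>w\<close> vanishes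
identically: otherwise \<open>w > 0\<close>, and the plane could be moved further.\<close>
lemma symmetric_hyperplane:
  assumes e: "norm e = 1"
  obtains \<mu> where "\<And>x. u (reflect e \<mu> x) = u x"
proof -
  have ex: "\<bar>e \<bullet> x\<bar> \<le> norm x" for x using Cauchy_Schwarz_ineq2[of e x] e by simp
  define T where "T = {\<mu>. \<forall>\<nu>\<ge>\<mu>. \<forall>x. \<nu> \<le> e \<bullet> x \<longrightarrow> 0 \<le> w e \<nu> x}"
  obtain R where "R \<in> T"
  proof -
    obtain R \<delta> where \<delta>: "0 < \<delta>" and loc: "\<And>e \<mu> x. norm e = 1 \<Longrightarrow>
        (\<And>y. norm y < R \<Longrightarrow> \<mu> + \<delta> < e \<bullet> y \<Longrightarrow> 0 \<le> w e \<mu> y) \<Longrightarrow> \<mu> \<le> e \<bullet> x \<Longrightarrow> 0 \<le> w e \<mu> x"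
      by (rule nonneg_difference_localised) blast
    have "R \<in> T" unfolding T_def
    proof (intro CollectI allI impI)
      fix \<nu> x assume \<nu>: "R \<le> \<nu>" "\<nu> \<le> e \<bullet> x"
      show "0 \<le> w e \<nu> x"
      proof (rule loc[OF e _ \<nu>(2)])
        show "0 \<le> w e \<nu> y" if "norm y < R" "\<nu> + \<delta> < e \<bullet> y" for y using that \<nu>(1) \<delta> ex[of y] by linarith
      qed
    qed
    then show ?thesis by (rule that)
  qed
  have Tup: "\<nu> \<in> T" if "\<mu> \<in> T" "\<mu> \<le> \<nu>" for \<mu> \<nu> using that unfolding T_def by (auto intro: order_trans)
  have "bdd_below T"
  proof (rule ccontr)
    assume nb: "\<not> bdd_below T"
    have all: "\<mu> \<in> T" for \<mu>
    proof -
      obtain \<mu>' where "\<mu>' \<in> T" "\<mu>' < \<mu>" using nb unfolding bdd_below_def by (meson not_le)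
      then show ?thesis using Tup by (meson less_imp_le)
    qed
    have mono: "u x \<le> u (x - t *\<^sub>R e)" if "t \<ge> 0" for x t
    proof -
      have "0 \<le> w e (e \<bullet> x - t / 2) x" using all[of "e \<bullet> x - t / 2"] that unfolding T_def by auto
      moreover have "reflect e (e \<bullet> x - t / 2) x = x - t *\<^sub>R e" by (simp add: reflect_def)
      ultimately show ?thesis by (simp add: w_def)
    qed
    obtain x where x: "u x \<noteq> 0" using nontrivial by blast
    then have ux: "u x > 0" using nonneg[of x] by simp
    obtain R' where R': "\<And>y. R' \<le> norm y \<Longrightarrow> u y \<le> u x / 2" using vanishes[of "u x / 2"] ux by auto
    define t where "t = \<bar>R'\<bar> + norm x"
    have "norm (t *\<^sub>R e) \<le> norm (x - t *\<^sub>R e) + norm x" by (metis norm_triangle_sub norm_minus_commute add.commute)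
    then have "R' \<le> norm (x - t *\<^sub>R e)" using e by (simp add: t_def)
    from R'[OF this] show False using mono[of t x] ux by (simp add: t_def)
  qed
  define \<mu>0 where "\<mu>0 = Inf T"
  have low: "\<mu>0 \<le> \<mu>" if "\<mu> \<in> T" for \<mu> unfolding \<mu>0_def by (rule cInf_lower[OF that \<open>bdd_below T\<close>])
  have above: "\<mu> \<in> T" if lt: "\<mu>0 < \<mu>" for \<mu>
  proof -
    have "\<exists>\<mu>'\<in>T. \<mu>' < \<mu>" using cInf_lessD[of T \<mu>] lt \<open>R \<in> T\<close> unfolding \<mu>0_def by blast
    then obtain \<mu>' where "\<mu>' \<in> T" "\<mu>' < \<mu>" by blast
    then show ?thesis using Tup by (meson less_imp_le)
  qed
  have w\<mu>0: "0 \<le> w e \<mu>0 x" if "\<mu>0 \<le> e \<bullet> x" for x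
  proof (cases "\<mu>0 = e \<bullet> x")
    case True
    then show ?thesis using reflect_on_plane[of e x \<mu>0] by (simp add: w_def)
  next
    case False
    then have lt: "\<mu>0 < e \<bullet> x" using that by simp
    have "continuous_on UNIV (\<lambda>\<mu>. w e \<mu> x)"
      unfolding w_def reflect_def
      by (intro continuous_on_diff continuous_on_const continuous_on_compose2[OF u_continuous]) (auto intro!: continuous_intros)
    then have "((\<lambda>\<mu>. w e \<mu> x) \<longlongrightarrow> w e \<mu>0 x) (at_right \<mu>0)"
      by (simp add: continuous_on_eq_continuous_within continuous_within filterlim_at_split)
    moreover have "eventually (\<lambda>\<mu>. 0 \<le> w e \<mu> x) (at_right \<mu>0)"
      unfolding eventually_at_right_field
    proof (intro exI[of _ "e \<bullet> x"] conjI lt allI impI)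
      fix \<mu> assume "\<mu>0 < \<mu>" "\<mu> < e \<bullet> x"
      then show "0 \<le> w e \<mu> x" using above[of \<mu>] unfolding T_def by auto
    qed
    ultimately show ?thesis by (rule tendsto_lowerbound) simp
  qed
  have zero: "w e \<mu>0 x = 0" if "\<mu>0 < e \<bullet> x" for x
  proof (rule ccontr)
    assume nz: "w e \<mu>0 x \<noteq> 0"
    have wpos: "0 < w e \<mu>0 y" if "\<mu>0 < e \<bullet> y" for y
      by (rule strong_maximum_principle[OF e w\<mu>0 \<open>\<mu>0 < e \<bullet> x\<close> nz that])
    obtain \<epsilon> where \<epsilon>: "\<epsilon> > 0" "\<And>\<nu> y. \<mu>0 - \<epsilon> \<le> \<nu> \<Longrightarrow> \<nu> < \<mu>0 \<Longrightarrow> \<nu> \<le> e \<bullet> y \<Longrightarrow> 0 \<le> w e \<nu> y"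
      using plane_moves_further[OF e wpos] by blast
    have "\<mu>0 - \<epsilon> \<in> T" unfolding T_def
    proof (intro CollectI allI impI)
      fix \<nu> y assume \<nu>: "\<mu>0 - \<epsilon> \<le> \<nu>" "\<nu> \<le> e \<bullet> y"
      show "0 \<le> w e \<nu> y"
      proof (cases "\<mu>0 \<le> \<nu>")
        case True
        then show ?thesis using w\<mu>0[of y] above[of \<nu>] \<nu>(2) unfolding T_def by (cases "\<mu>0 = \<nu>") auto
      next
        case False
        then show ?thesis using \<epsilon>(2)[OF \<nu>(1) _ \<nu>(2)] by simp
      qed
    qed
    from low[OF this] \<epsilon> show False by simp
  qed
  have "u (reflect e \<mu>0 x) = u x" for x
  proof -
    consider "\<mu>0 < e \<bullet> x" | "e \<bullet> x = \<mu>0" | "\<mu>0 < e \<bullet> reflect e \<mu>0 x"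
      using inner_reflect[OF e, of \<mu>0 x] by fastforce
    then show ?thesis
    proof cases
      case 1
      then show ?thesis using zero[of x] by (simp add: w_def)
    next
      case 2
      then show ?thesis by (simp add: reflect_on_plane)
    next
      case 3
      then show ?thesis using zero[OF 3] by (simp add: w_def reflect_reflect[OF e])
    qed
  qed
  with that show ?thesis by blast
qed

text \<open>The planes of symmetry orthogonal to the coordinate axes meet in a point \<open>c\<close>, and the product of their reflections is the
point reflection at \<open>c\<close>. A plane of symmetry missing \<open>c\<close> would yield a second one, its mirror image under the
point reflection, hence invariance under a nontrivial translation, against decay. So all reflections in planes through
\<open>c\<close> preserve \<open>u\<close>, and these act transitively on spheres.\<close>
theorem radial_about_a_point:
  obtains c where "\<And>x y. norm x = norm y \<Longrightarrow> u (x + c) = u (y + c)"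
proof -
  have "\<forall>e. \<exists>\<mu>. norm e = 1 \<longrightarrow> (\<forall>x. u (reflect e \<mu> x) = u x)" using symmetric_hyperplane by meson
  then obtain \<mu> where \<mu>: "\<And>e x. norm e = 1 \<Longrightarrow> u (reflect e (\<mu> e) x) = u x" by metis
  define c where "c = (\<chi> i. \<mu> (axis i 1))"
  define v where "v x = u (x + c)" for x
  have vr: "v (x - (2 * (e \<bullet> x - (\<mu> e - e \<bullet> c))) *\<^sub>R e) = v x" if "norm e = 1" for e x
    using \<mu>[OF that, of "x + c"] by (simp add: v_def reflect_def inner_add_right algebra_simps)
  \<comment> \<open>the reflections in the coordinate planes, composed one after the other\<close>
  have flip: "v (\<chi> i. if i \<in> I then - x $ i else x $ i) = v x" if "finite I" for I and x :: "real ^ 'n"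
    using that
  proof (induction I)
    case empty
    then show ?case by simp
  next
    case (insert j I)
    let ?y = "(\<chi> i. if i \<in> I then - x $ i else x $ i) :: real ^ 'n"
    let ?e = "axis j 1 :: real ^ 'n"
    have "?y - (2 * (?e \<bullet> ?y - (\<mu> ?e - ?e \<bullet> c))) *\<^sub>R ?e = (\<chi> i. if i \<in> insert j I then - x $ i else x $ i)"
    proof -
      have "axis j (1::real) $ i = (if i = j then 1 else 0)" for i by (simp add: axis_def)
      then show ?thesis using insert.hyps by (auto simp: vec_eq_iff inner_axis' c_def)
    qed
    then show ?case using vr[of ?e ?y] insert.IH by simp
  qed
  have even: "v (- x) = v x" for x
  proof -
    have "(\<chi> i. if i \<in> UNIV then - x $ i else x $ i) = - x" by (simp add: vec_eq_iff)
    then show ?thesis using flip[of UNIV x] by simp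
  qed
  have center: "\<mu> e - e \<bullet> c = 0" if e: "norm e = 1" for e
  proof (rule ccontr)
    assume nz: "\<mu> e - e \<bullet> c \<noteq> 0"
    define \<nu> where "\<nu> = \<mu> e - e \<bullet> c"
    have ee: "e \<bullet> e = 1" using e by (simp add: norm_eq_1)
    have r1: "v (x - (2 * (e \<bullet> x - \<nu>)) *\<^sub>R e) = v x" for x unfolding \<nu>_def by (rule vr[OF e])
    have r2: "v (x - (2 * (e \<bullet> x + \<nu>)) *\<^sub>R e) = v x" for x
    proof -
      have "v x = v (- x)" by (simp add: even)
      also have "\<dots> = v (- x - (2 * (e \<bullet> (- x) - \<nu>)) *\<^sub>R e)" by (rule r1[symmetric])
      also have "- x - (2 * (e \<bullet> (- x) - \<nu>)) *\<^sub>R e = - (x - (2 * (e \<bullet> x + \<nu>)) *\<^sub>R e)" by (simp add: algebra_simps)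
      finally show ?thesis by (simp only: even)
    qed
    have step: "v (x - (4 * \<nu>) *\<^sub>R e) = v x" for x
    proof -
      let ?y = "x - (2 * (e \<bullet> x - \<nu>)) *\<^sub>R e"
      have eq: "?y - (2 * (e \<bullet> ?y + \<nu>)) *\<^sub>R e = x - (4 * \<nu>) *\<^sub>R e"
      proof -
        have "e \<bullet> ?y = 2 * \<nu> - e \<bullet> x" by (simp add: inner_diff_right ee)
        then show ?thesis by (simp only:) (simp add: vec_eq_iff algebra_simps)
      qed
      show ?thesis by (rule trans[OF arg_cong[OF eq[symmetric], of v] trans[OF r2 r1]])
    qed
    \<comment> \<open>The composition of the two reflections is a translation, which can be iterated.\<close>
    have steps: "v (x - (real k * (4 * \<nu>)) *\<^sub>R e) = v x" for x k
    proof (induction k)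
      case (Suc k)
      have eq: "x - (real (Suc k) * (4 * \<nu>)) *\<^sub>R e = (x - (real k * (4 * \<nu>)) *\<^sub>R e) - (4 * \<nu>) *\<^sub>R e"
        by (simp add: algebra_simps)
      show ?case by (rule trans[OF arg_cong[OF eq, of v] trans[OF step Suc]])
    qed simp
    obtain x0 where x0: "u x0 \<noteq> 0" using nontrivial by blast
    then have ux: "u x0 > 0" using nonneg[of x0] by simp
    obtain R where R: "\<And>y. R \<le> norm y \<Longrightarrow> u y \<le> u x0 / 2" using vanishes[of "u x0 / 2"] ux by auto
    obtain k :: nat where k: "\<bar>R\<bar> + norm x0 < real k * (4 * \<bar>\<nu>\<bar>)"
      using ex_less_of_nat_mult[of "4 * \<bar>\<nu>\<bar>"] nz \<nu>_def by auto
    define y where "y = x0 - (real k * (4 * \<nu>)) *\<^sub>R e"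
    have "norm ((real k * (4 * \<nu>)) *\<^sub>R e) \<le> norm y + norm x0"
      unfolding y_def by (metis norm_triangle_sub norm_minus_commute add.commute)
    then have "R \<le> norm y" using k e by (simp add: abs_mult)
    then have "u y \<le> u x0 / 2" by (rule R)
    moreover have "u y = u x0" using steps[of "x0 - c" k] by (simp add: v_def y_def algebra_simps)
    ultimately show False using ux by simp
  qed
  have "v x = v y" if n: "norm x = norm y" for x y
  proof (cases "x = y")
    case False
    define d where "d = norm (x - y)"
    define e where "e = (x - y) /\<^sub>R d"
    have d: "d > 0" using False by (simp add: d_def)
    have e: "norm e = 1" using d by (simp add: e_def d_def)
    have "x \<bullet> x = y \<bullet> y" using n by (simp add: norm_eq)
    then have "2 * ((x - y) \<bullet> x) = d\<^sup>2"
      by (simp add: d_def power2_norm_eq_inner inner_diff_left inner_diff_right inner_commute)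
    moreover have "2 * (e \<bullet> x) = inverse d * (2 * ((x - y) \<bullet> x))" by (simp add: e_def)
    ultimately have "2 * (e \<bullet> x) = d" using d by (simp add: power2_eq_square)
    then have "x - (2 * (e \<bullet> x - (\<mu> e - e \<bullet> c))) *\<^sub>R e = y" using center[OF e] d by (simp add: e_def)
    then show ?thesis using vr[OF e, of x] by simp
  qed simp
  then show ?thesis unfolding v_def by (rule that)
qed

end

section \<open>Viscosity solutions under isometries, and the theorem\<close>

lemma local_min_at_affine:
  fixes R :: "real ^ 'n ^ 'n"
  assumes R: "orthogonal_matrix R" and m: "local_min_at (\<lambda>x. u (R *v x + b) - \<phi> x) x\<^sub>0"
  shows "local_min_at (\<lambda>y. u y - \<phi> (transpose R *v y + transpose R *v (- b))) (R *v x\<^sub>0 + b)"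
proof -
  let ?T = "\<lambda>y. transpose R *v y + transpose R *v (- b)"
  have inv1: "?T (R *v x + b) = x" for x
    using R by (simp add: matrix_vector_right_distrib[symmetric] matrix_vector_mul_assoc orthogonal_matrix_def
        del: transpose_matrix_vector)
  have inv2: "R *v ?T y + b = y" for y
    using R by (simp add: matrix_vector_right_distrib[symmetric] matrix_vector_mul_assoc orthogonal_matrix_def
        del: transpose_matrix_vector)
  have "continuous_on UNIV ((*v) (transpose R))"
    by (intro linear_continuous_on matrix_vector_mul_bounded_linear)
  then have "continuous_on UNIV ?T" by (intro continuous_on_add continuous_on_const)
  then have "isCont ?T (R *v x\<^sub>0 + b)" by (simp add: continuous_on_eq_continuous_within)
  then have "filterlim ?T (nhds (?T (R *v x\<^sub>0 + b))) (nhds (R *v x\<^sub>0 + b))"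
    using tendsto_at_iff_tendsto_nhds[of ?T "R *v x\<^sub>0 + b"] unfolding isCont_def by blast
  then have "filterlim ?T (nhds x\<^sub>0) (nhds (R *v x\<^sub>0 + b))" unfolding inv1 .
  then have "eventually (\<lambda>y. u (R *v x\<^sub>0 + b) - \<phi> x\<^sub>0 \<le> u (R *v ?T y + b) - \<phi> (?T y)) (nhds (R *v x\<^sub>0 + b))"
    using m unfolding local_min_at_def filterlim_iff by blast
  then show ?thesis unfolding local_min_at_def inv1 inv2 .
qed

lemma local_max_at_uminus: "local_max_at f x\<^sub>0 \<longleftrightarrow> local_min_at (\<lambda>x. - f x) x\<^sub>0"
  by (simp add: local_max_at_def local_min_at_def)

lemma local_max_at_affine:
  fixes R :: "real ^ 'n ^ 'n"
  assumes R: "orthogonal_matrix R" and m: "local_max_at (\<lambda>x. u (R *v x + b) - \<phi> x) x\<^sub>0"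
  shows "local_max_at (\<lambda>y. u y - \<phi> (transpose R *v y + transpose R *v (- b))) (R *v x\<^sub>0 + b)"
proof -
  have "local_min_at (\<lambda>x. (- u (R *v x + b)) - (- \<phi> x)) x\<^sub>0" using m by (simp add: local_max_at_uminus)
  from local_min_at_affine[OF R this] show ?thesis by (simp add: local_max_at_uminus del: transpose_matrix_vector)
qed

lemma pucci_orthogonal_invariant:
  fixes Q H :: "real ^ 'n ^ 'n"
  assumes "orthogonal_matrix Q"
  shows "pucci_plus l L (Q ** H ** transpose Q) = pucci_plus l L H"
    and "pucci_minus l L (Q ** H ** transpose Q) = pucci_minus l L H"
proof -
  have "Q ** transpose Q = mat 1" using assms by (simp add: orthogonal_matrix_def)
  then have "eigenvalues (Q ** H ** transpose Q) = eigenvalues H"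
    unfolding eigenvalues_def by (simp add: charpoly_similar)
  then show "pucci_plus l L (Q ** H ** transpose Q) = pucci_plus l L H"
    "pucci_minus l L (Q ** H ** transpose Q) = pucci_minus l L H"
    by (simp_all add: pucci_plus_def pucci_minus_def)
qed

lemma viscosity_solution_isometry:
  fixes R :: "real ^ 'n ^ 'n" and G :: "real ^ 'n ^ 'n \<Rightarrow> real"
  assumes R: "orthogonal_matrix R"
    and G: "\<And>H. G (R ** H ** transpose R) = G H"
    and u: "viscosity_solution G p u"
  shows "viscosity_solution G p (\<lambda>x. u (R *v x + b))"
proof -
  have inv: "transpose R *v (R *v x + b) + transpose R *v (- b) = x" for x
    using R by (simp add: matrix_vector_right_distrib[symmetric] matrix_vector_mul_assoc orthogonal_matrix_def
        del: transpose_matrix_vector)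
  have "continuous_on UNIV u" using u by (simp add: viscosity_solution_def viscosity_subsolution_def)
  moreover have "continuous_on UNIV (\<lambda>x. R *v x + b)"
    by (intro continuous_on_add continuous_on_const linear_continuous_on matrix_vector_mul_bounded_linear)
  ultimately have c: "continuous_on UNIV (\<lambda>x. u (R *v x + b))" by (rule continuous_on_compose2) auto
  have test: "C2_with_hessian (\<lambda>y. \<phi> (transpose R *v y + transpose R *v (- b)))
      (\<lambda>y. R ** H (transpose R *v y + transpose R *v (- b)) ** transpose R)"
    if h: "C2_with_hessian \<phi> H" for \<phi> H
  proof -
    obtain g where "C2_jet \<phi> g H" using h by (rule C2_with_hessianE)
    from C2_jet_hessian[OF C2_jet_affine[OF this, of "transpose R" "transpose R *v (- b)"]]
    show ?thesis by (simp only: transpose_transpose)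
  qed
  have "viscosity_supersolution G p (\<lambda>x. u (R *v x + b))" unfolding viscosity_supersolution_def
  proof (intro conjI c allI impI, elim conjE)
    fix \<phi> H x\<^sub>0 assume h: "C2_with_hessian \<phi> H" and m: "local_min_at (\<lambda>x. u (R *v x + b) - \<phi> x) x\<^sub>0"
    have "G (R ** H (transpose R *v (R *v x\<^sub>0 + b) + transpose R *v (- b)) ** transpose R) + u (R *v x\<^sub>0 + b) powr p \<le> 0"
      using u test[OF h] local_min_at_affine[OF R m]
      unfolding viscosity_solution_def viscosity_supersolution_def by blast
    then show "G (H x\<^sub>0) + u (R *v x\<^sub>0 + b) powr p \<le> 0" unfolding inv G .
  qed
  moreover have "viscosity_subsolution G p (\<lambda>x. u (R *v x + b))" unfolding viscosity_subsolution_def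
  proof (intro conjI c allI impI, elim conjE)
    fix \<phi> H x\<^sub>0 assume h: "C2_with_hessian \<phi> H" and m: "local_max_at (\<lambda>x. u (R *v x + b) - \<phi> x) x\<^sub>0"
    have "G (R ** H (transpose R *v (R *v x\<^sub>0 + b) + transpose R *v (- b)) ** transpose R) + u (R *v x\<^sub>0 + b) powr p \<ge> 0"
      using u test[OF h] local_max_at_affine[OF R m]
      unfolding viscosity_solution_def viscosity_subsolution_def by blast
    then show "G (H x\<^sub>0) + u (R *v x\<^sub>0 + b) powr p \<ge> 0" unfolding inv G .
  qed
  ultimately show ?thesis by (simp add: viscosity_solution_def)
qed

lemma reflect_affine:
  fixes e :: "real ^ 'n"
  assumes e: "norm e = 1"
  obtains R b where "orthogonal_matrix R" "\<And>x. reflect e \<mu> x = R *v x + b"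
proof
  define R where "R = mat 1 - 2 *\<^sub>R outer e e"
  have Rv: "R *v x = reflect e 0 x" for x
    by (simp add: R_def reflect_def matrix_vector_mult_diff_rdistrib scaleR_matrix_vector_assoc[symmetric] outer_mult)
  have "transpose R = R" by (simp add: R_def transpose_diff transpose_scaleR transpose_outer transpose_mat)
  moreover have "R ** R = mat 1"
    unfolding matrix_eq by (simp add: matrix_vector_mul_assoc[symmetric] Rv reflect_reflect[OF e])
  ultimately show "orthogonal_matrix R" by (simp add: orthogonal_matrix)
  show "reflect e \<mu> x = R *v x + (2 * \<mu>) *\<^sub>R e" for x
    by (simp add: Rv) (simp add: reflect_def algebra_simps)
qed

lemma dist_reflect:
  assumes e: "norm e = 1"
  shows "dist (reflect e \<mu> x) (reflect e \<mu> y) = dist x y"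
proof -
  have ee: "e \<bullet> e = 1" using e by (simp add: norm_eq_1)
  define d where "d = x - y"
  have "reflect e \<mu> x - reflect e \<mu> y = d - (2 * (e \<bullet> d)) *\<^sub>R e"
    by (simp add: reflect_def d_def vec_eq_iff inner_diff_right algebra_simps)
  moreover have "(d - (2 * (e \<bullet> d)) *\<^sub>R e) \<bullet> (d - (2 * (e \<bullet> d)) *\<^sub>R e) = d \<bullet> d"
    by (simp add: inner_diff_left inner_diff_right ee inner_commute[of d e] algebra_simps)
  ultimately show ?thesis by (simp add: dist_norm norm_eq_sqrt_inner d_def)
qed

lemma vanishing_at_infinity_imp_uniformly_continuous:
  fixes f :: "'a::euclidean_space \<Rightarrow> real"
  assumes f: "continuous_on UNIV f" and v: "\<And>\<epsilon>. 0 < \<epsilon> \<Longrightarrow> \<exists>R. \<forall>x. R \<le> norm x \<longrightarrow> \<bar>f x\<bar> \<le> \<epsilon>"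
  shows "uniformly_continuous_on UNIV f" and "\<exists>B. \<forall>x. \<bar>f x\<bar> \<le> B"
proof -
  show "uniformly_continuous_on UNIV f" unfolding uniformly_continuous_on_def
  proof (intro allI impI)
    fix \<epsilon> :: real assume \<epsilon>: "\<epsilon> > 0"
    obtain R where R: "\<And>x. R \<le> norm x \<Longrightarrow> \<bar>f x\<bar> \<le> \<epsilon> / 3" using v[of "\<epsilon> / 3"] \<epsilon> by auto
    have "uniformly_continuous_on (cball 0 (R + 1)) f"
      by (intro compact_uniformly_continuous continuous_on_subset[OF f] compact_cball) auto
    then obtain d where d: "d > 0" "\<And>x x'. x \<in> cball 0 (R + 1) \<Longrightarrow> x' \<in> cball 0 (R + 1) \<Longrightarrow> dist x' x < d \<Longrightarrow> dist (f x') (f x) < \<epsilon>"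
      unfolding uniformly_continuous_on_def using \<epsilon> by metis
    show "\<exists>d>0. \<forall>x\<in>UNIV. \<forall>x'\<in>UNIV. dist x' x < d \<longrightarrow> dist (f x') (f x) < \<epsilon>"
    proof (intro exI[of _ "min 1 d"] conjI ballI impI)
      fix x x' :: 'a assume dd: "dist x' x < min 1 d"
      show "dist (f x') (f x) < \<epsilon>"
      proof (cases "norm x \<le> R + 1 \<and> norm x' \<le> R + 1")
        case True
        then show ?thesis using d(2)[of x x'] dd by simp
      next
        case False
        have "norm x' \<le> norm x + dist x' x" "norm x \<le> norm x' + dist x' x"
          by (metis dist_norm norm_triangle_sub add.commute norm_minus_commute)+
        then have "R \<le> norm x" "R \<le> norm x'" using False dd by auto
        then show ?thesis using R[of x] R[of x'] \<epsilon> unfolding dist_real_def by linarith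
      qed
    qed (use d in simp)
  qed
  obtain R where R: "\<And>x. R \<le> norm x \<Longrightarrow> \<bar>f x\<bar> \<le> 1" using v[of 1] by auto
  have "compact (f ` cball 0 R)" by (intro compact_continuous_image compact_cball continuous_on_subset[OF f]) auto
  then have "bounded (f ` cball 0 R)" by (rule compact_imp_bounded)
  then obtain M where M: "\<And>x. x \<in> cball 0 R \<Longrightarrow> \<bar>f x\<bar> \<le> M"
    unfolding bounded_iff by (metis imageI real_norm_def)
  have "\<bar>f x\<bar> \<le> max 1 M" for x using R[of x] M[of x] by (cases "R \<le> norm x") auto
  then show "\<exists>B. \<forall>x. \<bar>f x\<bar> \<le> B" by blast
qed

lemma reflected_difference_plus:
  fixes u :: "real ^ 'n \<Rightarrow> real"
  assumes l: "0 < l" "l \<le> L"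
    and u: "uniformly_continuous_on UNIV u" "\<And>x. \<bar>u x\<bar> \<le> B"
    and up: "uniformly_continuous_on UNIV (\<lambda>x. u x powr p)" "\<And>x. \<bar>u x powr p\<bar> \<le> B'"
    and sol: "viscosity_solution (pucci_plus l L) p u" "viscosity_solution (pucci_plus l L) p (\<lambda>x. u (reflect e \<mu> x))"
    and e: "norm e = 1" and j: "C2_jet \<phi> g H" and sym: "\<And>x. transpose (H x) = H x"
    and m: "local_min_at (\<lambda>x. (u (reflect e \<mu> x) - u x) - \<phi> x) x\<^sub>0"
  shows "u (reflect e \<mu> x\<^sub>0) powr p - u x\<^sub>0 powr p \<le> pucci_plus l L (- H x\<^sub>0)"
proof -
  have uc: "uniformly_continuous_on UNIV (\<lambda>x. f (reflect e \<mu> x))" if "uniformly_continuous_on UNIV f" for f :: "real ^ 'n \<Rightarrow> real"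
    using that unfolding uniformly_continuous_on_def by (metis UNIV_I dist_reflect[OF e])
  have super: "pucci_supersolution l L (\<lambda>x. u (reflect e \<mu> x) powr p) (\<lambda>x. u (reflect e \<mu> x))"
    using sol(2) unfolding pucci_supersolution_def viscosity_solution_def viscosity_supersolution_def
    by (blast intro: C2_jet_hessian)
  have sub: "pucci_subsolution l L (\<lambda>x. u x powr p) u"
    using sol(1) unfolding pucci_subsolution_def viscosity_solution_def viscosity_subsolution_def
    by (blast intro: C2_jet_hessian)
  have "- pucci_plus l L (- H x\<^sub>0) + u (reflect e \<mu> x\<^sub>0) powr p - u x\<^sub>0 powr p \<le> 0"
    by (rule difference_is_supersolution[OF l uc[OF u(1)] u(2) uc[OF up(1)] up(2) super
          uniformly_continuous_imp_continuous[OF u(1)] uniformly_continuous_imp_continuous[OF up(1)] sub j sym m])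
  then show ?thesis by simp
qed

text \<open>Since \<open>- u\<close> and \<open>- (u \<circ> \<sigma>)\<close> solve an equation for \<open>\<M>\<^sup>+\<close>, with supersolutions and subsolutions exchanged, the
difference \<open>u \<circ> \<sigma> - u = (- u) - (- (u \<circ> \<sigma>))\<close> satisfies the same inequality as for \<open>\<M>\<^sup>+\<close>.\<close>
lemma reflected_difference_minus:
  fixes u :: "real ^ 'n \<Rightarrow> real"
  assumes l: "0 < l" "l \<le> L"
    and u: "uniformly_continuous_on UNIV u" "\<And>x. \<bar>u x\<bar> \<le> B"
    and up: "uniformly_continuous_on UNIV (\<lambda>x. u x powr p)" "\<And>x. \<bar>u x powr p\<bar> \<le> B'"
    and sol: "viscosity_solution (pucci_minus l L) p u" "viscosity_solution (pucci_minus l L) p (\<lambda>x. u (reflect e \<mu> x))"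
    and e: "norm e = 1" and j: "C2_jet \<phi> g H" and sym: "\<And>x. transpose (H x) = H x"
    and m: "local_min_at (\<lambda>x. (u (reflect e \<mu> x) - u x) - \<phi> x) x\<^sub>0"
  shows "u (reflect e \<mu> x\<^sub>0) powr p - u x\<^sub>0 powr p \<le> pucci_plus l L (- H x\<^sub>0)"
proof -
  have uc: "continuous_on UNIV (\<lambda>x. f (reflect e \<mu> x))" if "uniformly_continuous_on UNIV f" for f :: "real ^ 'n \<Rightarrow> real"
    by (rule continuous_on_compose2[OF uniformly_continuous_imp_continuous[OF that] continuous_on_reflect]) simp
  have neg: "uniformly_continuous_on UNIV (\<lambda>x. - f x)" if "uniformly_continuous_on UNIV f" for f :: "real ^ 'n \<Rightarrow> real"
    using uniformly_continuous_on_minus[OF that] .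
  have pm: "pucci_minus l L (- X) = - pucci_plus l L X" if "transpose X = X" for X :: "real ^ 'n ^ 'n"
    using pucci_minus_eq[of "- X"] that by (simp add: transpose_minus)
  have super: "pucci_supersolution l L (\<lambda>x. - (v x powr p)) (\<lambda>x. - v x)" if v: "viscosity_solution (pucci_minus l L) p v" for v :: "real ^ 'n \<Rightarrow> real"
    unfolding pucci_supersolution_def
  proof (intro allI impI, elim conjE)
    fix \<phi> g H x\<^sub>0 assume j: "C2_jet \<phi> g H" and sym: "\<forall>x. transpose (H x) = (H x :: real ^ 'n ^ 'n)"
      and m: "local_min_at (\<lambda>x. - v x - \<phi> x) x\<^sub>0"
    have "local_max_at (\<lambda>x. v x - (- \<phi> x)) x\<^sub>0" using m by (simp add: local_max_at_uminus diff_minus_eq_add minus_add_distrib add.commute[of "- v _"])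
    then have "pucci_minus l L (- H x\<^sub>0) + v x\<^sub>0 powr p \<ge> 0"
      using v C2_jet_hessian[OF C2_jet_minus[OF j]] unfolding viscosity_solution_def viscosity_subsolution_def by blast
    then show "pucci_plus l L (H x\<^sub>0) + - (v x\<^sub>0 powr p) \<le> 0" using pm sym by simp
  qed
  have sub: "pucci_subsolution l L (\<lambda>x. - (v x powr p)) (\<lambda>x. - v x)" if v: "viscosity_solution (pucci_minus l L) p v" for v :: "real ^ 'n \<Rightarrow> real"
    unfolding pucci_subsolution_def
  proof (intro allI impI, elim conjE)
    fix \<phi> g H x\<^sub>0 assume j: "C2_jet \<phi> g H" and sym: "\<forall>x. transpose (H x) = (H x :: real ^ 'n ^ 'n)"
      and m: "local_max_at (\<lambda>x. - v x - \<phi> x) x\<^sub>0"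
    have "local_min_at (\<lambda>x. v x - (- \<phi> x)) x\<^sub>0" using m by (simp add: local_max_at_uminus add.commute)
    then have "pucci_minus l L (- H x\<^sub>0) + v x\<^sub>0 powr p \<le> 0"
      using v C2_jet_hessian[OF C2_jet_minus[OF j]] unfolding viscosity_solution_def viscosity_supersolution_def by blast
    then show "pucci_plus l L (H x\<^sub>0) + - (v x\<^sub>0 powr p) \<ge> 0" using pm sym by simp
  qed
  have "local_min_at (\<lambda>x. (- u x - - u (reflect e \<mu> x)) - \<phi> x) x\<^sub>0" using m by simp
  then have "- pucci_plus l L (- H x\<^sub>0) + - (u x\<^sub>0 powr p) - - (u (reflect e \<mu> x\<^sub>0) powr p) \<le> 0"
    using difference_is_supersolution[OF l neg[OF u(1)] _ neg[OF up(1)] _ super[OF sol(1)]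
          continuous_on_minus[OF uc[OF u(1)]] continuous_on_minus[OF uc[OF up(1)]] sub[OF sol(2)] j sym, of B B' x\<^sub>0] u(2) up(2)
    by simp
  then show ?thesis by simp
qed

lemma decay_dominates:
  assumes s: "0 < s" "s \<le> q" and x: "1 \<le> norm x"
  shows "2 powr (- (s / 2)) * norm x powr (- q) \<le> decay s x"
proof -
  have "norm x powr (- q) \<le> norm x powr (- s)" using s x by (intro powr_mono) auto
  moreover have "(norm x)\<^sup>2 powr (- (s / 2)) = norm x powr (- s)"
    using x by (simp add: powr_powr flip: powr_numeral)
  moreover have "(2 * (norm x)\<^sup>2) powr (- (s / 2)) = 2 powr (- (s / 2)) * (norm x)\<^sup>2 powr (- (s / 2))"
    by (rule powr_mult)
  moreover have "(2 * (norm x)\<^sup>2) powr (- (s / 2)) \<le> decay s x"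
    unfolding decay_def using s x one_le_power[OF x, of 2] by (intro powr_mono2') (auto simp: add_pos_nonneg)
  ultimately show ?thesis by (metis mult_left_mono order_trans powr_ge_zero)
qed

text \<open>The exponent \<open>s\<close> of the barrier is limited in two ways: \<open>s \<le> 2 / (p - 1)\<close> makes \<open>u\<close> decay faster than the barrier, and
\<open>s < n\<^sup>* - 2\<close> makes \<open>\<kappa>\<close> positive.\<close>
lemma decaying_solution_contradiction:
  fixes u :: "real ^ 'n \<Rightarrow> real" and G :: "real ^ 'n ^ 'n \<Rightarrow> real"
  assumes l: "0 < l" "l \<le> L" and n: "2 < n_upper l L (real CARD('n))" and p: "1 < p"
    and G: "G = pucci_plus l L \<or> G = pucci_minus l L"
    and norad: "no_radial_solution G p"
    and u: "viscosity_solution G p u" "\<forall>x. 0 \<le> u x" "\<exists>x. u x \<noteq> 0"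
    and o: "u \<in> o[at_infinity](\<lambda>x. norm x powr (- (2 / (p - 1))))"
  shows False
proof -
  have Ginv: "G (Q ** H ** transpose Q) = G H" if "orthogonal_matrix Q" for Q H
    using G pucci_orthogonal_invariant[OF that] by auto
  define q where "q = 2 / (p - 1)"
  define N where "N = real CARD('n)"
  define s where "s = min q ((l / L * (N - 1) - 1) / 2)"
  define \<kappa> where "\<kappa> = (N - 1) * l - (s + 1) * L"
  have L0: "L > 0" using l by simp
  have q: "q > 0" using p by (simp add: q_def)
  have n1: "1 < l / L * (N - 1)" using n by (simp add: n_upper_def N_def)
  have s: "0 < s" "s \<le> q" using q n1 by (simp_all add: s_def)
  have "s \<le> (l / L * (N - 1) - 1) / 2" by (simp only: s_def min.cobounded2)
  moreover have "s + 1 < X" if "s \<le> (X - 1) / 2" "1 < X" for X using that by simp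
  ultimately have s1: "s + 1 < l / L * (N - 1)" using n1 by blast
  have \<kappa>: "\<kappa> > 0"
  proof -
    have "(s + 1) * L < l / L * (N - 1) * L" using s1 L0 by (rule mult_strict_right_mono)
    then show ?thesis using L0 by (simp add: \<kappa>_def mult.commute)
  qed
  have far: "\<exists>R\<ge>1. \<forall>x. R \<le> norm x \<longrightarrow> u x \<le> c * norm x powr (- q)" if c: "c > 0" for c
  proof -
    have "eventually (\<lambda>x. norm (u x) \<le> c * norm (norm x powr (- q))) at_infinity"
      using landau_o.smallD[OF o c] by (simp add: q_def)
    then obtain b where "\<And>x. b \<le> norm x \<Longrightarrow> norm (u x) \<le> c * norm (norm x powr (- q))"
      unfolding eventually_at_infinity by blast
    then show ?thesis using u(2) by (intro exI[of _ "max 1 b"]) auto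
  qed
  have decays: "\<exists>R. \<forall>x. R \<le> norm x \<longrightarrow> u x \<le> \<epsilon> * decay s x" if \<epsilon>: "0 < \<epsilon>" for \<epsilon>
  proof -
    have "0 < \<epsilon> * 2 powr (- (s / 2))" using \<epsilon> by simp
    from far[OF this] obtain R where R: "R \<ge> 1" "\<And>x. R \<le> norm x \<Longrightarrow> u x \<le> \<epsilon> * 2 powr (- (s / 2)) * norm x powr (- q)" by blast
    have "u x \<le> \<epsilon> * decay s x" if "R \<le> norm x" for x
    proof -
      have "\<epsilon> * (2 powr (- (s / 2)) * norm x powr (- q)) \<le> \<epsilon> * decay s x"
        using decay_dominates[OF s(1,2), of x] that R(1) \<epsilon> by (intro mult_left_mono) auto
      then show ?thesis using R(2)[OF that] by (simp add: mult.assoc)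
    qed
    then show ?thesis by blast
  qed
  have potential: "\<exists>R. \<forall>x. R \<le> norm x \<longrightarrow> 2 * p * u x powr (p - 1) < s * \<kappa> / (1 + (norm x)\<^sup>2)"
  proof -
    \<comment> \<open>with this constant the potential is at most half of the admissible size once \<open>norm x \<ge> 1\<close>\<close>
    define c where "c = (s * \<kappa> / (8 * p)) powr (1 / (p - 1))"
    have k: "s * \<kappa> / (8 * p) > 0" using s \<kappa> p by simp
    then have c: "c > 0" "c powr (p - 1) = s * \<kappa> / (8 * p)"
      using p s \<kappa> by (simp_all add: c_def powr_powr)
    obtain R where R: "R \<ge> 1" "\<And>x. R \<le> norm x \<Longrightarrow> u x \<le> c * norm x powr (- q)" using far[OF c(1)] by blast
    have "2 * p * u x powr (p - 1) < s * \<kappa> / (1 + (norm x)\<^sup>2)" if x: "R \<le> norm x" for x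
    proof -
      have x1: "1 \<le> norm x" using x R by simp
      have "u x powr (p - 1) \<le> (c * norm x powr (- q)) powr (p - 1)"
        using R(2)[OF x] u(2) p by (intro powr_mono2) auto
      also have "\<dots> = c powr (p - 1) * (norm x powr (- q)) powr (p - 1)" by (rule powr_mult)
      also have "(norm x powr (- q)) powr (p - 1) = 1 / (norm x)\<^sup>2"
      proof -
        have "- q * (p - 1) = - (2 / (p - 1) * (p - 1))" by (simp add: q_def)
        also have "\<dots> = - 2" using p by (subst nonzero_divide_eq_eq[THEN iffD1]) auto
        finally have "- q * (p - 1) = - 2" .
        then have "(norm x powr (- q)) powr (p - 1) = norm x powr (- 2)" by (simp add: powr_powr)
        also have "\<dots> = 1 / (norm x)\<^sup>2" using x1 by (simp add: powr_minus divide_inverse)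
        finally show ?thesis .
      qed
      finally have "2 * p * u x powr (p - 1) \<le> 2 * p * (s * \<kappa> / (8 * p) * (1 / (norm x)\<^sup>2))"
        using p c(2) by (intro mult_left_mono) auto
      also have "\<dots> = s * \<kappa> * (1 / (4 * (norm x)\<^sup>2))" using p by simp
      also have "\<dots> < s * \<kappa> * (1 / (1 + (norm x)\<^sup>2))"
      proof (rule mult_strict_left_mono)
        have "1 \<le> (norm x)\<^sup>2" using x1 by simp
        then show "1 / (4 * (norm x)\<^sup>2) < 1 / (1 + (norm x)\<^sup>2)"
          by (intro divide_strict_left_mono mult_pos_pos) linarith+
      qed (use s \<kappa> in simp)
      finally show ?thesis by simp
    qed
    then show ?thesis by blast
  qed
  have uc: "continuous_on UNIV u" using u(1) by (simp add: viscosity_solution_def viscosity_subsolution_def)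
  have v: "\<exists>R. \<forall>x. R \<le> norm x \<longrightarrow> \<bar>u x\<bar> \<le> \<epsilon>" if "0 < \<epsilon>" for \<epsilon>
  proof -
    have "\<epsilon> * decay s x \<le> \<epsilon>" for x :: "real ^ 'n" using that decay_le_one[OF s(1), of x] by (simp add: mult_left_le)
    then show ?thesis using decays[OF that] u(2) by (metis abs_of_nonneg order_trans)
  qed
  have vp: "\<exists>R. \<forall>x. R \<le> norm x \<longrightarrow> \<bar>u x powr p\<bar> \<le> \<epsilon>" if "0 < \<epsilon>" for \<epsilon>
  proof -
    obtain R where R: "\<And>x. R \<le> norm x \<Longrightarrow> \<bar>u x\<bar> \<le> min 1 \<epsilon>" using v[of "min 1 \<epsilon>"] \<open>0 < \<epsilon>\<close> by auto
    have "\<bar>u x powr p\<bar> \<le> \<epsilon>" if "R \<le> norm x" for x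
    proof (cases "u x = 0")
      case False
      then have "0 < u x" using u(2) by (simp add: less_le)
      then have "u x powr p \<le> u x" using R[OF that] p by (intro powr_le_one_le) auto
      then show ?thesis using R[OF that] \<open>0 < u x\<close> by simp
    qed (use \<open>0 < \<epsilon>\<close> p in simp)
    then show ?thesis by blast
  qed
  have upc: "continuous_on UNIV (\<lambda>x. u x powr p)" using uc u(2) p by (intro continuous_on_powr' continuous_on_const) auto
  note uu = vanishing_at_infinity_imp_uniformly_continuous[OF uc v]
  note pp = vanishing_at_infinity_imp_uniformly_continuous[OF upc vp]
  obtain B where B: "\<And>x. \<bar>u x\<bar> \<le> B" using uu(2) by blast
  obtain B' where B': "\<And>x. \<bar>u x powr p\<bar> \<le> B'" using pp(2) by blast
  interpret moving_planes u l L p s \<kappa>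
  proof
    show "0 < l" "l \<le> L" "1 < p" "0 < s" "0 < \<kappa>" by fact+
    show "\<kappa> = (real CARD('n) - 1) * l - (s + 1) * L" by (simp add: \<kappa>_def N_def)
    show "0 \<le> u x" for x using u(2) by simp
    show "\<exists>x. u x \<noteq> 0" by fact
    show "uniformly_continuous_on UNIV u" by (rule uu(1))
    show "\<exists>R. \<forall>x. R \<le> norm x \<longrightarrow> u x \<le> \<epsilon> * decay s x" if "0 < \<epsilon>" for \<epsilon> by (rule decays[OF that])
    show "\<exists>R. \<forall>x. R \<le> norm x \<longrightarrow> 2 * p * u x powr (p - 1) < s * \<kappa> / (1 + (norm x)\<^sup>2)" by (rule potential)
    fix e :: "real ^ 'n" and \<mu> \<phi> g H x\<^sub>0
    assume e: "norm e = 1" and j: "C2_jet \<phi> g H" and sym: "\<And>x. transpose (H x) = H x"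
      and m: "local_min_at (\<lambda>x. (u (reflect e \<mu> x) - u x) - \<phi> x) x\<^sub>0"
    obtain R b where R: "orthogonal_matrix R" "\<And>x. reflect e \<mu> x = R *v x + b" using reflect_affine[OF e] by blast
    have "viscosity_solution G p (\<lambda>x. u (reflect e \<mu> x))"
      unfolding R(2) by (rule viscosity_solution_isometry[OF R(1) Ginv[OF R(1)] u(1)])
    then show "u (reflect e \<mu> x\<^sub>0) powr p - u x\<^sub>0 powr p \<le> pucci_plus l L (- H x\<^sub>0)"
      using G u(1) reflected_difference_plus[OF l uu(1) B pp(1) B' _ _ e j sym m]
        reflected_difference_minus[OF l uu(1) B pp(1) B' _ _ e j sym m] by auto
  qed
  obtain c where c: "\<And>x y. norm x = norm y \<Longrightarrow> u (x + c) = u (y + c)" using radial_about_a_point by blast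
  have one: "orthogonal_matrix (mat 1 :: real ^ 'n ^ 'n)" by (rule orthogonal_matrix_id)
  have "viscosity_solution G p (\<lambda>x. u (x + c))"
    using viscosity_solution_isometry[OF one Ginv[OF one] u(1), of c] by simp
  moreover have "radially_symmetric (\<lambda>x. u (x + c))" unfolding radially_symmetric_def using c by blast
  moreover have "\<exists>x. u (x + c) \<noteq> 0" using u(3) by (metis diff_add_cancel)
  ultimately show False using norad u(2) unfolding no_radial_solution_def by blast
qed

theorem corollary2:
  fixes \<Lambda>\<^sub>1 \<Lambda>\<^sub>2 p_plus p_minus :: real
  assumes "0 < \<Lambda>\<^sub>1" and "\<Lambda>\<^sub>1 \<le> \<Lambda>\<^sub>2"
    and "n_upper \<Lambda>\<^sub>1 \<Lambda>\<^sub>2 (real CARD('n::finite)) > 2"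
  shows "(felmer_quaas_plus TYPE('n) \<Lambda>\<^sub>1 \<Lambda>\<^sub>2 p_plus \<longrightarrow>
         (\<forall>p. 1 < p \<and> p < p_plus \<longrightarrow>
           (\<nexists>u :: real ^ 'n \<Rightarrow> real.
              continuous_on UNIV u \<and>
              viscosity_solution (pucci_plus \<Lambda>\<^sub>1 \<Lambda>\<^sub>2) p u \<and>
              (\<forall>x. u x \<ge> 0) \<and> (\<exists>x. u x \<noteq> 0) \<and>
              u \<in> o[at_infinity](\<lambda>x. norm x powr (- (2 / (p - 1))))))) \<and>
         (felmer_quaas_minus TYPE('n) \<Lambda>\<^sub>1 \<Lambda>\<^sub>2 p_minus \<longrightarrow>
         (\<forall>p. 1 < p \<and> p < p_minus \<longrightarrow>
           (\<nexists>u :: real ^ 'n \<Rightarrow> real.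
              continuous_on UNIV u \<and>
              viscosity_solution (pucci_minus \<Lambda>\<^sub>1 \<Lambda>\<^sub>2) p u \<and>
              (\<forall>x. u x \<ge> 0) \<and> (\<exists>x. u x \<noteq> 0) \<and>
              u \<in> o[at_infinity](\<lambda>x. norm x powr (- (2 / (p - 1)))))))"
proof (intro conjI impI allI notI; elim exE conjE)
  fix p and u :: "real ^ 'n \<Rightarrow> real"
  assume fq: "felmer_quaas_plus TYPE('n) \<Lambda>\<^sub>1 \<Lambda>\<^sub>2 p_plus" and p: "1 < p" "p < p_plus"
    and u: "viscosity_solution (pucci_plus \<Lambda>\<^sub>1 \<Lambda>\<^sub>2) p u" "\<forall>x. 0 \<le> u x" "u \<in> o[at_infinity](\<lambda>x. norm x powr (- (2 / (p - 1))))"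
  fix x assume x: "u x \<noteq> 0"
  have "no_radial_solution (pucci_plus \<Lambda>\<^sub>1 \<Lambda>\<^sub>2 :: real ^ 'n ^ 'n \<Rightarrow> real) p"
    using fq p unfolding felmer_quaas_plus_def Let_def by blast
  then show False
    using decaying_solution_contradiction[OF assms p(1) _ _ u(1,2) _ u(3)] x by blast
next
  fix p and u :: "real ^ 'n \<Rightarrow> real"
  assume fq: "felmer_quaas_minus TYPE('n) \<Lambda>\<^sub>1 \<Lambda>\<^sub>2 p_minus" and p: "1 < p" "p < p_minus"
    and u: "viscosity_solution (pucci_minus \<Lambda>\<^sub>1 \<Lambda>\<^sub>2) p u" "\<forall>x. 0 \<le> u x" "u \<in> o[at_infinity](\<lambda>x. norm x powr (- (2 / (p - 1))))"
  fix x assume x: "u x \<noteq> 0"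
  have "no_radial_solution (pucci_minus \<Lambda>\<^sub>1 \<Lambda>\<^sub>2 :: real ^ 'n ^ 'n \<Rightarrow> real) p"
    using fq p unfolding felmer_quaas_minus_def Let_def by blast
  then show False
    using decaying_solution_contradiction[OF assms p(1) _ _ u(1,2) _ u(3)] x by blast
qed

end
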